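(* Let $(X_n,p_{nm})_{n\in\mathbb N}$ be an inverse system of (irreducible) Poisson varieties $X_n$ over $F$ with surjective Poisson transition morphisms $p_{nm}:X_n\to X_m$ ($n\ge m$), and let $(X=\varprojlim X_n,\mathcal O_X)$ be the corresponding provariety. Then the structure sheaf $\mathcal O_X$ is a sheaf of Poisson algebras. (Such an $X$ is called a Poisson provariety.)
   Context: $F$ is an algebraically closed field of characteristic zero. A Poisson variety is a variety whose structure sheaf is a sheaf of Poisson algebras (each $\mathcal O(U)$ is a Poisson algebra and restrictions are Poisson homomorphisms); a morphism $\phi$ of Poisson varieties is Poisson if $\phi^\sharp$ is a morphism of sheaves of Poisson algebras. Provariety: for an inverse system $\{(X_n,p_{nm})\}_{n\in\mathbb N}$ of irreducible varieties over $F$ with surjective transition morphisms, $X=\varprojlim X_n$ with projections $p_n:X\to X_n$ has the inverse limit topology, with basis $\mathcal B=\{p_n^{-1}(U_n):n\in\mathbb N,\ U_n\subseteq X_n\text{ open}\}$. For $U=p_n^{-1}(U_n)\in\mathcal B$ put $\widetilde{\mathcal O}_X(U)=\varinjlim_{k\ge n}p_k^*\mathcal O_{X_k}(p_{kn}^{-1}(U_n))$ ($p_k^*$ is pullback of functions along $p_k$), with the natural restriction maps, and for any open $U\subseteq X$ put $\mathcal O_X(U)=\varprojlim_{V\subseteq U,\,V\in\mathcal B}\widetilde{\mathcal O}_X(V)$. The Poisson bracket on $\mathcal O_X$ is the one induced by the brackets on the $\mathcal O_{X_k}$ through these direct and inverse limits. *)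

theory Defs
  imports "HOL-Analysis.Function_Topology" "HOL-Algebra.Algebraic_Closure"
begin

section \<open>Poisson algebras\<close>

record ('a, 'b) poisson = "('a, 'b) module" +
  pbracket :: "'b \<Rightarrow> 'b \<Rightarrow> 'b"  (\<open>\<lbrace>_, _\<rbrace>\<index>\<close>)

locale poisson_algebra = algebra F A
  for F :: "('f, 'e) ring_scheme" (structure) and A :: "('f, 's, 'm) poisson_scheme" (structure) +
  assumes pb_closed: "\<lbrakk>x \<in> carrier A; y \<in> carrier A\<rbrakk> \<Longrightarrow> \<lbrace>x, y\<rbrace>\<^bsub>A\<^esub> \<in> carrier A"
    and pb_add_left: "\<lbrakk>x \<in> carrier A; y \<in> carrier A; z \<in> carrier A\<rbrakk>
          \<Longrightarrow> \<lbrace>x \<oplus>\<^bsub>A\<^esub> y, z\<rbrace>\<^bsub>A\<^esub> = \<lbrace>x, z\<rbrace>\<^bsub>A\<^esub> \<oplus>\<^bsub>A\<^esub> \<lbrace>y, z\<rbrace>\<^bsub>A\<^esub>"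
    and pb_add_right: "\<lbrakk>x \<in> carrier A; y \<in> carrier A; z \<in> carrier A\<rbrakk>
          \<Longrightarrow> \<lbrace>x, y \<oplus>\<^bsub>A\<^esub> z\<rbrace>\<^bsub>A\<^esub> = \<lbrace>x, y\<rbrace>\<^bsub>A\<^esub> \<oplus>\<^bsub>A\<^esub> \<lbrace>x, z\<rbrace>\<^bsub>A\<^esub>"
    and pb_smult_left: "\<lbrakk>c \<in> carrier F; x \<in> carrier A; y \<in> carrier A\<rbrakk>
          \<Longrightarrow> \<lbrace>c \<odot>\<^bsub>A\<^esub> x, y\<rbrace>\<^bsub>A\<^esub> = c \<odot>\<^bsub>A\<^esub> \<lbrace>x, y\<rbrace>\<^bsub>A\<^esub>"
    and pb_smult_right: "\<lbrakk>c \<in> carrier F; x \<in> carrier A; y \<in> carrier A\<rbrakk>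
          \<Longrightarrow> \<lbrace>x, c \<odot>\<^bsub>A\<^esub> y\<rbrace>\<^bsub>A\<^esub> = c \<odot>\<^bsub>A\<^esub> \<lbrace>x, y\<rbrace>\<^bsub>A\<^esub>"
    and pb_alternating: "x \<in> carrier A \<Longrightarrow> \<lbrace>x, x\<rbrace>\<^bsub>A\<^esub> = \<zero>\<^bsub>A\<^esub>"
    and pb_jacobi: "\<lbrakk>x \<in> carrier A; y \<in> carrier A; z \<in> carrier A\<rbrakk>
          \<Longrightarrow> \<lbrace>x, \<lbrace>y, z\<rbrace>\<^bsub>A\<^esub>\<rbrace>\<^bsub>A\<^esub> \<oplus>\<^bsub>A\<^esub> \<lbrace>y, \<lbrace>z, x\<rbrace>\<^bsub>A\<^esub>\<rbrace>\<^bsub>A\<^esub> \<oplus>\<^bsub>A\<^esub> \<lbrace>z, \<lbrace>x, y\<rbrace>\<^bsub>A\<^esub>\<rbrace>\<^bsub>A\<^esub> = \<zero>\<^bsub>A\<^esub>"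
    and pb_leibniz: "\<lbrakk>x \<in> carrier A; y \<in> carrier A; z \<in> carrier A\<rbrakk>
          \<Longrightarrow> \<lbrace>x \<otimes>\<^bsub>A\<^esub> y, z\<rbrace>\<^bsub>A\<^esub> = x \<otimes>\<^bsub>A\<^esub> \<lbrace>y, z\<rbrace>\<^bsub>A\<^esub> \<oplus>\<^bsub>A\<^esub> \<lbrace>x, z\<rbrace>\<^bsub>A\<^esub> \<otimes>\<^bsub>A\<^esub> y"

definition alg_hom :: "('f, 'e) ring_scheme \<Rightarrow> ('f, 's, 'm) module_scheme \<Rightarrow> ('f, 't, 'n) module_scheme
    \<Rightarrow> ('s \<Rightarrow> 't) set" where
  "alg_hom F A B = {h \<in> ring_hom A B.
     \<forall>c\<in>carrier F. \<forall>x\<in>carrier A. h (c \<odot>\<^bsub>A\<^esub> x) = c \<odot>\<^bsub>B\<^esub> h x}"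

definition poisson_hom :: "('f, 'e) ring_scheme \<Rightarrow> ('f, 's, 'm) poisson_scheme \<Rightarrow> ('f, 't, 'n) poisson_scheme
    \<Rightarrow> ('s \<Rightarrow> 't) set" where
  "poisson_hom F A B = {h \<in> alg_hom F A B.
     \<forall>x\<in>carrier A. \<forall>y\<in>carrier A. h \<lbrace>x, y\<rbrace>\<^bsub>A\<^esub> = \<lbrace>h x, h y\<rbrace>\<^bsub>B\<^esub>}"

section \<open>Sheaves of algebras\<close>

text \<open>\<open>sec \<X> U\<close> is the algebra of sections over the open set \<open>U\<close> and \<open>res \<X> U V\<close>, for \<open>V \<subseteq> U\<close>, the
  restriction map. Only the values on open sets, and on carriers, are meaningful.\<close>

record ('a, 's, 'A) sheafed_space =
  topol :: "'a topology"
  sec :: "'a set \<Rightarrow> 'A"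
  res :: "'a set \<Rightarrow> 'a set \<Rightarrow> 's \<Rightarrow> 's"

abbreviation points :: "('a, 's, 'A, 'z) sheafed_space_scheme \<Rightarrow> 'a set" where
  "points \<X> \<equiv> topspace (topol \<X>)"

abbreviation is_open :: "('a, 's, 'A, 'z) sheafed_space_scheme \<Rightarrow> 'a set \<Rightarrow> bool" where
  "is_open \<X> U \<equiv> openin (topol \<X>) U"

definition sheaf_of :: "(('s, 'm) partial_object_scheme \<Rightarrow> bool)
    \<Rightarrow> (('s, 'm) partial_object_scheme \<Rightarrow> ('s, 'm) partial_object_scheme \<Rightarrow> ('s \<Rightarrow> 's) set)
    \<Rightarrow> ('a, 's, ('s, 'm) partial_object_scheme) sheafed_space \<Rightarrow> bool" where
  "sheaf_of Obj Hom \<X> \<longleftrightarrow>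
     (\<forall>U. is_open \<X> U \<longrightarrow> Obj (sec \<X> U)) \<and>
     (\<forall>U V. is_open \<X> U \<and> is_open \<X> V \<and> V \<subseteq> U \<longrightarrow> res \<X> U V \<in> Hom (sec \<X> U) (sec \<X> V)) \<and>
     (\<forall>U. is_open \<X> U \<longrightarrow> (\<forall>s\<in>carrier (sec \<X> U). res \<X> U U s = s)) \<and>
     (\<forall>U V W. is_open \<X> U \<and> is_open \<X> V \<and> is_open \<X> W \<and> W \<subseteq> V \<and> V \<subseteq> U \<longrightarrow>
        (\<forall>s\<in>carrier (sec \<X> U). res \<X> V W (res \<X> U V s) = res \<X> U W s)) \<and>
     (\<forall>\<U> s. (\<forall>V\<in>\<U>. is_open \<X> V \<and> s V \<in> carrier (sec \<X> V)) \<and>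
        (\<forall>V\<in>\<U>. \<forall>W\<in>\<U>. res \<X> V (V \<inter> W) (s V) = res \<X> W (V \<inter> W) (s W)) \<longrightarrow>
        (\<exists>!a. a \<in> carrier (sec \<X> (\<Union>\<U>)) \<and> (\<forall>V\<in>\<U>. res \<X> (\<Union>\<U>) V a = s V)))"

definition sheaf_of_algebras :: "('f, 'e) ring_scheme
    \<Rightarrow> ('a, 's, ('f, 's, 'm) module_scheme) sheafed_space \<Rightarrow> bool" where
  "sheaf_of_algebras F = sheaf_of (algebra F) (alg_hom F)"

definition sheaf_of_poisson_algebras :: "('f, 'e) ring_scheme
    \<Rightarrow> ('a, 's, ('f, 's, 'm) poisson_scheme) sheafed_space \<Rightarrow> bool" where
  "sheaf_of_poisson_algebras F = sheaf_of (poisson_algebra F) (poisson_hom F)"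

section \<open>Varieties\<close>

text \<open>An irreducible variety over \<open>F\<close> is an integral separated scheme of finite type over \<open>F\<close>, so that
  its points include the generic points of its subvarieties. With closed points only, the structure
  sheaf of a provariety over a countable field can fail to be a sheaf.\<close>

definition basic_open :: "('s, 'm) ring_scheme \<Rightarrow> 's \<Rightarrow> 's set set" where
  "basic_open A f = {P. primeideal P A \<and> f \<notin> P}"

definition zariski :: "('s, 'm) ring_scheme \<Rightarrow> 's set topology" where
  "zariski A = topology_generated_by (basic_open A ` carrier A)"

text \<open>\<open>h : A \<rightarrow> B\<close> is the localization of \<open>A\<close> at the powers of \<open>f\<close>.\<close>

definition is_localization :: "('s, 'm) ring_scheme \<Rightarrow> 's \<Rightarrow> ('t, 'n) ring_scheme \<Rightarrow> ('s \<Rightarrow> 't) \<Rightarrow> bool" where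
  "is_localization A f B h \<longleftrightarrow>
     h \<in> ring_hom A B \<and> h f \<in> Units B \<and>
     (\<forall>b\<in>carrier B. \<exists>a\<in>carrier A. \<exists>n::nat. b \<otimes>\<^bsub>B\<^esub> (h f [^]\<^bsub>B\<^esub> n) = h a) \<and>
     (\<forall>a\<in>carrier A. h a = \<zero>\<^bsub>B\<^esub> \<longrightarrow> (\<exists>n::nat. (f [^]\<^bsub>A\<^esub> n) \<otimes>\<^bsub>A\<^esub> a = \<zero>\<^bsub>A\<^esub>))"

text \<open>The structure sheaf of \<open>Spec A\<close> is the sheaf whose restriction maps from \<open>Spec A\<close> to the basic
  open sets \<open>D(f)\<close> are the localizations \<open>A \<rightarrow> A\<^sub>f\<close>. Hence the following says that \<open>\<X>\<close> restricted to
  \<open>U\<close> is isomorphic, as a ringed space, to \<open>Spec A\<close> for \<open>A = sec \<X> U\<close>.\<close>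

definition affine_open :: "('a, 's, ('f, 's, 'm) module_scheme) sheafed_space \<Rightarrow> 'a set \<Rightarrow> bool" where
  "affine_open \<X> U \<longleftrightarrow> is_open \<X> U \<and>
     (\<exists>h. homeomorphic_map (subtopology (topol \<X>) U) (zariski (sec \<X> U)) h \<and>
        (\<forall>f\<in>carrier (sec \<X> U).
           let D = {x \<in> U. h x \<in> basic_open (sec \<X> U) f}
           in is_localization (sec \<X> U) f (sec \<X> D) (res \<X> U D)))"

definition fin_gen_algebra :: "('f, 'e) ring_scheme \<Rightarrow> ('f, 's, 'm) module_scheme \<Rightarrow> bool" where
  "fin_gen_algebra F A \<longleftrightarrow> (\<exists>S. finite S \<and> S \<subseteq> carrier A \<and>
     (\<forall>B. subring B A \<and> (\<forall>c\<in>carrier F. \<forall>b\<in>B. c \<odot>\<^bsub>A\<^esub> b \<in> B) \<and> S \<subseteq> B \<longrightarrow> B = carrier A))"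

text \<open>The diagonal is a closed immersion iff, for all affine open \<open>U\<close> and \<open>V\<close>, the intersection
  \<open>U \<inter> V\<close> is affine and the map from \<open>sec \<X> U \<otimes> sec \<X> V\<close> to \<open>sec \<X> (U \<inter> V)\<close> is surjective. The
  latter says that the images of the two restriction maps generate \<open>sec \<X> (U \<inter> V)\<close> as a ring.\<close>

definition separated :: "('a, 's, ('f, 's, 'm) module_scheme) sheafed_space \<Rightarrow> bool" where
  "separated \<X> \<longleftrightarrow> (\<forall>U V. affine_open \<X> U \<and> affine_open \<X> V \<longrightarrow>
     affine_open \<X> (U \<inter> V) \<and>
     (\<forall>B. subring B (sec \<X> (U \<inter> V)) \<and>
          res \<X> U (U \<inter> V) ` carrier (sec \<X> U) \<subseteq> B \<and>
          res \<X> V (U \<inter> V) ` carrier (sec \<X> V) \<subseteq> B \<longrightarrow> B = carrier (sec \<X> (U \<inter> V))))"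

definition reduced :: "('a, 's, ('f, 's, 'm) module_scheme) sheafed_space \<Rightarrow> bool" where
  "reduced \<X> \<longleftrightarrow> (\<forall>U. is_open \<X> U \<longrightarrow> (\<forall>s\<in>carrier (sec \<X> U). \<forall>n::nat.
     s [^]\<^bsub>sec \<X> U\<^esub> n = \<zero>\<^bsub>sec \<X> U\<^esub> \<longrightarrow> s = \<zero>\<^bsub>sec \<X> U\<^esub>))"

definition variety :: "('f, 'e) ring_scheme
    \<Rightarrow> ('a, 's, ('f, 's, 'm) module_scheme) sheafed_space \<Rightarrow> bool" where
  "variety F \<X> \<longleftrightarrow> sheaf_of_algebras F \<X> \<and>
     (\<exists>\<U>. finite \<U> \<and> \<Union>\<U> = points \<X> \<and> (\<forall>U\<in>\<U>. affine_open \<X> U \<and> fin_gen_algebra F (sec \<X> U))) \<and>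
     separated \<X> \<and> reduced \<X>"

definition irreducible_topology :: "'a topology \<Rightarrow> bool" where
  "irreducible_topology T \<longleftrightarrow> topspace T \<noteq> {} \<and>
     (\<forall>C D. closedin T C \<and> closedin T D \<and> C \<union> D = topspace T \<longrightarrow> C = topspace T \<or> D = topspace T)"

definition irreducible_variety :: "('f, 'e) ring_scheme
    \<Rightarrow> ('a, 's, ('f, 's, 'm) module_scheme) sheafed_space \<Rightarrow> bool" where
  "irreducible_variety F \<X> \<longleftrightarrow> variety F \<X> \<and> irreducible_topology (topol \<X>)"

text \<open>A section is invertible at \<open>x\<close> if its germ in the stalk at \<open>x\<close> is a unit.\<close>

definition invertible_at :: "('a, 's, ('f, 's, 'm) module_scheme) sheafed_space
    \<Rightarrow> 'a set \<Rightarrow> 's \<Rightarrow> 'a \<Rightarrow> bool" where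
  "invertible_at \<X> U s x \<longleftrightarrow> (\<exists>W. is_open \<X> W \<and> x \<in> W \<and> W \<subseteq> U \<and> res \<X> U W s \<in> Units (sec \<X> W))"

definition preimage_on :: "'a set \<Rightarrow> ('a \<Rightarrow> 'b) \<Rightarrow> 'b set \<Rightarrow> 'a set" where
  "preimage_on S f V = {x \<in> S. f x \<in> V}"

text \<open>A morphism \<open>\<X> \<rightarrow> Y\<close> is a pair of a continuous map \<open>f\<close> and a morphism of sheaves \<open>fs\<close> on \<open>Y\<close>, given
  by \<open>fs V : sec Y V \<rightarrow> sec \<X> (f\<^sup>-\<^sup>1 V)\<close>, such that the induced maps of stalks are local.\<close>

definition sheafed_morphism ::
    "(('s, 'm) partial_object_scheme \<Rightarrow> ('s, 'm) partial_object_scheme \<Rightarrow> ('s \<Rightarrow> 's) set)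
     \<Rightarrow> ('a, 's, ('s, 'm) partial_object_scheme) sheafed_space
     \<Rightarrow> ('a, 's, ('s, 'm) partial_object_scheme) sheafed_space
     \<Rightarrow> ('a \<Rightarrow> 'a) \<Rightarrow> ('a set \<Rightarrow> 's \<Rightarrow> 's) \<Rightarrow> bool" where
  "sheafed_morphism Hom \<X> Y f fs \<longleftrightarrow>
     continuous_map (topol \<X>) (topol Y) f \<and>
     (\<forall>V. is_open Y V \<longrightarrow> fs V \<in> Hom (sec Y V) (sec \<X> (preimage_on (points \<X>) f V))) \<and>
     (\<forall>V W. is_open Y V \<and> is_open Y W \<and> W \<subseteq> V \<longrightarrow> (\<forall>s\<in>carrier (sec Y V).
        fs W (res Y V W s) =
        res \<X> (preimage_on (points \<X>) f V) (preimage_on (points \<X>) f W) (fs V s)))"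

definition variety_morphism :: "('f, 'e) ring_scheme
    \<Rightarrow> ('a, 's, ('f, 's, 'm) module_scheme) sheafed_space
    \<Rightarrow> ('a, 's, ('f, 's, 'm) module_scheme) sheafed_space
    \<Rightarrow> ('a \<Rightarrow> 'a) \<Rightarrow> ('a set \<Rightarrow> 's \<Rightarrow> 's) \<Rightarrow> bool" where
  "variety_morphism F \<X> Y f fs \<longleftrightarrow> sheafed_morphism (alg_hom F) \<X> Y f fs \<and>
     (\<forall>V x. is_open Y V \<and> x \<in> points \<X> \<and> f x \<in> V \<longrightarrow> (\<forall>s\<in>carrier (sec Y V).
        invertible_at \<X> (preimage_on (points \<X>) f V) (fs V s) x \<longrightarrow> invertible_at Y V s (f x)))"

definition poisson_variety :: "('f, 'e) ring_scheme
    \<Rightarrow> ('a, 's, ('f, 's, 'm) poisson_scheme) sheafed_space \<Rightarrow> bool" where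
  "poisson_variety F \<X> \<longleftrightarrow> variety F \<X> \<and> sheaf_of_poisson_algebras F \<X>"

definition poisson_morphism :: "('f, 'e) ring_scheme
    \<Rightarrow> ('a, 's, ('f, 's, 'm) poisson_scheme) sheafed_space
    \<Rightarrow> ('a, 's, ('f, 's, 'm) poisson_scheme) sheafed_space
    \<Rightarrow> ('a \<Rightarrow> 'a) \<Rightarrow> ('a set \<Rightarrow> 's \<Rightarrow> 's) \<Rightarrow> bool" where
  "poisson_morphism F \<X> Y f fs \<longleftrightarrow>
     variety_morphism F \<X> Y f fs \<and> sheafed_morphism (poisson_hom F) \<X> Y f fs"

section \<open>Inverse systems and provarieties\<close>

text \<open>The transition morphism \<open>\<X> n \<rightarrow> \<X> m\<close>, for \<open>m \<le> n\<close>, is \<open>p n m\<close> on points and \<open>ps n m\<close> on sections.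
  All members of the system have their points in one type \<open>'a\<close> and their sections in one type \<open>'s\<close>.\<close>

type_synonym ('f, 'a, 's) psystem = "nat \<Rightarrow> ('a, 's, ('f, 's) poisson) sheafed_space"

definition inverse_system :: "('f, 'a, 's) psystem \<Rightarrow> (nat \<Rightarrow> nat \<Rightarrow> 'a \<Rightarrow> 'a)
    \<Rightarrow> (nat \<Rightarrow> nat \<Rightarrow> 'a set \<Rightarrow> 's \<Rightarrow> 's) \<Rightarrow> bool" where
  "inverse_system \<X> p ps \<longleftrightarrow>
     (\<forall>n. (\<forall>x\<in>points (\<X> n). p n n x = x) \<and>
          (\<forall>V. is_open (\<X> n) V \<longrightarrow> (\<forall>s\<in>carrier (sec (\<X> n) V). ps n n V s = s))) \<and>
     (\<forall>k m n. k \<le> m \<and> m \<le> n \<longrightarrow>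
          (\<forall>x\<in>points (\<X> n). p m k (p n m x) = p n k x) \<and>
          (\<forall>V. is_open (\<X> k) V \<longrightarrow> (\<forall>s\<in>carrier (sec (\<X> k) V).
             ps n m (preimage_on (points (\<X> m)) (p m k) V) (ps m k V s) = ps n k V s)))"

definition poisson_system :: "('f, 'e) ring_scheme \<Rightarrow> ('f, 'a, 's) psystem
    \<Rightarrow> (nat \<Rightarrow> nat \<Rightarrow> 'a \<Rightarrow> 'a) \<Rightarrow> (nat \<Rightarrow> nat \<Rightarrow> 'a set \<Rightarrow> 's \<Rightarrow> 's) \<Rightarrow> bool" where
  "poisson_system F \<X> p ps \<longleftrightarrow>
     (\<forall>n. irreducible_variety F (\<X> n) \<and> poisson_variety F (\<X> n)) \<and>
     (\<forall>n m. m \<le> n \<longrightarrow> poisson_morphism F (\<X> n) (\<X> m) (p n m) (ps n m) \<and>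
                        p n m ` points (\<X> n) = points (\<X> m)) \<and>
     inverse_system \<X> p ps"

definition lim_points :: "('f, 'a, 's) psystem \<Rightarrow> (nat \<Rightarrow> nat \<Rightarrow> 'a \<Rightarrow> 'a) \<Rightarrow> (nat \<Rightarrow> 'a) set" where
  "lim_points \<X> p = {x. (\<forall>n. x n \<in> points (\<X> n)) \<and> (\<forall>n m. m \<le> n \<longrightarrow> p n m (x n) = x m)}"

definition lim_topology :: "('f, 'a, 's) psystem \<Rightarrow> (nat \<Rightarrow> nat \<Rightarrow> 'a \<Rightarrow> 'a) \<Rightarrow> (nat \<Rightarrow> 'a) topology" where
  "lim_topology \<X> p = subtopology (product_topology (\<lambda>n. topol (\<X> n)) UNIV) (lim_points \<X> p)"

definition cylinder :: "('f, 'a, 's) psystem \<Rightarrow> (nat \<Rightarrow> nat \<Rightarrow> 'a \<Rightarrow> 'a) \<Rightarrow> nat \<Rightarrow> 'a set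
    \<Rightarrow> (nat \<Rightarrow> 'a) set" where
  "cylinder \<X> p n W = preimage_on (lim_points \<X> p) (\<lambda>x. x n) W"

definition lim_basis :: "('f, 'a, 's) psystem \<Rightarrow> (nat \<Rightarrow> nat \<Rightarrow> 'a \<Rightarrow> 'a) \<Rightarrow> (nat \<Rightarrow> 'a) set set" where
  "lim_basis \<X> p = {cylinder \<X> p n W | n W. is_open (\<X> n) W}"

text \<open>A basic open set \<open>U\<close> may be written as \<open>p\<^sub>n\<^sup>-\<^sup>1(U\<^sub>n)\<close> for several \<open>n\<close>; the least one is used. By
  surjectivity \<open>U\<^sub>n\<close> is then unique, and a larger \<open>n\<close> gives a cofinal part of the same direct system.\<close>

definition level :: "('f, 'a, 's) psystem \<Rightarrow> (nat \<Rightarrow> nat \<Rightarrow> 'a \<Rightarrow> 'a) \<Rightarrow> (nat \<Rightarrow> 'a) set \<Rightarrow> nat" where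
  "level \<X> p U = (LEAST n. \<exists>W. is_open (\<X> n) W \<and> U = cylinder \<X> p n W)"

definition level_open :: "('f, 'a, 's) psystem \<Rightarrow> (nat \<Rightarrow> nat \<Rightarrow> 'a \<Rightarrow> 'a) \<Rightarrow> (nat \<Rightarrow> 'a) set \<Rightarrow> 'a set" where
  "level_open \<X> p U =
     (SOME W. is_open (\<X> (level \<X> p U)) W \<and> U = cylinder \<X> p (level \<X> p U) W)"

definition trace_open :: "('f, 'a, 's) psystem \<Rightarrow> (nat \<Rightarrow> nat \<Rightarrow> 'a \<Rightarrow> 'a) \<Rightarrow> (nat \<Rightarrow> 'a) set \<Rightarrow> nat \<Rightarrow> 'a set" where
  "trace_open \<X> p U k = preimage_on (points (\<X> k)) (p k (level \<X> p U)) (level_open \<X> p U)"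

text \<open>The direct limit of Poisson algebras \<open>D k\<close>, \<open>k \<ge> n\<close>, along transition maps \<open>t k m : D k \<rightarrow> D m\<close>:
  the disjoint union modulo equality at some later stage. An operation applied to two classes is
  computed at any common stage, and the union below is over equal classes.\<close>

definition germ :: "nat \<Rightarrow> (nat \<Rightarrow> ('f, 's) poisson) \<Rightarrow> (nat \<Rightarrow> nat \<Rightarrow> 's \<Rightarrow> 's) \<Rightarrow> nat \<Rightarrow> 's
    \<Rightarrow> (nat \<times> 's) set" where
  "germ n D t k s = {(l, u). n \<le> l \<and> u \<in> carrier (D l) \<and> (\<exists>m. k \<le> m \<and> l \<le> m \<and> t k m s = t l m u)}"

definition direct_limit :: "nat \<Rightarrow> (nat \<Rightarrow> ('f, 's) poisson) \<Rightarrow> (nat \<Rightarrow> nat \<Rightarrow> 's \<Rightarrow> 's)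
    \<Rightarrow> ('f, (nat \<times> 's) set) poisson" where
  "direct_limit n D t =
     \<lparr> carrier = {germ n D t k s | k s. n \<le> k \<and> s \<in> carrier (D k)},
       monoid.mult = (\<lambda>a b. \<Union>{germ n D t k (x \<otimes>\<^bsub>D k\<^esub> y) | k x y. (k, x) \<in> a \<and> (k, y) \<in> b}),
       monoid.one = germ n D t n \<one>\<^bsub>D n\<^esub>,
       ring.zero = germ n D t n \<zero>\<^bsub>D n\<^esub>,
       ring.add = (\<lambda>a b. \<Union>{germ n D t k (x \<oplus>\<^bsub>D k\<^esub> y) | k x y. (k, x) \<in> a \<and> (k, y) \<in> b}),
       module.smult = (\<lambda>c a. \<Union>{germ n D t k (c \<odot>\<^bsub>D k\<^esub> x) | k x. (k, x) \<in> a}),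
       pbracket = (\<lambda>a b. \<Union>{germ n D t k \<lbrace>x, y\<rbrace>\<^bsub>D k\<^esub> | k x y. (k, x) \<in> a \<and> (k, y) \<in> b}) \<rparr>"

text \<open>The inverse limit of Poisson algebras \<open>D V\<close> indexed by sets \<open>V \<in> I\<close>, along maps
  \<open>r V W : D V \<rightarrow> D W\<close> for \<open>W \<subseteq> V\<close>.\<close>

definition inverse_limit :: "'x set set \<Rightarrow> ('x set \<Rightarrow> ('f, 's) poisson) \<Rightarrow> ('x set \<Rightarrow> 'x set \<Rightarrow> 's \<Rightarrow> 's)
    \<Rightarrow> ('f, 'x set \<Rightarrow> 's) poisson" where
  "inverse_limit I D r =
     \<lparr> carrier = {s \<in> (\<Pi>\<^sub>E V\<in>I. carrier (D V)). \<forall>V\<in>I. \<forall>W\<in>I. W \<subseteq> V \<longrightarrow> r V W (s V) = s W},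
       monoid.mult = (\<lambda>s t. \<lambda>V\<in>I. s V \<otimes>\<^bsub>D V\<^esub> t V),
       monoid.one = (\<lambda>V\<in>I. \<one>\<^bsub>D V\<^esub>),
       ring.zero = (\<lambda>V\<in>I. \<zero>\<^bsub>D V\<^esub>),
       ring.add = (\<lambda>s t. \<lambda>V\<in>I. s V \<oplus>\<^bsub>D V\<^esub> t V),
       module.smult = (\<lambda>c s. \<lambda>V\<in>I. c \<odot>\<^bsub>D V\<^esub> s V),
       pbracket = (\<lambda>s t. \<lambda>V\<in>I. \<lbrace>s V, t V\<rbrace>\<^bsub>D V\<^esub>) \<rparr>"

definition stage :: "('f, 'a, 's) psystem \<Rightarrow> (nat \<Rightarrow> nat \<Rightarrow> 'a \<Rightarrow> 'a) \<Rightarrow> (nat \<Rightarrow> 'a) set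
    \<Rightarrow> nat \<Rightarrow> ('f, 's) poisson" where
  "stage \<X> p U k = sec (\<X> k) (trace_open \<X> p U k)"

definition stage_map :: "('f, 'a, 's) psystem \<Rightarrow> (nat \<Rightarrow> nat \<Rightarrow> 'a \<Rightarrow> 'a)
    \<Rightarrow> (nat \<Rightarrow> nat \<Rightarrow> 'a set \<Rightarrow> 's \<Rightarrow> 's) \<Rightarrow> (nat \<Rightarrow> 'a) set \<Rightarrow> nat \<Rightarrow> nat \<Rightarrow> 's \<Rightarrow> 's" where
  "stage_map \<X> p ps U k l = ps l k (trace_open \<X> p U k)"

definition pre_sec :: "('f, 'a, 's) psystem \<Rightarrow> (nat \<Rightarrow> nat \<Rightarrow> 'a \<Rightarrow> 'a)
    \<Rightarrow> (nat \<Rightarrow> nat \<Rightarrow> 'a set \<Rightarrow> 's \<Rightarrow> 's) \<Rightarrow> (nat \<Rightarrow> 'a) set \<Rightarrow> ('f, (nat \<times> 's) set) poisson" where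
  "pre_sec \<X> p ps U = direct_limit (level \<X> p U) (stage \<X> p U) (stage_map \<X> p ps U)"

text \<open>The restriction from \<open>U\<close> to \<open>V \<subseteq> U\<close> takes the class of a section over \<open>trace_open \<X> p U k\<close>, for \<open>k\<close> at
  least the level of \<open>V\<close>, to the class of its restriction to \<open>trace_open \<X> p V k\<close>.\<close>

definition pre_res :: "('f, 'a, 's) psystem \<Rightarrow> (nat \<Rightarrow> nat \<Rightarrow> 'a \<Rightarrow> 'a)
    \<Rightarrow> (nat \<Rightarrow> nat \<Rightarrow> 'a set \<Rightarrow> 's \<Rightarrow> 's) \<Rightarrow> (nat \<Rightarrow> 'a) set \<Rightarrow> (nat \<Rightarrow> 'a) set
    \<Rightarrow> (nat \<times> 's) set \<Rightarrow> (nat \<times> 's) set" where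
  "pre_res \<X> p ps U V a =
     \<Union>{germ (level \<X> p V) (stage \<X> p V) (stage_map \<X> p ps V) k
          (res (\<X> k) (trace_open \<X> p U k) (trace_open \<X> p V k) x) | k x. (k, x) \<in> a \<and> level \<X> p V \<le> k}"

definition provariety :: "('f, 'a, 's) psystem \<Rightarrow> (nat \<Rightarrow> nat \<Rightarrow> 'a \<Rightarrow> 'a)
    \<Rightarrow> (nat \<Rightarrow> nat \<Rightarrow> 'a set \<Rightarrow> 's \<Rightarrow> 's)
    \<Rightarrow> (nat \<Rightarrow> 'a, (nat \<Rightarrow> 'a) set \<Rightarrow> (nat \<times> 's) set,
        ('f, (nat \<Rightarrow> 'a) set \<Rightarrow> (nat \<times> 's) set) poisson) sheafed_space" where
  "provariety \<X> p ps =
     \<lparr> topol = lim_topology \<X> p,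
       sec = (\<lambda>U. inverse_limit {V \<in> lim_basis \<X> p. V \<subseteq> U} (pre_sec \<X> p ps) (pre_res \<X> p ps)),
       res = (\<lambda>U U' s. restrict s {V \<in> lim_basis \<X> p. V \<subseteq> U'}) \<rparr>"

end

(*
  The point is that U |-> pre_sec U is already a sheaf on the basis of cylinders. Compatible sections
  on an infinite cover of a cylinder can be glued in the structure sheaf of a single X_k once finitely
  many of them, all represented at level k, suffice. Such a k exists because an inverse system of
  nonempty locally closed subsets of the X_n has a nonempty limit, and this holds because the X_n are
  Noetherian (Hilbert's basis theorem) and sober (every irreducible closed set has a generic point).
*)

theory Submission
  imports Defs "HOL-Analysis.Abstract_Topological_Spaces"
begin

section \<open>Noetherian algebras of finite type\<close>

text \<open>A section over a basic set is a class in a direct limit, so every member of a compatible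
  family has a level of its own. Nothing bounds these levels, nor the later levels at which two
  members begin to agree, and quasi-compactness of a single \<open>\<X> n\<close> does not help with
  a cover whose members come from unboundedly many levels. The argument therefore turns to the parts
  of the traces left uncovered at each level: were they never empty, a point in their limit would be
  a point of the cylinder that the cover misses. Such a point may exist only as a generic point,
  since it has to satisfy infinitely many conditions at once; hence the role of sobriety. The sets
  reaching a finite cover at one level also leave only finitely many overlaps, so a maximum of
  levels settles all agreements. Hilbert's theorem is proved for subrings of one fixed ring, with
  one generator adjoined at a time, so that the induction stays within a single type.\<close>

definition ideal_within :: "('s, 'm) ring_scheme \<Rightarrow> 's set \<Rightarrow> 's set \<Rightarrow> bool" where
  "ideal_within A B I \<longleftrightarrow> I \<subseteq> B \<and> \<zero>\<^bsub>A\<^esub> \<in> I \<and> (\<forall>x\<in>I. \<forall>y\<in>I. x \<oplus>\<^bsub>A\<^esub> y \<in> I) \<and>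
     (\<forall>b\<in>B. \<forall>x\<in>I. b \<otimes>\<^bsub>A\<^esub> x \<in> I)"

definition noetherian_within :: "('s, 'm) ring_scheme \<Rightarrow> 's set \<Rightarrow> bool" where
  "noetherian_within A B \<longleftrightarrow> (\<forall>I :: nat \<Rightarrow> 's set.
     (\<forall>n. ideal_within A B (I n)) \<and> (\<forall>n. I n \<subseteq> I (Suc n)) \<longrightarrow> (\<exists>n. \<forall>m\<ge>n. I m = I n))"

text \<open>Polynomials in \<open>x\<close> are represented by their values in \<open>A\<close>. As \<open>x\<close> need not be transcendental over
  \<open>B\<close>, neither the degree nor the leading coefficient of a value is determined.\<close>

primrec polys :: "('s, 'm) ring_scheme \<Rightarrow> 's set \<Rightarrow> 's \<Rightarrow> nat \<Rightarrow> 's set" where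
  "polys A B x 0 = {\<zero>\<^bsub>A\<^esub>}"
| "polys A B x (Suc n) = {p \<oplus>\<^bsub>A\<^esub> b \<otimes>\<^bsub>A\<^esub> x [^]\<^bsub>A\<^esub> n | p b. p \<in> polys A B x n \<and> b \<in> B}"

text \<open>\<open>polys A B x n\<close> holds values of degree less than \<open>n\<close>, so
  \<open>b\<close> stands at degree exactly \<open>n\<close>. Every expression with value in
  \<open>I\<close> contributes its coefficient, which makes this an ideal of \<open>B\<close> even
  though a value does not determine its expression.\<close>

definition leading :: "('s, 'm) ring_scheme \<Rightarrow> 's set \<Rightarrow> 's \<Rightarrow> 's set \<Rightarrow> nat \<Rightarrow> 's set" where
  "leading A B x I n = {b \<in> B. \<exists>p\<in>polys A B x n. p \<oplus>\<^bsub>A\<^esub> b \<otimes>\<^bsub>A\<^esub> x [^]\<^bsub>A\<^esub> n \<in> I}"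

locale cring_extension = cring A for A :: "('s, 'm) ring_scheme" (structure) +
  fixes B :: "'s set" and x :: 's
  assumes B: "subring B A" and x [simp, intro]: "x \<in> carrier A"
begin

lemma B_carrier [simp, intro]: "b \<in> B \<Longrightarrow> b \<in> carrier A"
  and B_zero [simp, intro]: "\<zero> \<in> B"
  and B_one [simp, intro]: "\<one> \<in> B"
  and B_minus [simp, intro]: "b \<in> B \<Longrightarrow> \<ominus> b \<in> B"
  and B_mult [simp, intro]: "b \<in> B \<Longrightarrow> c \<in> B \<Longrightarrow> b \<otimes> c \<in> B"
  and B_add [simp, intro]: "b \<in> B \<Longrightarrow> c \<in> B \<Longrightarrow> b \<oplus> c \<in> B"
  using subringE[OF B] by auto

abbreviation P :: "nat \<Rightarrow> 's set" where "P \<equiv> polys A B x"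

lemma P_carrier [simp, intro]: "p \<in> P n \<Longrightarrow> p \<in> carrier A"
  by (induction n arbitrary: p) auto

lemma P_SucI: "p \<in> P n \<Longrightarrow> b \<in> B \<Longrightarrow> p \<oplus> b \<otimes> x [^] n \<in> P (Suc n)"
  by auto

lemma P_zero [simp, intro]: "\<zero> \<in> P n"
proof (induction n)
  case (Suc n)
  then show ?case using P_SucI[OF Suc B_zero] by simp
qed simp

lemma P_add: "p \<in> P n \<Longrightarrow> q \<in> P n \<Longrightarrow> p \<oplus> q \<in> P n"
proof (induction n arbitrary: p q)
  case (Suc n)
  then obtain p' b q' c where *: "p = p' \<oplus> b \<otimes> x [^] n" "p' \<in> P n" "b \<in> B"
      "q = q' \<oplus> c \<otimes> x [^] n" "q' \<in> P n" "c \<in> B" by auto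
  then have "p \<oplus> q = (p' \<oplus> q') \<oplus> (b \<oplus> c) \<otimes> x [^] n"
    by (simp add: l_distr a_ac)
  with * Suc.IH[of p' q'] show ?case by (simp only:) (rule P_SucI, auto)
qed simp

lemma P_smult: "b \<in> B \<Longrightarrow> p \<in> P n \<Longrightarrow> b \<otimes> p \<in> P n"
proof (induction n arbitrary: p)
  case (Suc n)
  then obtain p' c where *: "p = p' \<oplus> c \<otimes> x [^] n" "p' \<in> P n" "c \<in> B" by auto
  then have "b \<otimes> p = b \<otimes> p' \<oplus> (b \<otimes> c) \<otimes> x [^] n"
    using Suc.prems by (simp add: r_distr m_assoc)
  with * Suc show ?case by (simp only:) (rule P_SucI, auto)
qed simp

lemma P_Suc: "P n \<subseteq> P (Suc n)"
proof
  fix p assume "p \<in> P n"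
  then show "p \<in> P (Suc n)" using P_SucI[of p n \<zero>] by simp
qed

lemma P_mono: "n \<le> m \<Longrightarrow> P n \<subseteq> P m"
  using lift_Suc_mono_le[of P n m] P_Suc by blast

lemma P_shift: "p \<in> P n \<Longrightarrow> x \<otimes> p \<in> P (Suc n)"
proof (induction n arbitrary: p)
  case (Suc n)
  then obtain p' c where *: "p = p' \<oplus> c \<otimes> x [^] n" "p' \<in> P n" "c \<in> B" by auto
  then have "x \<otimes> p = x \<otimes> p' \<oplus> c \<otimes> x [^] (Suc n)"
    by (simp add: r_distr m_ac)
  with * Suc.IH[of p'] show ?case by (simp only:) (rule P_SucI, auto)
qed (use P_zero[of "Suc 0"] in simp)

lemma P_shift_pow: "p \<in> P n \<Longrightarrow> x [^] m \<otimes> p \<in> P (n + m)"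
proof (induction m)
  case (Suc m)
  then have "x \<otimes> (x [^] m \<otimes> p) \<in> P (Suc (n + m))" using P_shift by blast
  then show ?case using Suc.prems by (simp add: m_ac del: polys.simps)
qed simp

lemma P_mult: "p \<in> P n \<Longrightarrow> q \<in> P m \<Longrightarrow> p \<otimes> q \<in> P (n + m)"
proof (induction m arbitrary: q)
  case (Suc m)
  then obtain q' c where *: "q = q' \<oplus> c \<otimes> x [^] m" "q' \<in> P m" "c \<in> B" by auto
  then have eq: "p \<otimes> q = p \<otimes> q' \<oplus> c \<otimes> (x [^] m \<otimes> p)"
    using Suc.prems by (simp add: r_distr m_ac)
  have "p \<otimes> q \<in> P (n + m)"
    unfolding eq by (rule P_add[OF Suc.IH[OF Suc.prems(1) *(2)] P_smult[OF *(3) P_shift_pow[OF Suc.prems(1)]]])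
  then show ?case using P_mono[of "n + m" "n + Suc m"] by auto
qed (use P_zero in simp)

text \<open>The ring \<open>B[x]\<close> inside \<open>A\<close>: the image of the polynomial ring
  over \<open>B\<close> under evaluation at \<open>x\<close>.\<close>

definition adjoin :: "'s set" where "adjoin = (\<Union>n. P n)"

lemma adjoin_subring: "subring adjoin A"
proof (rule subringI)
  show "adjoin \<subseteq> carrier A" by (auto simp: adjoin_def)
  have "\<one> \<in> P (Suc 0)" using P_SucI[of \<zero> 0 \<one>] by simp
  then show "\<one> \<in> adjoin" unfolding adjoin_def by blast
  show "\<ominus> h \<in> adjoin" if h: "h \<in> adjoin" for h
  proof -
    obtain n where n: "h \<in> P n" using h by (auto simp: adjoin_def)
    then have "\<ominus> h = (\<ominus> \<one>) \<otimes> h" by (simp add: l_minus)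
    then show ?thesis using P_smult[OF B_minus[OF B_one] n] by (auto simp: adjoin_def)
  qed
  fix h k assume "h \<in> adjoin" "k \<in> adjoin"
  then obtain n m where nm: "h \<in> P n" "k \<in> P m" by (auto simp: adjoin_def)
  then show "h \<otimes> k \<in> adjoin" using P_mult unfolding adjoin_def by blast
  have "h \<in> P (max n m)" "k \<in> P (max n m)" using nm P_mono[of n "max n m"] P_mono[of m "max n m"] by auto
  then show "h \<oplus> k \<in> adjoin" using P_add unfolding adjoin_def by blast
qed

lemma B_subset_adjoin: "B \<subseteq> adjoin"
proof
  fix b assume "b \<in> B"
  then have "b \<in> P (Suc 0)" using P_SucI[of \<zero> 0 b] by simp
  then show "b \<in> adjoin" unfolding adjoin_def by blast
qed

lemma x_in_adjoin: "x \<in> adjoin"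
proof -
  have "x \<in> P (Suc (Suc 0))" using P_SucI[of \<zero> "Suc 0" \<one>] by (simp add: del: polys.simps)
  then show ?thesis unfolding adjoin_def by blast
qed

lemma leading_ideal:
  assumes I: "ideal_within A adjoin I"
  shows "ideal_within A B (leading A B x I n)"
  unfolding ideal_within_def
proof (intro conjI ballI)
  show "leading A B x I n \<subseteq> B" by (auto simp: leading_def)
  show "\<zero> \<in> leading A B x I n" using I P_zero[of n] by (auto simp: leading_def ideal_within_def intro!: bexI[of _ \<zero>])
  { fix b c assume "b \<in> leading A B x I n" "c \<in> leading A B x I n"
    then obtain p q where *: "b \<in> B" "c \<in> B" "p \<in> P n" "q \<in> P n"
      "p \<oplus> b \<otimes> x [^] n \<in> I" "q \<oplus> c \<otimes> x [^] n \<in> I" by (auto simp: leading_def)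
    have "(p \<oplus> q) \<oplus> (b \<oplus> c) \<otimes> x [^] n = (p \<oplus> b \<otimes> x [^] n) \<oplus> (q \<oplus> c \<otimes> x [^] n)"
      using * by (simp add: l_distr a_ac)
    then show "b \<oplus> c \<in> leading A B x I n"
      using * I P_add[of p n q] by (auto simp: leading_def ideal_within_def intro!: bexI[of _ "p \<oplus> q"]) }
  { fix b c assume b: "b \<in> B" and "c \<in> leading A B x I n"
    then obtain q where *: "c \<in> B" "q \<in> P n" "q \<oplus> c \<otimes> x [^] n \<in> I" by (auto simp: leading_def)
    have "(b \<otimes> q) \<oplus> (b \<otimes> c) \<otimes> x [^] n = b \<otimes> (q \<oplus> c \<otimes> x [^] n)"
      using * b by (simp add: r_distr m_assoc)
    moreover have "b \<otimes> (q \<oplus> c \<otimes> x [^] n) \<in> I"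
      using * b I B_subset_adjoin by (auto simp: ideal_within_def)
    ultimately show "b \<otimes> c \<in> leading A B x I n"
      using * b P_smult[of b q n] by (auto simp: leading_def intro!: bexI[of _ "b \<otimes> q"]) }
qed

text \<open>Multiplication by \<open>x\<close> raises the degree by one and keeps the top
  coefficient.\<close>

lemma leading_Suc:
  assumes I: "ideal_within A adjoin I"
  shows "leading A B x I n \<subseteq> leading A B x I (Suc n)"
proof
  fix b assume "b \<in> leading A B x I n"
  then obtain p where *: "b \<in> B" "p \<in> P n" "p \<oplus> b \<otimes> x [^] n \<in> I" by (auto simp: leading_def)
  then have "x \<otimes> (p \<oplus> b \<otimes> x [^] n) \<in> I" using I x_in_adjoin by (auto simp: ideal_within_def)
  moreover have "x \<otimes> (p \<oplus> b \<otimes> x [^] n) = x \<otimes> p \<oplus> b \<otimes> x [^] Suc n"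
    using * by (simp add: r_distr m_ac)
  ultimately show "b \<in> leading A B x I (Suc n)"
    using * P_shift[of p n] unfolding leading_def by (auto simp del: polys.simps)
qed

text \<open>Induction on the degree bound: an element of \<open>J\<close> shares its top coefficient
  with an element of \<open>I\<close> of the same bound, and their difference lies in
  \<open>J\<close> with a smaller bound, hence in \<open>I\<close>. The comparison is between chosen
  expressions, so \<open>x\<close> may be algebraic over \<open>B\<close>.\<close>

lemma ideals_eq_of_leading_eq:
  assumes I: "ideal_within A adjoin I" and J: "ideal_within A adjoin J" and IJ: "I \<subseteq> J"
    and eq: "\<And>n. leading A B x J n \<subseteq> leading A B x I n"
  shows "J = I"
proof -
  have sub: "J \<subseteq> adjoin" using J by (auto simp: ideal_within_def)
  \<comment> \<open>\<open>ideal_within\<close> does not mention negatives; subtraction is addition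
    after multiplying by this element.\<close>
  have minus: "\<ominus> \<one> \<in> adjoin" using subringE(3,5)[OF adjoin_subring] by blast
  have "s \<in> I" if "s \<in> P n" "s \<in> J" for s n
    using that
  proof (induction n arbitrary: s)
    case 0
    then show ?case using I by (auto simp: ideal_within_def)
  next
    case (Suc n)
    then obtain p b where s: "s = p \<oplus> b \<otimes> x [^] n" "p \<in> P n" "b \<in> B" by auto
    then have "b \<in> leading A B x J n" using Suc by (auto simp: leading_def)
    then obtain q where q: "q \<in> P n" "q \<oplus> b \<otimes> x [^] n \<in> I" using eq by (fastforce simp: leading_def)
    let ?t = "q \<oplus> b \<otimes> x [^] n"
    have "(\<ominus> \<one>) \<otimes> ?t \<in> J" using q J IJ minus by (auto simp: ideal_within_def)
    then have "s \<oplus> (\<ominus> \<one>) \<otimes> ?t \<in> J" using Suc J by (auto simp: ideal_within_def)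
    moreover have e: "s \<oplus> (\<ominus> \<one>) \<otimes> ?t = p \<oplus> (\<ominus> \<one>) \<otimes> q"
      using s q by (simp add: l_minus minus_add a_ac r_neg r_neg1 r_neg2)
    moreover have "p \<oplus> (\<ominus> \<one>) \<otimes> q \<in> P n" using s q by (intro P_add P_smult) auto
    ultimately have "p \<oplus> (\<ominus> \<one>) \<otimes> q \<in> I" using Suc.IH by metis
    then have "(p \<oplus> (\<ominus> \<one>) \<otimes> q) \<oplus> ?t \<in> I" using q I by (auto simp: ideal_within_def)
    moreover have "(p \<oplus> (\<ominus> \<one>) \<otimes> q) \<oplus> ?t = s" using s q by (simp add: l_minus a_ac r_neg1 r_neg2)
    ultimately show ?case by simp
  qed
  then show ?thesis using sub IJ by (auto simp: adjoin_def)
qed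

text \<open>The leading ideals form an array \<open>f k n\<close> that increases in both indices.
  Its diagonal is constant from some \<open>N\<close> on, and for each of the finitely many
  \<open>n \<le> N\<close> the sequence in \<open>k\<close> becomes constant. Hence one
  \<open>M\<close> works for all \<open>n\<close> at once, and the ideals from \<open>I M\<close> on
  have the same leading ideals.\<close>

theorem hilbert_basis:
  assumes "noetherian_within A B"
  shows "noetherian_within A adjoin"
  unfolding noetherian_within_def
proof (intro allI impI, elim conjE)
  fix I :: "nat \<Rightarrow> 's set"
  assume I: "\<forall>n. ideal_within A adjoin (I n)" and inc: "\<forall>n. I n \<subseteq> I (Suc n)"
  define f where "f k n = leading A B x (I k) n" for k n
  have mono: "I k \<subseteq> I l" if "k \<le> l" for k l using that inc lift_Suc_mono_le[of I] by blast
  have f1: "f k n \<subseteq> f l n" if "k \<le> l" for k l n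
    using mono[OF that] by (auto simp: f_def leading_def)
  have f2: "f k n \<subseteq> f k m" if "n \<le> m" for k n m
    using that lift_Suc_mono_le[of "f k"] leading_Suc I unfolding f_def by blast
  have fI: "ideal_within A B (f k n)" for k n using leading_ideal I by (auto simp: f_def)
  have diag: "f n n \<subseteq> f (Suc n) (Suc n)" for n
    using f1[of n "Suc n" n] f2[of n "Suc n" "Suc n"] by auto
  obtain N where N: "\<And>m. m \<ge> N \<Longrightarrow> f m m = f N N"
    using assms[unfolded noetherian_within_def, rule_format, of "\<lambda>n. f n n"] fI diag by auto
  have "\<exists>K. \<forall>k\<ge>K. f k n = f K n" for n
    using assms[unfolded noetherian_within_def, rule_format, of "\<lambda>k. f k n"] fI f1 by auto
  then obtain K where K: "\<And>n k. k \<ge> K n \<Longrightarrow> f k n = f (K n) n" by metis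
  define M where "M = Max (insert N (K ` {..N}))"
  have MN: "N \<le> M" unfolding M_def by (rule Max_ge) auto
  have MK: "K n \<le> M" if "n \<le> N" for n
    unfolding M_def using that by (intro Max_ge) auto
  have "f k n \<subseteq> f M n" if "k \<ge> M" for k n
  proof (cases "n \<le> N")
    case True
    then show ?thesis using K[of n k] K[of n M] MK[of n] that by auto
  next
    case False
    \<comment> \<open>Diagonal entries from \<open>N\<close> on equal \<open>f N N\<close>, which
      bounds this entry from above; as \<open>N \<le> M\<close> and \<open>N \<le> n\<close>,
      monotonicity places \<open>f N N\<close> inside \<open>f M n\<close>.\<close>
    have "f k n \<subseteq> f (max k n) (max k n)" using f1[of k "max k n" n] f2[of n "max k n"] by fastforce
    also have "\<dots> = f N N" using N[of "max k n"] False by auto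
    also have "\<dots> \<subseteq> f M n" using f1[OF MN, of N] f2[of N n M] False by auto
    finally show ?thesis .
  qed
  then have "I k = I M" if "k \<ge> M" for k
    using ideals_eq_of_leading_eq[of "I M" "I k"] I mono[OF that] that unfolding f_def by auto
  then show "\<exists>n. \<forall>m\<ge>n. I m = I n" by blast
qed

end

section \<open>Finitely generated algebras over a field\<close>

lemma (in algebra) scalars_subring: "subring ((\<lambda>c. c \<odot>\<^bsub>M\<^esub> \<one>\<^bsub>M\<^esub>) ` carrier R) M"
proof (rule ring.subringI)
  show "ring M" using M_cring cring.axioms(1) by blast
  have mult: "(c \<odot>\<^bsub>M\<^esub> \<one>\<^bsub>M\<^esub>) \<otimes>\<^bsub>M\<^esub> (d \<odot>\<^bsub>M\<^esub> \<one>\<^bsub>M\<^esub>) = (c \<otimes>\<^bsub>R\<^esub> d) \<odot>\<^bsub>M\<^esub> \<one>\<^bsub>M\<^esub>"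
    if "c \<in> carrier R" "d \<in> carrier R" for c d
    using that by (simp add: smult_assoc2 smult_assoc1)
  show "(\<lambda>c. c \<odot>\<^bsub>M\<^esub> \<one>\<^bsub>M\<^esub>) ` carrier R \<subseteq> carrier M" by auto
  show "\<one>\<^bsub>M\<^esub> \<in> (\<lambda>c. c \<odot>\<^bsub>M\<^esub> \<one>\<^bsub>M\<^esub>) ` carrier R" by (rule image_eqI[of _ _ "\<one>\<^bsub>R\<^esub>"]) auto
  show "\<ominus>\<^bsub>M\<^esub> h \<in> (\<lambda>c. c \<odot>\<^bsub>M\<^esub> \<one>\<^bsub>M\<^esub>) ` carrier R" if "h \<in> (\<lambda>c. c \<odot>\<^bsub>M\<^esub> \<one>\<^bsub>M\<^esub>) ` carrier R" for h
    using that smult_l_minus[symmetric] by auto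
  fix h k assume "h \<in> (\<lambda>c. c \<odot>\<^bsub>M\<^esub> \<one>\<^bsub>M\<^esub>) ` carrier R" "k \<in> (\<lambda>c. c \<odot>\<^bsub>M\<^esub> \<one>\<^bsub>M\<^esub>) ` carrier R"
  then obtain c d where cd: "c \<in> carrier R" "d \<in> carrier R" "h = c \<odot>\<^bsub>M\<^esub> \<one>\<^bsub>M\<^esub>" "k = d \<odot>\<^bsub>M\<^esub> \<one>\<^bsub>M\<^esub>" by auto
  show "h \<otimes>\<^bsub>M\<^esub> k \<in> (\<lambda>c. c \<odot>\<^bsub>M\<^esub> \<one>\<^bsub>M\<^esub>) ` carrier R" using cd mult by auto
  show "h \<oplus>\<^bsub>M\<^esub> k \<in> (\<lambda>c. c \<odot>\<^bsub>M\<^esub> \<one>\<^bsub>M\<^esub>) ` carrier R"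
    using cd smult_l_distr[symmetric] by auto
qed

text \<open>A nonzero element of an ideal is \<open>c \<odot> \<one>\<close> with \<open>c\<close>
  invertible in the field, so the ideal is everything and a chain can grow at most once. The
  argument covers the zero algebra too, where the image is not a field.\<close>

lemma (in algebra) scalars_noetherian:
  assumes "field R"
  shows "noetherian_within M ((\<lambda>c. c \<odot>\<^bsub>M\<^esub> \<one>\<^bsub>M\<^esub>) ` carrier R)" (is "noetherian_within M ?B")
proof -
  interpret field R by fact
  have all: "I = ?B" if I: "ideal_within M ?B I" and b: "b \<in> I" "b \<noteq> \<zero>\<^bsub>M\<^esub>" for I b
  proof -
    obtain c where c: "c \<in> carrier R" "b = c \<odot>\<^bsub>M\<^esub> \<one>\<^bsub>M\<^esub>" using I b by (auto simp: ideal_within_def)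
    then have "c \<noteq> \<zero>\<^bsub>R\<^esub>" using b by auto
    then have ic: "inv\<^bsub>R\<^esub> c \<in> carrier R" "c \<otimes>\<^bsub>R\<^esub> inv\<^bsub>R\<^esub> c = \<one>\<^bsub>R\<^esub>" using c by (auto simp: field_Units)
    have "d \<odot>\<^bsub>M\<^esub> \<one>\<^bsub>M\<^esub> \<in> I" if d: "d \<in> carrier R" for d
    proof -
      have "((d \<otimes>\<^bsub>R\<^esub> inv\<^bsub>R\<^esub> c) \<odot>\<^bsub>M\<^esub> \<one>\<^bsub>M\<^esub>) \<otimes>\<^bsub>M\<^esub> b = ((d \<otimes>\<^bsub>R\<^esub> inv\<^bsub>R\<^esub> c) \<otimes>\<^bsub>R\<^esub> c) \<odot>\<^bsub>M\<^esub> \<one>\<^bsub>M\<^esub>"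
        using c d ic by (simp add: smult_assoc2 smult_assoc1)
      also have "(d \<otimes>\<^bsub>R\<^esub> inv\<^bsub>R\<^esub> c) \<otimes>\<^bsub>R\<^esub> c = d"
        using c d ic R.m_assoc[of d "inv\<^bsub>R\<^esub> c" c] R.m_comm[of "inv\<^bsub>R\<^esub> c" c] by simp
      finally have "((d \<otimes>\<^bsub>R\<^esub> inv\<^bsub>R\<^esub> c) \<odot>\<^bsub>M\<^esub> \<one>\<^bsub>M\<^esub>) \<otimes>\<^bsub>M\<^esub> b = d \<odot>\<^bsub>M\<^esub> \<one>\<^bsub>M\<^esub>" .
      moreover have "(d \<otimes>\<^bsub>R\<^esub> inv\<^bsub>R\<^esub> c) \<odot>\<^bsub>M\<^esub> \<one>\<^bsub>M\<^esub> \<in> ?B" using d ic by blast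
      ultimately show ?thesis using I b(1) unfolding ideal_within_def by metis
    qed
    then show ?thesis using I by (auto simp: ideal_within_def)
  qed
  show ?thesis unfolding noetherian_within_def
  proof (intro allI impI, elim conjE)
    fix I :: "nat \<Rightarrow> 'c set"
    assume I: "\<forall>n. ideal_within M ?B (I n)" and inc: "\<forall>n. I n \<subseteq> I (Suc n)"
    have mono: "I k \<subseteq> I l" if "k \<le> l" for k l using that inc lift_Suc_mono_le[of I] by blast
    show "\<exists>n. \<forall>m\<ge>n. I m = I n"
    proof (cases "\<exists>n. \<exists>b\<in>I n. b \<noteq> \<zero>\<^bsub>M\<^esub>")
      case True
      then obtain n b where b: "b \<in> I n" "b \<noteq> \<zero>\<^bsub>M\<^esub>" by blast
      then have "I m = ?B" if "m \<ge> n" for m using all[of "I m" b] I mono[OF that] by blast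
      then show ?thesis by (metis order_refl)
    next
      case False
      then have "I n = {\<zero>\<^bsub>M\<^esub>}" for n using I by (auto simp: ideal_within_def)
      then show ?thesis by metis
    qed
  qed
qed

text \<open>The generators are adjoined one by one to the image of the field. The induction carries
  a subring containing that image; closure under scalars is recovered at the end from
  \<open>c \<odot> b = (c \<odot> \<one>) \<otimes> b\<close>, and then the definition of finite
  generation identifies the subring with the whole algebra.\<close>

lemma fin_gen_noetherian:
  fixes M :: "('f, 's, 'm) module_scheme" (structure)
  assumes alg: "algebra R M" and "field R" "fin_gen_algebra R M"
  shows "noetherian_within M (carrier M)"
proof -
  interpret algebra R M by (rule alg)
  interpret cring M by (rule M_cring)
  obtain S where S: "finite S" "S \<subseteq> carrier M"
    and gen: "\<forall>B. subring B M \<and> (\<forall>c\<in>carrier R. \<forall>b\<in>B. c \<odot> b \<in> B) \<and> S \<subseteq> B \<longrightarrow> B = carrier M"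
    using assms(3) unfolding fin_gen_algebra_def by (elim exE conjE)
  let ?K = "(\<lambda>c. c \<odot> \<one>\<^bsub>M\<^esub>) ` carrier R"
  have "\<exists>B. subring B M \<and> ?K \<subseteq> B \<and> S \<subseteq> B \<and> noetherian_within M B"
    using S(1,2)
  proof (induction S)
    case empty
    show ?case using scalars_subring scalars_noetherian[OF assms(2)] by blast
  next
    case (insert y S)
    then obtain B where B': "subring B M" "?K \<subseteq> B" "S \<subseteq> B" "noetherian_within M B" by auto
    have "y \<in> carrier M" using insert.prems by simp
    then interpret cring_extension M B y
      by (intro cring_extension.intro cring_extension_axioms.intro M_cring B'(1))
    show ?case using adjoin_subring B_subset_adjoin x_in_adjoin hilbert_basis[OF B'(4)] B'(2,3)
      by (intro exI[of _ adjoin] conjI) blast+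
  qed
  then obtain B where B': "subring B M" "?K \<subseteq> B" "S \<subseteq> B" "noetherian_within M B" by blast
  have "c \<odot> b \<in> B" if "c \<in> carrier R" "b \<in> B" for c b
  proof -
    have bM: "b \<in> carrier M" using that subringE(1)[OF B'(1)] by blast
    then have "c \<odot> b = (c \<odot> \<one>\<^bsub>M\<^esub>) \<otimes>\<^bsub>M\<^esub> b" using that by (simp add: smult_assoc2)
    then show ?thesis using that B'(2) subringE(6)[OF B'(1)] by auto
  qed
  then have "B = carrier M" using gen[rule_format, of B] B'(1,3) by blast
  then show ?thesis using B'(4) by simp
qed

section \<open>Noetherian sober spaces\<close>

definition noetherian_space :: "'a topology \<Rightarrow> bool" where
  "noetherian_space T \<longleftrightarrow> (\<forall>\<C>. \<C> \<noteq> {} \<and> (\<forall>C\<in>\<C>. closedin T C) \<longrightarrow>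
     (\<exists>C\<in>\<C>. \<forall>D\<in>\<C>. D \<subseteq> C \<longrightarrow> D = C))"

text \<open>The usual condition on unions of closed sets, passed to complements: generic points are
  tested on open sets as well.\<close>

definition irreducible_closed :: "'a topology \<Rightarrow> 'a set \<Rightarrow> bool" where
  "irreducible_closed T Z \<longleftrightarrow> closedin T Z \<and> Z \<noteq> {} \<and>
     (\<forall>U V. openin T U \<and> openin T V \<and> U \<inter> Z \<noteq> {} \<and> V \<inter> Z \<noteq> {} \<longrightarrow> U \<inter> V \<inter> Z \<noteq> {})"

text \<open>For closed \<open>Z\<close> this says that \<open>Z\<close> is the closure of the point
  \<open>x\<close>.\<close>

definition generic_point :: "'a topology \<Rightarrow> 'a set \<Rightarrow> 'a \<Rightarrow> bool" where
  "generic_point T Z x \<longleftrightarrow> x \<in> Z \<and> (\<forall>U. openin T U \<and> U \<inter> Z \<noteq> {} \<longrightarrow> x \<in> U)"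

text \<open>The T0 axiom supplies uniqueness of generic points, see
  \<open>generic_point_unique\<close>; this is what turns compatibility of generic points in an
  inverse system into an equation.\<close>

definition sober_space :: "'a topology \<Rightarrow> bool" where
  "sober_space T \<longleftrightarrow> t0_space T \<and> (\<forall>Z. irreducible_closed T Z \<longrightarrow> (\<exists>x. generic_point T Z x))"

lemma noetherian_space_minimal:
  assumes "noetherian_space T" "closedin T C" "Q C"
  shows "\<exists>D. closedin T D \<and> Q D \<and> (\<forall>E. closedin T E \<longrightarrow> Q E \<longrightarrow> E \<subseteq> D \<longrightarrow> E = D)"
proof -
  have "{D. closedin T D \<and> Q D} \<noteq> {}" using assms(2,3) by auto
  then have "\<exists>D\<in>{D. closedin T D \<and> Q D}. \<forall>E\<in>{D. closedin T D \<and> Q D}. E \<subseteq> D \<longrightarrow> E = D"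
    using assms(1)[unfolded noetherian_space_def, rule_format, of "{D. closedin T D \<and> Q D}"] by simp
  then show ?thesis by auto
qed

text \<open>The charts are treated one at a time. Given a member \<open>C\<close> below which
  nothing changes on the earlier charts, a member below \<open>C\<close> with minimal trace on the
  next chart keeps that property and gains it for the new chart.\<close>

lemma noetherian_space_cover:
  assumes "finite \<U>" "\<Union>\<U> = topspace T" "\<And>U. U \<in> \<U> \<Longrightarrow> noetherian_space (subtopology T U)"
  shows "noetherian_space T"
  unfolding noetherian_space_def
proof (intro allI impI, elim conjE)
  fix \<C> :: "'a set set" assume ne: "\<C> \<noteq> {}" and cl: "\<forall>C\<in>\<C>. closedin T C"
  have "\<exists>C\<in>\<C>. \<forall>D\<in>\<C>. D \<subseteq> C \<longrightarrow> (\<forall>U\<in>\<U>. D \<inter> U = C \<inter> U)"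
    using assms(1,3)
  proof (induction \<U>)
    case empty
    then show ?case using ne by auto
  next
    case (insert U \<V>)
    then obtain C where C: "C \<in> \<C>" "\<And>D V. D \<in> \<C> \<Longrightarrow> D \<subseteq> C \<Longrightarrow> V \<in> \<V> \<Longrightarrow> D \<inter> V = C \<inter> V"
      by (metis insert_iff)
    have ns: "noetherian_space (subtopology T U)" using insert.prems by simp
    let ?Q = "\<lambda>E. \<exists>D\<in>\<C>. D \<subseteq> C \<and> E = D \<inter> U"
    have "closedin (subtopology T U) (C \<inter> U)" "?Q (C \<inter> U)"
      using C(1) cl by (auto simp: closedin_subtopology)
    from noetherian_space_minimal[OF ns, where Q = ?Q, OF this]
    obtain E where E: "?Q E \<and> (\<forall>E'. closedin (subtopology T U) E' \<longrightarrow> ?Q E' \<longrightarrow> E' \<subseteq> E \<longrightarrow> E' = E)"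
      by (elim exE conjE) simp
    then have min: "\<forall>E'. closedin (subtopology T U) E' \<longrightarrow> ?Q E' \<longrightarrow> E' \<subseteq> E \<longrightarrow> E' = E" by simp
    from E obtain D where D: "D \<in> \<C>" "D \<subseteq> C" "E = D \<inter> U" by auto
    have "D' \<inter> V = D \<inter> V" if D': "D' \<in> \<C>" "D' \<subseteq> D" and V: "V \<in> insert U \<V>" for D' V
    proof (cases "V = U")
      case True
      have "closedin (subtopology T U) (D' \<inter> U)" using D' cl by (auto simp: closedin_subtopology)
      moreover have "?Q (D' \<inter> U)" using D(2) D' by (intro bexI[of _ D']) auto
      moreover have "D' \<inter> U \<subseteq> E" using D(3) D' by auto
      ultimately have "D' \<inter> U = E" using min by simp
      then show ?thesis using True D by simp
    next
      case False
      then show ?thesis using C(2)[OF D'(1)] C(2)[OF D(1,2)] D D' V by auto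
    qed
    then show ?case by (intro bexI[OF _ D(1)] ballI impI)
  qed
  then obtain C where C: "C \<in> \<C>" "\<forall>D\<in>\<C>. D \<subseteq> C \<longrightarrow> (\<forall>U\<in>\<U>. D \<inter> U = C \<inter> U)"
    by (elim bexE)
  have "D = C" if "D \<in> \<C>" "D \<subseteq> C" for D
  proof -
    have "C \<subseteq> \<Union>\<U>" unfolding assms(2) using C(1) cl closedin_subset[of T] by simp
    moreover have "D \<inter> U = C \<inter> U" if "U \<in> \<U>" for U using C(2) \<open>D \<in> \<C>\<close> \<open>D \<subseteq> C\<close> that by simp
    ultimately show ?thesis using that(2) by blast
  qed
  then show "\<exists>C\<in>\<C>. \<forall>D\<in>\<C>. D \<subseteq> C \<longrightarrow> D = C" using C(1) by blast
qed

text \<open>Among complements of finite unions choose a minimal one; adding one more member of the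
  cover cannot shrink it, so that finite union already contains every member.\<close>

lemma noetherian_space_finite_subcover:
  assumes T: "noetherian_space T" and op: "\<And>U. U \<in> \<U> \<Longrightarrow> openin T U"
  obtains \<F> where "finite \<F>" "\<F> \<subseteq> \<U>" "\<Union>\<F> = \<Union>\<U>"
proof -
  define Q where "Q D \<longleftrightarrow> (\<exists>\<F>. finite \<F> \<and> \<F> \<subseteq> \<U> \<and> D = topspace T - \<Union>\<F>)" for D
  have "closedin T (topspace T)" "Q (topspace T)" by (auto simp: Q_def intro!: exI[of _ "{}"])
  from noetherian_space_minimal[OF T, where Q = Q, OF this]
  obtain D where "Q D" and min: "\<forall>E. closedin T E \<longrightarrow> Q E \<longrightarrow> E \<subseteq> D \<longrightarrow> E = D"
    by (elim exE conjE)
  from \<open>Q D\<close> obtain \<F> where \<F>: "finite \<F>" "\<F> \<subseteq> \<U>" "D = topspace T - \<Union>\<F>"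
    unfolding Q_def by (elim exE conjE)
  have "U \<subseteq> \<Union>\<F>" if U: "U \<in> \<U>" for U
  proof -
    have "topspace T - \<Union>(insert U \<F>) = D"
    proof (rule min[rule_format])
      show "closedin T (topspace T - \<Union>(insert U \<F>))" using op U \<F> by (intro closedin_diff) auto
      show "Q (topspace T - \<Union>(insert U \<F>))"
        unfolding Q_def using \<F> U by (intro exI[of _ "insert U \<F>"]) auto
    qed (use \<F> in auto)
    then show ?thesis using \<F>(3) openin_subset[OF op[OF U]] by blast
  qed
  then show thesis using that[of \<F>] \<F> by blast
qed

text \<open>A generic point of \<open>Z \<inter> U\<close>, for a chart \<open>U\<close> that meets
  \<open>Z\<close>, is generic for \<open>Z\<close>: by irreducibility an open set meeting
  \<open>Z\<close> also meets \<open>Z\<close> inside \<open>U\<close>. For T0, two points without a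
  common chart are separated by a chart.\<close>

lemma sober_space_cover:
  assumes cov: "\<Union>\<U> = topspace T" and op: "\<And>U. U \<in> \<U> \<Longrightarrow> openin T U"
    and sob: "\<And>U. U \<in> \<U> \<Longrightarrow> sober_space (subtopology T U)"
  shows "sober_space T"
  unfolding sober_space_def
proof (intro conjI allI impI)
  show "t0_space T"
    unfolding t0_space_def
  proof (intro ballI impI)
    fix x y assume xy: "x \<in> topspace T" "y \<in> topspace T" "x \<noteq> y"
    then obtain U where U: "U \<in> \<U>" "x \<in> U" using cov by auto
    show "\<exists>U. openin T U \<and> (x \<notin> U) = (y \<in> U)"
    proof (cases "y \<in> U")
      case False
      then show ?thesis using U op by blast
    next
      case True
      have "t0_space (subtopology T U)" using sob U by (auto simp: sober_space_def)
      then obtain V where "openin (subtopology T U) V" "(x \<notin> V) = (y \<in> V)"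
        using xy U True unfolding t0_space_def by (metis IntI topspace_subtopology)
      then show ?thesis using op[OF U(1)] openin_open_subtopology by blast
    qed
  qed
  fix Z assume Z: "irreducible_closed T Z"
  then obtain z where z: "z \<in> Z" "z \<in> topspace T"
    using closedin_subset[of T Z] by (auto simp: irreducible_closed_def)
  then obtain U where U: "U \<in> \<U>" "z \<in> U" using cov by auto
  have o: "openin T V" "V \<subseteq> U" if "openin (subtopology T U) V" for V
    using that op[OF U(1)] by (simp_all add: openin_open_subtopology)
  have "irreducible_closed (subtopology T U) (Z \<inter> U)"
    unfolding irreducible_closed_def
  proof (intro conjI allI impI)
    show "closedin (subtopology T U) (Z \<inter> U)"
      using Z by (auto simp: irreducible_closed_def closedin_subtopology)
    show "Z \<inter> U \<noteq> {}" using z U by auto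
    fix V W assume *: "openin (subtopology T U) V \<and> openin (subtopology T U) W \<and> V \<inter> (Z \<inter> U) \<noteq> {} \<and> W \<inter> (Z \<inter> U) \<noteq> {}"
    then have "V \<inter> W \<inter> Z \<noteq> {}" using Z o[of V] o[of W] unfolding irreducible_closed_def
      by (metis Int_assoc Int_commute inf_bot_left)
    then show "V \<inter> W \<inter> (Z \<inter> U) \<noteq> {}" using o * by blast
  qed
  then obtain x where x: "generic_point (subtopology T U) (Z \<inter> U) x"
    using sob[OF U(1)] by (auto simp: sober_space_def)
  have "generic_point T Z x"
    unfolding generic_point_def
  proof (intro conjI allI impI)
    show "x \<in> Z" using x by (simp add: generic_point_def)
    fix V assume V: "openin T V \<and> V \<inter> Z \<noteq> {}"
    then have "V \<inter> U \<inter> Z \<noteq> {}" using Z op[OF U(1)] z U unfolding irreducible_closed_def by blast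
    moreover have "openin (subtopology T U) (V \<inter> U)" using V by (auto simp: openin_subtopology)
    ultimately show "x \<in> V" using x unfolding generic_point_def by blast
  qed
  then show "\<exists>x. generic_point T Z x" ..
qed

lemma homeomorphic_map_noetherian_space:
  assumes h: "homeomorphic_map S T h" and T: "noetherian_space T"
  shows "noetherian_space S"
  unfolding noetherian_space_def
proof (intro allI impI, elim conjE)
  fix \<C> :: "'a set set" assume ne: "\<C> \<noteq> {}" and cl: "\<forall>C\<in>\<C>. closedin S C"
  have "\<forall>C\<in>(`) h ` \<C>. closedin T C"
    using cl homeomorphic_imp_closed_map[OF h] by (auto simp: closed_map_def)
  then have "\<exists>C\<in>(`) h ` \<C>. \<forall>D\<in>(`) h ` \<C>. D \<subseteq> C \<longrightarrow> D = C"
    using ne by (intro T[unfolded noetherian_space_def, rule_format]) simp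
  then obtain C where C: "C \<in> \<C>" "\<And>D. D \<in> \<C> \<Longrightarrow> h ` D \<subseteq> h ` C \<Longrightarrow> h ` D = h ` C"
    by auto
  have "D = C" if "D \<in> \<C>" "D \<subseteq> C" for D
    using C(2)[OF that(1) image_mono[OF that(2)]] that(1) cl C(1)
      inj_on_image_eq_iff[OF homeomorphic_imp_injective_map[OF h], of D C] closedin_subset[of S] by simp
  then show "\<exists>C\<in>\<C>. \<forall>D\<in>\<C>. D \<subseteq> C \<longrightarrow> D = C" using C(1) by blast
qed

lemma homeomorphic_map_sober_space:
  assumes h: "homeomorphic_map S T h" and T: "sober_space T"
  shows "sober_space S"
  unfolding sober_space_def
proof (intro conjI allI impI)
  show "t0_space S" using h T homeomorphic_t0_space unfolding sober_space_def
    by (metis homeomorphic_space_def homeomorphic_map_maps)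
  have inj: "inj_on h (topspace S)" and im: "h ` topspace S = topspace T"
    using h homeomorphic_imp_injective_map homeomorphic_imp_surjective_map by blast+
  have pre: "openin S {x \<in> topspace S. h x \<in> U}" if "openin T U" for U
    using that h homeomorphic_imp_continuous_map openin_continuous_map_preimage by blast
  fix Z assume Z: "irreducible_closed S Z"
  have sub: "Z \<subseteq> topspace S" using Z closedin_subset by (auto simp: irreducible_closed_def)
  have "irreducible_closed T (h ` Z)"
    unfolding irreducible_closed_def
  proof (intro conjI allI impI)
    show "closedin T (h ` Z)" using Z h homeomorphic_imp_closed_map
      by (auto simp: irreducible_closed_def closed_map_def)
    show "h ` Z \<noteq> {}" using Z by (auto simp: irreducible_closed_def)
    fix U V assume *: "openin T U \<and> openin T V \<and> U \<inter> h ` Z \<noteq> {} \<and> V \<inter> h ` Z \<noteq> {}"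
    have "{x \<in> topspace S. h x \<in> U} \<inter> {x \<in> topspace S. h x \<in> V} \<inter> Z \<noteq> {}"
      using Z pre[of U] pre[of V] * sub unfolding irreducible_closed_def by blast
    then show "U \<inter> V \<inter> h ` Z \<noteq> {}" by blast
  qed
  then obtain y where y: "generic_point T (h ` Z) y" using T by (auto simp: sober_space_def)
  then obtain x where x: "x \<in> Z" "y = h x" by (auto simp: generic_point_def)
  have "x \<in> U" if U: "openin S U" "U \<inter> Z \<noteq> {}" for U
  proof -
    have "openin T (h ` U)" using U(1) homeomorphic_imp_open_map[OF h] by (simp add: open_map_def)
    moreover have "h ` U \<inter> h ` Z \<noteq> {}" using U(2) by blast
    ultimately have "h x \<in> h ` U" using y x(2) by (simp add: generic_point_def)
    then obtain x' where "x' \<in> U" "h x = h x'" by blast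
    then show ?thesis using inj_onD[OF inj, of x x'] x(1) sub openin_subset[OF U(1)] by auto
  qed
  then show "\<exists>x. generic_point S Z x" using x by (auto simp: generic_point_def)
qed

section \<open>The Zariski spectrum of a commutative ring\<close>

lemma (in cring) basic_open_mult:
  assumes "f \<in> carrier R" "g \<in> carrier R"
  shows "basic_open R f \<inter> basic_open R g = basic_open R (f \<otimes> g)"
proof -
  have "f \<otimes> g \<in> P \<longleftrightarrow> f \<in> P \<or> g \<in> P" if "primeideal P R" for P
  proof -
    interpret P: primeideal P R by fact
    show ?thesis using assms P.I_prime[of f g] P.I_l_closed[of g f] P.I_r_closed[of f g] by blast
  qed
  then show ?thesis by (auto simp: basic_open_def)
qed

lemma (in cring) basic_open_one: "basic_open R \<one> = {P. primeideal P R}"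
proof -
  have "\<one> \<notin> P" if "primeideal P R" for P
    using ideal.one_imp_carrier[OF primeideal.axioms(1)[OF that]] primeideal.I_notcarr[OF that] by auto
  then show ?thesis by (auto simp: basic_open_def)
qed

lemma (in cring) topspace_zariski: "topspace (zariski R) = {P. primeideal P R}"
  using basic_open_one unfolding zariski_def by (auto simp: basic_open_def)

lemma (in cring) openin_basic_open: "f \<in> carrier R \<Longrightarrow> openin (zariski R) (basic_open R f)"
  unfolding zariski_def by (intro topology_generated_by_Basis) auto

text \<open>Basic open sets are closed under binary intersection, so the subbasis of
  \<open>zariski\<close> is a basis.\<close>

lemma (in cring) openin_zariski_basis:
  assumes "openin (zariski R) U" "P \<in> U"
  obtains f where "f \<in> carrier R" "P \<in> basic_open R f" "basic_open R f \<subseteq> U"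
proof -
  have "generate_topology_on (basic_open R ` carrier R) U"
    using assms(1) unfolding zariski_def by (rule openin_topology_generated_by)
  then have "\<forall>P\<in>U. \<exists>f\<in>carrier R. P \<in> basic_open R f \<and> basic_open R f \<subseteq> U"
  proof (induction rule: generate_topology_on.induct)
    case (Int a b)
    show ?case
    proof
      fix P assume "P \<in> a \<inter> b"
      then obtain f g where fg: "f \<in> carrier R" "g \<in> carrier R" "P \<in> basic_open R f" "P \<in> basic_open R g"
        "basic_open R f \<subseteq> a" "basic_open R g \<subseteq> b" using Int by blast
      then show "\<exists>f\<in>carrier R. P \<in> basic_open R f \<and> basic_open R f \<subseteq> a \<inter> b"
        using basic_open_mult[of f g] by (intro bexI[of _ "f \<otimes> g"]) auto
    qed
  next
    case (UN K)
    then show ?case by (metis Union_iff Union_upper subset_trans)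
  qed auto
  then show thesis using assms(2) that by blast
qed

text \<open>The ideal \<open>I(C)\<close>, the intersection of the primes in \<open>C\<close>;
  restricting to the carrier makes it the unit ideal for empty \<open>C\<close>.\<close>

definition vanishing :: "('s, 'm) ring_scheme \<Rightarrow> 's set set \<Rightarrow> 's set" where
  "vanishing A C = {f \<in> carrier A. \<forall>P\<in>C. f \<in> P}"

lemma (in cring) vanishing_ideal:
  assumes "C \<subseteq> {P. primeideal P R}"
  shows "ideal (vanishing R C) R"
proof (rule idealI)
  have id: "ideal P R" if "P \<in> C" for P using assms that primeideal.axioms(1) by auto
  have ag: "additive_subgroup P R" if "P \<in> C" for P using id[OF that] ideal.axioms(1) by auto
  show "ring R" by (rule ring_axioms)
  show "subgroup (vanishing R C) (add_monoid R)"
    using additive_subgroup.a_closed[OF ag] additive_subgroup.a_inv_closed[OF ag] additive_subgroup.zero_closed[OF ag]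
    by (intro add.subgroupI) (auto simp: vanishing_def a_inv_def[symmetric])
  fix a x assume "a \<in> vanishing R C" "x \<in> carrier R"
  then show "x \<otimes> a \<in> vanishing R C" "a \<otimes> x \<in> vanishing R C"
    using ideal.I_l_closed[OF id] ideal.I_r_closed[OF id] by (auto simp: vanishing_def)
qed

text \<open>The inclusion of \<open>V(I(C))\<close> in \<open>C\<close>. If \<open>P\<close> were
  outside \<open>C\<close>, a basic open neighbourhood of \<open>P\<close> given by \<open>f\<close>
  would miss \<open>C\<close>, so that \<open>f\<close> would vanish on \<open>C\<close> without
  lying in \<open>P\<close>.\<close>

lemma (in cring) mem_closedin_zariski:
  assumes "closedin (zariski R) C" "primeideal P R" "vanishing R C \<subseteq> P"
  shows "P \<in> C"
proof (rule ccontr)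
  assume "P \<notin> C"
  then have "openin (zariski R) (topspace (zariski R) - C)" "P \<in> topspace (zariski R) - C"
    using assms(1,2) by (simp_all add: topspace_zariski closedin_def)
  then obtain f where f: "f \<in> carrier R" "P \<in> basic_open R f" "basic_open R f \<subseteq> topspace (zariski R) - C"
    by (rule openin_zariski_basis)
  have "C \<subseteq> {P. primeideal P R}" using closedin_subset[OF assms(1)] by (simp add: topspace_zariski)
  then have "f \<in> vanishing R C" using f unfolding vanishing_def basic_open_def by auto
  then show False using f assms(3) by (auto simp: basic_open_def)
qed

text \<open>The generic point of \<open>Z\<close> is its vanishing ideal. The basic open set of
  \<open>f\<close> meets \<open>Z\<close> iff \<open>f\<close> is outside this ideal, so
  irreducibility of \<open>Z\<close> translates into primality, and closedness of \<open>Z\<close>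
  puts the ideal into \<open>Z\<close>.\<close>

lemma (in cring) sober_zariski: "sober_space (zariski R)"
  unfolding sober_space_def
proof (intro conjI allI impI)
  show "t0_space (zariski R)"
    unfolding t0_space_def
  proof (intro ballI impI)
    fix P Q assume *: "P \<in> topspace (zariski R)" "Q \<in> topspace (zariski R)" "P \<noteq> Q"
    then have PQ: "primeideal P R" "primeideal Q R" by (auto simp: topspace_zariski)
    then have sub: "P \<subseteq> carrier R" "Q \<subseteq> carrier R"
      by (auto dest!: primeideal.axioms(1) ideal.axioms(1) additive_subgroup.a_subset)
    obtain f where "f \<in> P \<and> f \<notin> Q \<or> f \<in> Q \<and> f \<notin> P" using * by blast
    then have "f \<in> carrier R" "(P \<notin> basic_open R f) = (Q \<in> basic_open R f)"
      using PQ sub by (auto simp: basic_open_def)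
    then show "\<exists>U. openin (zariski R) U \<and> (P \<notin> U) = (Q \<in> U)" using openin_basic_open by blast
  qed
  fix Z assume Z: "irreducible_closed (zariski R) Z"
  then have cl: "closedin (zariski R) Z" by (simp add: irreducible_closed_def)
  then have sub: "Z \<subseteq> {P. primeideal P R}" using closedin_subset topspace_zariski by metis
  let ?I = "vanishing R Z"
  have meets: "basic_open R f \<inter> Z \<noteq> {} \<longleftrightarrow> f \<notin> ?I" if "f \<in> carrier R" for f
    using that sub by (auto simp: basic_open_def vanishing_def)
  have "primeideal ?I R"
  proof (rule primeidealI)
    show "ideal ?I R" by (rule vanishing_ideal[OF sub])
    show "cring R" by (rule is_cring)
    obtain P where P: "P \<in> Z" using Z by (auto simp: irreducible_closed_def)
    then have "basic_open R \<one> \<inter> Z \<noteq> {}" using sub basic_open_one by blast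
    then show "carrier R \<noteq> ?I" using meets[of \<one>] by auto
    fix a b assume ab: "a \<in> carrier R" "b \<in> carrier R" "a \<otimes> b \<in> ?I"
    show "a \<in> ?I \<or> b \<in> ?I"
    proof (rule ccontr)
      assume "\<not> (a \<in> ?I \<or> b \<in> ?I)"
      then have "basic_open R a \<inter> basic_open R b \<inter> Z \<noteq> {}"
        using Z openin_basic_open[OF ab(1)] openin_basic_open[OF ab(2)] meets[OF ab(1)] meets[OF ab(2)]
        by (simp add: irreducible_closed_def)
      then show False using meets[of "a \<otimes> b"] ab basic_open_mult by auto
    qed
  qed
  then have "?I \<in> Z" using mem_closedin_zariski[OF cl] by blast
  moreover have "?I \<in> U" if U: "openin (zariski R) U" "U \<inter> Z \<noteq> {}" for U
  proof -
    obtain P where P: "P \<in> U" "P \<in> Z" using U by blast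
    obtain f where f: "f \<in> carrier R" "P \<in> basic_open R f" "basic_open R f \<subseteq> U"
      by (rule openin_zariski_basis[OF U(1) P(1)])
    then have "?I \<in> basic_open R f" using meets[of f] P \<open>primeideal ?I R\<close> by (auto simp: basic_open_def)
    then show ?thesis using f by blast
  qed
  ultimately show "\<exists>x. generic_point (zariski R) Z x" unfolding generic_point_def by blast
qed

text \<open>Without a minimal member there is a strictly descending chain of closed sets. Its
  vanishing ideals become stationary, and a closed set can be recovered from its vanishing
  ideal.\<close>

lemma (in cring) noetherian_zariski:
  assumes "noetherian_within R (carrier R)"
  shows "noetherian_space (zariski R)"
  unfolding noetherian_space_def
proof (intro allI impI, elim conjE, rule ccontr)
  fix \<C> :: "'a set set set" assume ne: "\<C> \<noteq> {}" and cl: "\<forall>C\<in>\<C>. closedin (zariski R) C"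
    and no: "\<not> (\<exists>C\<in>\<C>. \<forall>D\<in>\<C>. D \<subseteq> C \<longrightarrow> D = C)"
  obtain C :: "nat \<Rightarrow> 'a set set" where C: "\<And>n. C n \<in> \<C>" "\<And>n. C (Suc n) \<subset> C n"
    using dependent_nat_choice[of "\<lambda>_ C. C \<in> \<C>" "\<lambda>_ C D. D \<subset> C"] ne no
    by (metis all_not_in_conv psubsetI)
  have sub: "C n \<subseteq> {P. primeideal P R}" for n
    using closedin_subset[of "zariski R" "C n"] C(1) cl by (simp add: topspace_zariski)
  have "ideal_within R (carrier R) (vanishing R (C n))" for n
  proof -
    interpret I: ideal "vanishing R (C n)" R by (rule vanishing_ideal[OF sub])
    show ?thesis unfolding ideal_within_def
      using I.I_l_closed I.zero_closed I.a_closed I.a_subset by (intro conjI ballI)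
  qed
  moreover have "vanishing R (C n) \<subseteq> vanishing R (C (Suc n))" for n
    using C(2)[of n] by (auto simp: vanishing_def)
  ultimately obtain n where n: "\<And>m. m \<ge> n \<Longrightarrow> vanishing R (C m) = vanishing R (C n)"
    using assms[unfolded noetherian_within_def, rule_format, of "\<lambda>n. vanishing R (C n)"] by blast
  obtain P where P: "P \<in> C n" "P \<notin> C (Suc n)" using C(2)[of n] by blast
  have "vanishing R (C (Suc n)) \<subseteq> P" using n[of "Suc n"] P by (auto simp: vanishing_def)
  then show False using mem_closedin_zariski[of "C (Suc n)" P] cl C(1) sub P by blast
qed

lemma variety_noetherian_sober:
  assumes F: "field F" and X: "variety F \<X>"
  shows "noetherian_space (topol \<X>) \<and> sober_space (topol \<X>)"
proof -
  obtain \<U> where \<U>: "finite \<U>" "\<Union>\<U> = points \<X>"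
    "\<And>U. U \<in> \<U> \<Longrightarrow> affine_open \<X> U" "\<And>U. U \<in> \<U> \<Longrightarrow> fin_gen_algebra F (sec \<X> U)"
    using X unfolding variety_def by (elim conjE exE) simp
  have op: "is_open \<X> U" if "U \<in> \<U>" for U using \<U>(3)[OF that] by (simp add: affine_open_def)
  have *: "noetherian_space (subtopology (topol \<X>) U) \<and> sober_space (subtopology (topol \<X>) U)" if U: "U \<in> \<U>" for U
  proof -
    have alg: "algebra F (sec \<X> U)"
      using X op[OF U] by (simp add: variety_def sheaf_of_algebras_def sheaf_of_def)
    obtain h where h: "homeomorphic_map (subtopology (topol \<X>) U) (zariski (sec \<X> U)) h"
      using \<U>(3)[OF U] unfolding affine_open_def by (elim conjE exE)
    have cr: "cring (sec \<X> U)" by (rule algebra.M_cring[OF alg])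
    show ?thesis
      using homeomorphic_map_noetherian_space[OF h] homeomorphic_map_sober_space[OF h]
        cring.sober_zariski[OF cr] cring.noetherian_zariski[OF cr] fin_gen_noetherian[OF alg F \<U>(4)[OF U]] by blast
  qed
  then show ?thesis using noetherian_space_cover[OF \<U>(1,2)] sober_space_cover[OF \<U>(2) op] by blast
qed

section \<open>Inverse limits of locally closed sets\<close>

lemma generic_pointD: "generic_point T Z x \<Longrightarrow> openin T U \<Longrightarrow> U \<inter> Z \<noteq> {} \<Longrightarrow> x \<in> U"
  by (simp add: generic_point_def)

lemma generic_point_unique:
  assumes "t0_space T" "generic_point T Z x" "generic_point T Z y" "Z \<subseteq> topspace T"
  shows "x = y"
proof (rule ccontr)
  assume "x \<noteq> y"
  moreover have xy: "x \<in> Z" "y \<in> Z" using assms(2,3) by (simp_all add: generic_point_def)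
  ultimately obtain U where U: "openin T U" "(x \<notin> U) = (y \<in> U)"
    using assms(1,4) unfolding t0_space_def by (meson subsetD)
  then have "U \<inter> Z \<noteq> {}" using xy by blast
  then have "x \<in> U" "y \<in> U" using assms(2,3) U(1) by (simp_all add: generic_point_def)
  then show False using U(2) by simp
qed

text \<open>\<open>Z n\<close> is chosen minimal among the closed sets whose preimage meets every later \<open>C m\<close>. Minimality
  makes \<open>Z n\<close> irreducible, each \<open>Z (Suc n) \<rightarrow> Z n\<close> dominant and \<open>Z n - U n\<close> equal to \<open>Z n\<close>; the
  generic points of the \<open>Z n\<close> are then compatible.\<close>

theorem inverse_limit_locally_closed_nonempty:
  fixes T :: "nat \<Rightarrow> 'a topology" and p :: "nat \<Rightarrow> nat \<Rightarrow> 'a \<Rightarrow> 'a"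
  assumes noe: "\<And>n. noetherian_space (T n)" and sob: "\<And>n. sober_space (T n)"
    and cont: "\<And>m n. m \<le> n \<Longrightarrow> continuous_map (T n) (T m) (p n m)"
    and pid: "\<And>n x. x \<in> topspace (T n) \<Longrightarrow> p n n x = x"
    and comp: "\<And>k m n x. k \<le> m \<Longrightarrow> m \<le> n \<Longrightarrow> x \<in> topspace (T n) \<Longrightarrow> p m k (p n m x) = p n k x"
    and W: "\<And>n. openin (T n) (W n)" and U: "\<And>n. openin (T n) (U n)"
    and ne: "\<And>n. W n - U n \<noteq> {}"
    and maps: "\<And>m n x. m \<le> n \<Longrightarrow> x \<in> W n - U n \<Longrightarrow> p n m x \<in> W m - U m"
  shows "\<exists>x. (\<forall>n. x n \<in> W n - U n) \<and> (\<forall>m n. m \<le> n \<longrightarrow> p n m (x n) = x m)"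
proof -
  define C where "C n = W n - U n" for n
  have Csub: "C n \<subseteq> topspace (T n)" for n using openin_subset[OF W[of n]] by (auto simp: C_def)
  define Q where "Q n Z \<longleftrightarrow> (\<forall>m\<ge>n. \<exists>c\<in>C m. p m n c \<in> Z)" for n Z
  define M where "M n Z \<longleftrightarrow> closedin (T n) Z \<and> Q n Z \<and> (\<forall>E. closedin (T n) E \<longrightarrow> Q n E \<longrightarrow> E \<subseteq> Z \<longrightarrow> E = Z)" for n Z
  have Q_step: "Q (Suc n) {x \<in> topspace (T (Suc n)). p (Suc n) n x \<in> Z}" if Q: "Q n Z" for n Z
    unfolding Q_def
  proof (intro allI impI)
    fix m assume m: "Suc n \<le> m"
    then obtain c where c: "c \<in> C m" "p m n c \<in> Z" using Q unfolding Q_def by (meson Suc_leD)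
    have cT: "c \<in> topspace (T m)" using c Csub by blast
    have "p m (Suc n) c \<in> topspace (T (Suc n))"
      using continuous_map_image_subset_topspace[OF cont[OF m]] cT by blast
    moreover have "p (Suc n) n (p m (Suc n) c) \<in> Z" using comp[OF _ m cT, of n] c(2) by simp
    ultimately show "\<exists>c\<in>C m. p m (Suc n) c \<in> {x \<in> topspace (T (Suc n)). p (Suc n) n x \<in> Z}"
      using c(1) by (intro bexI[of _ c]) simp_all
  qed
  have "\<exists>Z. M 0 Z"
  proof -
    have "p m 0 c \<in> topspace (T 0)" if "c \<in> C m" for m c
      using continuous_map_image_subset_topspace[OF cont[of 0 m]] that Csub[of m] by auto
    moreover have "\<exists>c. c \<in> C m" for m using ne[of m] by (auto simp: C_def)
    ultimately have "Q 0 (topspace (T 0))" unfolding Q_def by meson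
    then show ?thesis unfolding M_def
      using noetherian_space_minimal[OF noe, of 0 "topspace (T 0)" "Q 0"] by simp
  qed
  moreover have "\<exists>Z'. M (Suc n) Z' \<and> p (Suc n) n ` Z' \<subseteq> Z" if M: "M n Z" for n Z
  proof -
    let ?P = "{x \<in> topspace (T (Suc n)). p (Suc n) n x \<in> Z}"
    have MZ: "closedin (T n) Z" "Q n Z" using M unfolding M_def by auto
    have "closedin (T (Suc n)) ?P"
      using closedin_continuous_map_preimage[OF cont[of n "Suc n"] MZ(1)] by simp
    moreover have "Q (Suc n) ?P \<and> ?P \<subseteq> ?P" using Q_step[OF MZ(2)] by simp
    ultimately obtain D where D: "closedin (T (Suc n)) D" "Q (Suc n) D \<and> D \<subseteq> ?P"
      "\<forall>E. closedin (T (Suc n)) E \<longrightarrow> Q (Suc n) E \<and> E \<subseteq> ?P \<longrightarrow> E \<subseteq> D \<longrightarrow> E = D"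
      using noetherian_space_minimal[OF noe, of "Suc n" ?P "\<lambda>E. Q (Suc n) E \<and> E \<subseteq> ?P"] by auto
    \<comment> \<open>Minimality was obtained only among subsets of \<open>?P\<close>, but whatever
      lies in \<open>D\<close> lies in \<open>?P\<close>, so \<open>D\<close> is minimal
      outright.\<close>
    have "E = D" if "closedin (T (Suc n)) E" "Q (Suc n) E" "E \<subseteq> D" for E
      using D(2) D(3)[rule_format, of E] that by blast
    then have "M (Suc n) D" using D(1,2) by (simp add: M_def)
    then show ?thesis using D(2) by blast
  qed
  ultimately obtain Z where Z: "\<And>n. M n (Z n)" and Zp: "\<And>n. p (Suc n) n ` Z (Suc n) \<subseteq> Z n"
    using dependent_nat_choice[of M "\<lambda>n Z Z'. p (Suc n) n ` Z' \<subseteq> Z"] by metis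
  have Zc: "closedin (T n) (Z n)" and ZQ: "Q n (Z n)" for n using Z[of n] unfolding M_def by auto
  have Zsub: "Z n \<subseteq> topspace (T n)" for n using closedin_subset[OF Zc] .
  \<comment> \<open>Minimality enters in this form three times: for irreducibility, for avoiding
    \<open>U n\<close> and for dominance of the transition maps.\<close>
  have meets: "V \<inter> Z n = {}" if V: "openin (T n) V" and QV: "Q n (Z n - V)" for n V
  proof -
    have "closedin (T n) (Z n - V)" using Zc V by (rule closedin_diff)
    then have "Z n - V = Z n" using Z[of n] QV unfolding M_def by (simp add: Diff_subset)
    then show ?thesis by blast
  qed
  have "irreducible_closed (T n) (Z n)" for n
    unfolding irreducible_closed_def
  proof (intro conjI allI impI)
    show "Z n \<noteq> {}" using ZQ[of n] unfolding Q_def by blast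
    fix V1 V2 assume V: "openin (T n) V1 \<and> openin (T n) V2 \<and> V1 \<inter> Z n \<noteq> {} \<and> V2 \<inter> Z n \<noteq> {}"
    show "V1 \<inter> V2 \<inter> Z n \<noteq> {}"
    proof
      assume e: "V1 \<inter> V2 \<inter> Z n = {}"
      \<comment> \<open>As \<open>V1\<close> and \<open>V2\<close> meet \<open>Z n\<close>, removing
        either destroys \<open>Q n\<close>, at the levels \<open>m1\<close> and \<open>m2\<close>. A
        point of \<open>C\<close> at the larger level that maps into \<open>Z n\<close> also passes
        through \<open>C m1\<close> and \<open>C m2\<close>, so its image is forced into both
        \<open>V1\<close> and \<open>V2\<close>.\<close>
      obtain m1 where m1: "m1 \<ge> n" "\<And>c. c \<in> C m1 \<Longrightarrow> p m1 n c \<notin> Z n - V1"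
        using V meets[of n V1] unfolding Q_def by auto
      obtain m2 where m2: "m2 \<ge> n" "\<And>c. c \<in> C m2 \<Longrightarrow> p m2 n c \<notin> Z n - V2"
        using V meets[of n V2] unfolding Q_def by auto
      let ?m = "max m1 m2"
      obtain c where c: "c \<in> C ?m" "p ?m n c \<in> Z n" using ZQ[of n] m1(1) unfolding Q_def by (meson max.coboundedI1)
      have cT: "c \<in> topspace (T ?m)" using c Csub by blast
      have "p ?m m1 c \<in> C m1" "p ?m m2 c \<in> C m2" using maps c(1) by (simp_all add: C_def)
      moreover have "p m1 n (p ?m m1 c) = p ?m n c" "p m2 n (p ?m m2 c) = p ?m n c"
        using comp cT m1(1) m2(1) by simp_all
      ultimately have "p ?m n c \<in> V1" "p ?m n c \<in> V2" using m1(2) m2(2) c(2) by (metis DiffI, metis DiffI)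
      then show False using e c(2) by blast
    qed
  qed (rule Zc)
  then have "\<exists>x. generic_point (T n) (Z n) x" for n using sob[of n] by (simp add: sober_space_def)
  then obtain x where x: "\<And>n. generic_point (T n) (Z n) (x n)" by metis
  have xZ: "x n \<in> Z n" for n using x[of n] by (simp add: generic_point_def)
  have xT: "x n \<in> topspace (T n)" for n using xZ Zsub by blast
  have "x n \<in> C n" for n
  proof -
    \<comment> \<open>The case \<open>m = n\<close> of \<open>Q n\<close>: the set
      \<open>Z n\<close> contains a point of \<open>C n\<close> itself, so the open set
      \<open>W n\<close> meets \<open>Z n\<close> and hence contains the generic point.\<close>
    obtain c where c: "c \<in> C n" "p n n c \<in> Z n" using ZQ[of n] unfolding Q_def by blast
    then have "c \<in> W n \<inter> Z n" using pid Csub[of n] by (auto simp: C_def)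
    then have "x n \<in> W n" using x[of n] W[of n] unfolding generic_point_def by blast
    \<comment> \<open>Points of a later \<open>C m\<close> map into \<open>C n\<close>, outside
      \<open>U n\<close>, so removing \<open>U n\<close> from \<open>Z n\<close> loses no
      witness.\<close>
    moreover have "Q n (Z n - U n)" unfolding Q_def
    proof (intro allI impI)
      fix m assume m: "n \<le> m"
      then obtain c where "c \<in> C m" "p m n c \<in> Z n" using ZQ[of n] unfolding Q_def by blast
      moreover have "p m n c \<in> C n" using maps[OF m] \<open>c \<in> C m\<close> by (simp add: C_def)
      ultimately show "\<exists>c\<in>C m. p m n c \<in> Z n - U n" by (auto simp: C_def)
    qed
    then have "x n \<notin> U n" using meets[OF U] xZ[of n] by blast
    ultimately show ?thesis by (simp add: C_def)
  qed
  moreover have step: "p (Suc n) n (x (Suc n)) = x n" for n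
  proof (rule generic_point_unique[OF _ _ x Zsub])
    show "t0_space (T n)" using sob[of n] by (simp add: sober_space_def)
    show "generic_point (T n) (Z n) (p (Suc n) n (x (Suc n)))"
      unfolding generic_point_def
    proof (intro conjI allI impI)
      show "p (Suc n) n (x (Suc n)) \<in> Z n" using Zp[of n] xZ[of "Suc n"] by blast
      fix V assume V: "openin (T n) V \<and> V \<inter> Z n \<noteq> {}"
      let ?V = "{y \<in> topspace (T (Suc n)). p (Suc n) n y \<in> V}"
      have oV: "openin (T (Suc n)) ?V"
        using openin_continuous_map_preimage[OF cont[of n "Suc n"] conjunct1[OF V]] by simp
      have "?V \<inter> Z (Suc n) \<noteq> {}"
      proof
        assume e: "?V \<inter> Z (Suc n) = {}"
        have "Q n (Z n - V)" unfolding Q_def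
        proof (intro allI impI)
          fix m assume m: "n \<le> m"
          \<comment> \<open>\<open>Q (Suc n)\<close> speaks of levels from \<open>Suc n\<close> on,
            while here \<open>m\<close> may be \<open>n\<close>. A witness is taken at the maximum
            and pushed down to \<open>C m\<close>.\<close>
          let ?m = "max m (Suc n)"
          obtain c where c: "c \<in> C ?m" "p ?m (Suc n) c \<in> Z (Suc n)"
            using ZQ[of "Suc n"] unfolding Q_def by (meson max.cobounded2)
          have cT: "c \<in> topspace (T ?m)" using c Csub by blast
          have "p (Suc n) n (p ?m (Suc n) c) \<in> Z n - V" using Zp[of n] c(2) e Zsub[of "Suc n"] by blast
          then have "p m n (p ?m m c) \<in> Z n - V" using comp[OF _ _ cT] m by simp
          moreover have "p ?m m c \<in> C m" using maps[of m ?m c] c(1) by (simp add: C_def)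
          ultimately show "\<exists>c\<in>C m. p m n c \<in> Z n - V" by (intro bexI[of _ "p ?m m c"])
        qed
        then show False using meets V by blast
      qed
      then have "x (Suc n) \<in> ?V" by (rule generic_pointD[OF x oV])
      then show "p (Suc n) n (x (Suc n)) \<in> V" by simp
    qed
  qed
  have "p n m (x n) = x m" if "m \<le> n" for m n
    using that
  proof (induction n rule: dec_induct)
    case base
    show ?case using pid xT by blast
  next
    case (step k)
    have "p (Suc k) m (x (Suc k)) = p k m (p (Suc k) k (x (Suc k)))"
      using comp[of m k "Suc k"] step(1) xT by simp
    then show ?case using step \<open>\<And>n. p (Suc n) n (x (Suc n)) = x n\<close> by simp
  qed
  ultimately show ?thesis unfolding C_def by blast
qed

section \<open>Limits of Poisson algebras\<close>

lemma poisson_algebraI: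
  fixes F :: "('f, 'e) ring_scheme" (structure) and A :: "('f, 's, 'm) poisson_scheme" (structure)
  assumes "cring F"
    and "\<And>x y. x \<in> carrier A \<Longrightarrow> y \<in> carrier A \<Longrightarrow> x \<oplus>\<^bsub>A\<^esub> y \<in> carrier A"
    and "\<zero>\<^bsub>A\<^esub> \<in> carrier A"
    and "\<And>x y z. x \<in> carrier A \<Longrightarrow> y \<in> carrier A \<Longrightarrow> z \<in> carrier A \<Longrightarrow> (x \<oplus>\<^bsub>A\<^esub> y) \<oplus>\<^bsub>A\<^esub> z = x \<oplus>\<^bsub>A\<^esub> (y \<oplus>\<^bsub>A\<^esub> z)"
    and "\<And>x y. x \<in> carrier A \<Longrightarrow> y \<in> carrier A \<Longrightarrow> x \<oplus>\<^bsub>A\<^esub> y = y \<oplus>\<^bsub>A\<^esub> x"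
    and "\<And>x. x \<in> carrier A \<Longrightarrow> \<zero>\<^bsub>A\<^esub> \<oplus>\<^bsub>A\<^esub> x = x"
    and "\<And>x. x \<in> carrier A \<Longrightarrow> \<exists>y\<in>carrier A. y \<oplus>\<^bsub>A\<^esub> x = \<zero>\<^bsub>A\<^esub>"
    and "\<And>x y. x \<in> carrier A \<Longrightarrow> y \<in> carrier A \<Longrightarrow> x \<otimes>\<^bsub>A\<^esub> y \<in> carrier A"
    and "\<one>\<^bsub>A\<^esub> \<in> carrier A"
    and "\<And>x y z. x \<in> carrier A \<Longrightarrow> y \<in> carrier A \<Longrightarrow> z \<in> carrier A \<Longrightarrow> (x \<otimes>\<^bsub>A\<^esub> y) \<otimes>\<^bsub>A\<^esub> z = x \<otimes>\<^bsub>A\<^esub> (y \<otimes>\<^bsub>A\<^esub> z)"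
    and "\<And>x. x \<in> carrier A \<Longrightarrow> \<one>\<^bsub>A\<^esub> \<otimes>\<^bsub>A\<^esub> x = x"
    and "\<And>x y. x \<in> carrier A \<Longrightarrow> y \<in> carrier A \<Longrightarrow> x \<otimes>\<^bsub>A\<^esub> y = y \<otimes>\<^bsub>A\<^esub> x"
    and "\<And>x y z. x \<in> carrier A \<Longrightarrow> y \<in> carrier A \<Longrightarrow> z \<in> carrier A
          \<Longrightarrow> (x \<oplus>\<^bsub>A\<^esub> y) \<otimes>\<^bsub>A\<^esub> z = (x \<otimes>\<^bsub>A\<^esub> z) \<oplus>\<^bsub>A\<^esub> (y \<otimes>\<^bsub>A\<^esub> z)"
    and "\<And>c x. c \<in> carrier F \<Longrightarrow> x \<in> carrier A \<Longrightarrow> c \<odot>\<^bsub>A\<^esub> x \<in> carrier A"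
    and "\<And>c d x. c \<in> carrier F \<Longrightarrow> d \<in> carrier F \<Longrightarrow> x \<in> carrier A
          \<Longrightarrow> (c \<oplus>\<^bsub>F\<^esub> d) \<odot>\<^bsub>A\<^esub> x = (c \<odot>\<^bsub>A\<^esub> x) \<oplus>\<^bsub>A\<^esub> (d \<odot>\<^bsub>A\<^esub> x)"
    and "\<And>c x y. c \<in> carrier F \<Longrightarrow> x \<in> carrier A \<Longrightarrow> y \<in> carrier A
          \<Longrightarrow> c \<odot>\<^bsub>A\<^esub> (x \<oplus>\<^bsub>A\<^esub> y) = (c \<odot>\<^bsub>A\<^esub> x) \<oplus>\<^bsub>A\<^esub> (c \<odot>\<^bsub>A\<^esub> y)"
    and "\<And>c d x. c \<in> carrier F \<Longrightarrow> d \<in> carrier F \<Longrightarrow> x \<in> carrier A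
          \<Longrightarrow> (c \<otimes>\<^bsub>F\<^esub> d) \<odot>\<^bsub>A\<^esub> x = c \<odot>\<^bsub>A\<^esub> (d \<odot>\<^bsub>A\<^esub> x)"
    and "\<And>x. x \<in> carrier A \<Longrightarrow> \<one>\<^bsub>F\<^esub> \<odot>\<^bsub>A\<^esub> x = x"
    and "\<And>c x y. c \<in> carrier F \<Longrightarrow> x \<in> carrier A \<Longrightarrow> y \<in> carrier A
          \<Longrightarrow> (c \<odot>\<^bsub>A\<^esub> x) \<otimes>\<^bsub>A\<^esub> y = c \<odot>\<^bsub>A\<^esub> (x \<otimes>\<^bsub>A\<^esub> y)"
    and "poisson_algebra_axioms F A"
  shows "poisson_algebra F A"
proof -
  have "abelian_group A" using assms(2-7) by (intro abelian_groupI) simp_all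
  moreover have "comm_monoid A" using assms(8-12) by (intro comm_monoidI) simp_all
  ultimately have "cring A" using assms(13) by (intro cringI) simp_all
  then have "algebra F A" using assms(1,14-19) by (intro algebraI) simp_all
  then show ?thesis using assms(20) by (intro poisson_algebra.intro)
qed

lemma poisson_hom_closed: "h \<in> poisson_hom F A B \<Longrightarrow> x \<in> carrier A \<Longrightarrow> h x \<in> carrier B"
  and poisson_hom_mult: "h \<in> poisson_hom F A B \<Longrightarrow> x \<in> carrier A \<Longrightarrow> y \<in> carrier A
    \<Longrightarrow> h (x \<otimes>\<^bsub>A\<^esub> y) = h x \<otimes>\<^bsub>B\<^esub> h y"
  and poisson_hom_add: "h \<in> poisson_hom F A B \<Longrightarrow> x \<in> carrier A \<Longrightarrow> y \<in> carrier A
    \<Longrightarrow> h (x \<oplus>\<^bsub>A\<^esub> y) = h x \<oplus>\<^bsub>B\<^esub> h y"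
  and poisson_hom_one: "h \<in> poisson_hom F A B \<Longrightarrow> h \<one>\<^bsub>A\<^esub> = \<one>\<^bsub>B\<^esub>"
  and poisson_hom_smult: "h \<in> poisson_hom F A B \<Longrightarrow> c \<in> carrier F \<Longrightarrow> x \<in> carrier A
    \<Longrightarrow> h (c \<odot>\<^bsub>A\<^esub> x) = c \<odot>\<^bsub>B\<^esub> h x"
  and poisson_hom_bracket: "h \<in> poisson_hom F A B \<Longrightarrow> x \<in> carrier A \<Longrightarrow> y \<in> carrier A
    \<Longrightarrow> h \<lbrace>x, y\<rbrace>\<^bsub>A\<^esub> = \<lbrace>h x, h y\<rbrace>\<^bsub>B\<^esub>"
  by (simp_all add: poisson_hom_def alg_hom_def ring_hom_def Pi_iff)

lemma poisson_homI:
  assumes "\<And>x. x \<in> carrier A \<Longrightarrow> h x \<in> carrier B"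
    and "\<And>x y. x \<in> carrier A \<Longrightarrow> y \<in> carrier A \<Longrightarrow> h (x \<otimes>\<^bsub>A\<^esub> y) = h x \<otimes>\<^bsub>B\<^esub> h y"
    and "\<And>x y. x \<in> carrier A \<Longrightarrow> y \<in> carrier A \<Longrightarrow> h (x \<oplus>\<^bsub>A\<^esub> y) = h x \<oplus>\<^bsub>B\<^esub> h y"
    and "h \<one>\<^bsub>A\<^esub> = \<one>\<^bsub>B\<^esub>"
    and "\<And>c x. c \<in> carrier F \<Longrightarrow> x \<in> carrier A \<Longrightarrow> h (c \<odot>\<^bsub>A\<^esub> x) = c \<odot>\<^bsub>B\<^esub> h x"
    and "\<And>x y. x \<in> carrier A \<Longrightarrow> y \<in> carrier A \<Longrightarrow> h \<lbrace>x, y\<rbrace>\<^bsub>A\<^esub> = \<lbrace>h x, h y\<rbrace>\<^bsub>B\<^esub>"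
  shows "h \<in> poisson_hom F A B"
  using assms by (simp add: poisson_hom_def alg_hom_def ring_hom_def)

lemma poisson_algebra_ring: "poisson_algebra F A \<Longrightarrow> ring A"
  by (rule cring.axioms(1)[OF algebra.M_cring[OF poisson_algebra.axioms(1)]])

lemma poisson_algebra_base: "poisson_algebra F A \<Longrightarrow> cring F"
  by (rule algebra.R_cring[OF poisson_algebra.axioms(1)])

lemma poisson_hom_zero:
  assumes "poisson_algebra F A" "poisson_algebra F B" "h \<in> poisson_hom F A B"
  shows "h \<zero>\<^bsub>A\<^esub> = \<zero>\<^bsub>B\<^esub>"
  using ring_hom_zero[of h A B] assms(3) poisson_algebra_ring[OF assms(1)] poisson_algebra_ring[OF assms(2)]
  by (simp add: poisson_hom_def alg_hom_def)

lemma poisson_hom_minus: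
  assumes "poisson_algebra F A" "poisson_algebra F B" "h \<in> poisson_hom F A B" "x \<in> carrier A"
  shows "h (\<ominus>\<^bsub>A\<^esub> x) = \<ominus>\<^bsub>B\<^esub> h x"
proof -
  interpret ring_hom_ring A B h
    using assms(3) poisson_algebra_ring[OF assms(1)] poisson_algebra_ring[OF assms(2)]
    by (intro ring_hom_ringI2) (simp_all add: poisson_hom_def alg_hom_def)
  show ?thesis using assms(4) by simp
qed

lemma (in poisson_algebra) poisson_algebra_facts:
  "cring F" "cring A" "algebra F A" "poisson_algebra F A"
  using R_cring M_cring algebra_axioms poisson_algebra_axioms by auto

section \<open>Direct limits\<close>

locale poisson_direct_system =
  fixes F :: "('f, 'e) ring_scheme" and n :: nat and D :: "nat \<Rightarrow> ('f, 's) poisson"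
    and t :: "nat \<Rightarrow> nat \<Rightarrow> 's \<Rightarrow> 's"
  assumes stage_algebra: "n \<le> k \<Longrightarrow> poisson_algebra F (D k)"
    and trans_hom: "n \<le> k \<Longrightarrow> k \<le> l \<Longrightarrow> t k l \<in> poisson_hom F (D k) (D l)"
    and trans_id: "n \<le> k \<Longrightarrow> s \<in> carrier (D k) \<Longrightarrow> t k k s = s"
    and trans_comp: "n \<le> k \<Longrightarrow> k \<le> l \<Longrightarrow> l \<le> m \<Longrightarrow> s \<in> carrier (D k) \<Longrightarrow> t l m (t k l s) = t k m s"
begin

abbreviation g where "g \<equiv> germ n D t"

abbreviation L where "L \<equiv> direct_limit n D t"

lemma mem_germ: "(l, u) \<in> g k s \<longleftrightarrow> n \<le> l \<and> u \<in> carrier (D l) \<and> (\<exists>m. k \<le> m \<and> l \<le> m \<and> t k m s = t l m u)"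
  by (simp add: germ_def)

lemma self_mem_germ: "n \<le> k \<Longrightarrow> s \<in> carrier (D k) \<Longrightarrow> (k, s) \<in> g k s"
  by (auto simp: mem_germ)

lemma trans_closed: "n \<le> k \<Longrightarrow> k \<le> l \<Longrightarrow> s \<in> carrier (D k) \<Longrightarrow> t k l s \<in> carrier (D l)"
  using poisson_hom_closed[OF trans_hom] .

lemma trans_eq_mono:
  assumes "n \<le> k" "n \<le> l" "s \<in> carrier (D k)" "u \<in> carrier (D l)" "k \<le> m" "l \<le> m" "t k m s = t l m u" "m \<le> m'"
  shows "t k m' s = t l m' u"
  using trans_comp[of k m m' s] trans_comp[of l m m' u] assms by simp

lemma germ_subset:
  assumes "n \<le> k" "n \<le> l" "s \<in> carrier (D k)" "u \<in> carrier (D l)" "k \<le> m" "l \<le> m" "t k m s = t l m u"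
  shows "g k s \<subseteq> g l u"
proof clarify
  fix j w assume "(j, w) \<in> g k s"
  then obtain m' where j: "n \<le> j" "w \<in> carrier (D j)" and m': "k \<le> m'" "j \<le> m'" "t k m' s = t j m' w"
    by (auto simp: mem_germ)
  let ?M = "max m m'"
  have "t l ?M u = t k ?M s" using trans_eq_mono[OF assms, of ?M] by simp
  also have "\<dots> = t j ?M w" using trans_eq_mono[OF assms(1) j(1) assms(3) j(2) m', of ?M] by simp
  finally have "l \<le> ?M \<and> j \<le> ?M \<and> t l ?M u = t j ?M w" using assms(6) m'(2) by (simp add: le_max_iff_disj)
  then show "(j, w) \<in> g l u" using j unfolding mem_germ by blast
qed

lemma germ_eq_iff:
  assumes "n \<le> k" "n \<le> l" "s \<in> carrier (D k)" "u \<in> carrier (D l)"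
  shows "g k s = g l u \<longleftrightarrow> (\<exists>m. k \<le> m \<and> l \<le> m \<and> t k m s = t l m u)"
proof
  assume "g k s = g l u"
  then have "(l, u) \<in> g k s" using self_mem_germ[OF assms(2,4)] by simp
  then show "\<exists>m. k \<le> m \<and> l \<le> m \<and> t k m s = t l m u" by (simp add: mem_germ)
next
  assume "\<exists>m. k \<le> m \<and> l \<le> m \<and> t k m s = t l m u"
  then obtain m where m: "k \<le> m" "l \<le> m" "t k m s = t l m u" by auto
  show "g k s = g l u"
    using germ_subset[OF assms m] germ_subset[OF assms(2,1,4,3) m(2,1) m(3)[symmetric]] by (rule equalityI)
qed

lemma germ_trans:
  assumes "n \<le> k" "k \<le> m" "s \<in> carrier (D k)"
  shows "g m (t k m s) = g k s"
proof -
  have "t m m (t k m s) = t k m s" using trans_id[of m] trans_closed assms by simp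
  then show ?thesis using assms trans_closed[OF assms] by (subst germ_eq_iff) auto
qed

lemma carrier_limit: "carrier L = {g k s | k s. n \<le> k \<and> s \<in> carrier (D k)}"
  by (simp add: direct_limit_def)

lemma germ_closed: "n \<le> k \<Longrightarrow> s \<in> carrier (D k) \<Longrightarrow> g k s \<in> carrier L"
  by (auto simp: carrier_limit)

lemma germ_cases:
  assumes "a \<in> carrier L"
  obtains k s where "n \<le> k" "s \<in> carrier (D k)" "a = g k s"
  using assms by (auto simp: carrier_limit)

lemma germ_cases_above:
  assumes "a \<in> carrier L"
  obtains k s where "m \<le> k" "n \<le> k" "s \<in> carrier (D k)" "a = g k s"
proof -
  obtain k s where ks: "n \<le> k" "s \<in> carrier (D k)" "a = g k s" using assms by (rule germ_cases)
  show thesis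
    using that[of "max k m" "t k (max k m) s"] ks trans_closed[of k "max k m" s] germ_trans[of k "max k m" s] by simp
qed

lemma germ_cases2:
  assumes "a \<in> carrier L" "b \<in> carrier L"
  obtains k x y where "n \<le> k" "x \<in> carrier (D k)" "y \<in> carrier (D k)" "a = g k x" "b = g k y"
proof -
  obtain k x where k: "n \<le> k" "x \<in> carrier (D k)" "a = g k x" using assms(1) by (rule germ_cases)
  obtain l y where l: "k \<le> l" "n \<le> l" "y \<in> carrier (D l)" "b = g l y" using assms(2) by (rule germ_cases_above)
  show thesis
    using that[of l "t k l x" y] k l trans_closed[of k l x] germ_trans[of k l x] by simp
qed

text \<open>Each Poisson algebra axiom involves at most three algebra elements, so it can be checked
  in the one algebra \<open>D k\<close> where all three are represented.\<close>

lemma germ_cases3: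
  assumes "a \<in> carrier L" "b \<in> carrier L" "c \<in> carrier L"
  obtains k x y z where "n \<le> k" "x \<in> carrier (D k)" "y \<in> carrier (D k)" "z \<in> carrier (D k)"
    "a = g k x" "b = g k y" "c = g k z"
proof -
  obtain k x y where k: "n \<le> k" "x \<in> carrier (D k)" "y \<in> carrier (D k)" "a = g k x" "b = g k y"
    using assms(1,2) by (rule germ_cases2)
  obtain l z where l: "k \<le> l" "n \<le> l" "z \<in> carrier (D l)" "c = g l z" using assms(3) by (rule germ_cases_above)
  show thesis
    using that[of l "t k l x" "t k l y" z] k l trans_closed[of k l] germ_trans[of k l] by simp
qed

text \<open>Any two choices of representatives agree at a later stage, where the compatibility of
  \<open>f\<close> with \<open>t\<close> identifies the results. The union that defines an operation
  therefore runs over a singleton.\<close>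

lemma germ_binary:
  assumes cl: "\<And>k x y. n \<le> k \<Longrightarrow> x \<in> carrier (D k) \<Longrightarrow> y \<in> carrier (D k) \<Longrightarrow> f k x y \<in> carrier (D k)"
    and hom: "\<And>k m x y. n \<le> k \<Longrightarrow> k \<le> m \<Longrightarrow> x \<in> carrier (D k) \<Longrightarrow> y \<in> carrier (D k)
          \<Longrightarrow> t k m (f k x y) = f m (t k m x) (t k m y)"
    and i: "n \<le> i" and a: "a \<in> carrier (D i)" and b: "b \<in> carrier (D i)"
  shows "\<Union>{g k (f k x y) | k x y. (k, x) \<in> g i a \<and> (k, y) \<in> g i b} = g i (f i a b)"
proof -
  have "g k (f k x y) = g i (f i a b)" if x: "(k, x) \<in> g i a" and y: "(k, y) \<in> g i b" for k x y
  proof -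
    have k: "n \<le> k" and xk: "x \<in> carrier (D k)" and yk: "y \<in> carrier (D k)" using x y by (simp_all add: mem_germ)
    obtain m1 where m1: "i \<le> m1" "k \<le> m1" "t i m1 a = t k m1 x" using x by (auto simp: mem_germ)
    obtain m2 where m2: "i \<le> m2" "k \<le> m2" "t i m2 b = t k m2 y" using y by (auto simp: mem_germ)
    let ?M = "max m1 m2"
    have M: "i \<le> ?M" "k \<le> ?M" using m1 by simp_all
    have "t i ?M a = t k ?M x" "t i ?M b = t k ?M y"
      using trans_eq_mono[OF i k a xk m1, of ?M] trans_eq_mono[OF i k b yk m2, of ?M] by simp_all
    then have "t k ?M (f k x y) = t i ?M (f i a b)"
      using hom[OF k M(2) xk yk] hom[OF i M(1) a b] by simp
    then show ?thesis using germ_eq_iff[OF k i cl[OF k xk yk] cl[OF i a b]] M by blast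
  qed
  moreover have "(i, a) \<in> g i a" "(i, b) \<in> g i b" using self_mem_germ i a b by simp_all
  ultimately have "{g k (f k x y) | k x y. (k, x) \<in> g i a \<and> (k, y) \<in> g i b} = {g i (f i a b)}" by blast
  then show ?thesis by simp
qed

lemma
  assumes "n \<le> k" "x \<in> carrier (D k)"
  shows stage_minus_closed: "\<ominus>\<^bsub>D k\<^esub> x \<in> carrier (D k)"
    and stage_smult_closed: "c \<in> carrier F \<Longrightarrow> c \<odot>\<^bsub>D k\<^esub> x \<in> carrier (D k)"
    and stage_add_closed: "y \<in> carrier (D k) \<Longrightarrow> x \<oplus>\<^bsub>D k\<^esub> y \<in> carrier (D k)"
    and stage_mult_closed: "y \<in> carrier (D k) \<Longrightarrow> x \<otimes>\<^bsub>D k\<^esub> y \<in> carrier (D k)"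
    and stage_bracket_closed: "y \<in> carrier (D k) \<Longrightarrow> \<lbrace>x, y\<rbrace>\<^bsub>D k\<^esub> \<in> carrier (D k)"
proof -
  interpret A: poisson_algebra F "D k" using assms(1) by (rule stage_algebra)
  show "\<ominus>\<^bsub>D k\<^esub> x \<in> carrier (D k)" "c \<in> carrier F \<Longrightarrow> c \<odot>\<^bsub>D k\<^esub> x \<in> carrier (D k)"
    "y \<in> carrier (D k) \<Longrightarrow> x \<oplus>\<^bsub>D k\<^esub> y \<in> carrier (D k)" "y \<in> carrier (D k) \<Longrightarrow> x \<otimes>\<^bsub>D k\<^esub> y \<in> carrier (D k)"
    "y \<in> carrier (D k) \<Longrightarrow> \<lbrace>x, y\<rbrace>\<^bsub>D k\<^esub> \<in> carrier (D k)"
    using assms(2) A.pb_closed by simp_all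
qed

lemma
  assumes k: "n \<le> k"
  shows stage_zero_closed: "\<zero>\<^bsub>D k\<^esub> \<in> carrier (D k)" and stage_one_closed: "\<one>\<^bsub>D k\<^esub> \<in> carrier (D k)"
proof -
  interpret A: poisson_algebra F "D k" using assms(1) by (rule stage_algebra)
  show "\<zero>\<^bsub>D k\<^esub> \<in> carrier (D k)" "\<one>\<^bsub>D k\<^esub> \<in> carrier (D k)" by simp_all
qed

lemma
  assumes "n \<le> k" "x \<in> carrier (D k)" "y \<in> carrier (D k)"
  shows germ_mult: "g k x \<otimes>\<^bsub>L\<^esub> g k y = g k (x \<otimes>\<^bsub>D k\<^esub> y)"
    and germ_add: "g k x \<oplus>\<^bsub>L\<^esub> g k y = g k (x \<oplus>\<^bsub>D k\<^esub> y)"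
    and germ_bracket: "\<lbrace>g k x, g k y\<rbrace>\<^bsub>L\<^esub> = g k \<lbrace>x, y\<rbrace>\<^bsub>D k\<^esub>"
  using germ_binary[of "\<lambda>k x y. x \<otimes>\<^bsub>D k\<^esub> y", OF stage_mult_closed poisson_hom_mult[OF trans_hom] assms]
    germ_binary[of "\<lambda>k x y. x \<oplus>\<^bsub>D k\<^esub> y", OF stage_add_closed poisson_hom_add[OF trans_hom] assms]
    germ_binary[of "\<lambda>k x y. \<lbrace>x, y\<rbrace>\<^bsub>D k\<^esub>", OF stage_bracket_closed poisson_hom_bracket[OF trans_hom] assms]
  by (simp_all add: direct_limit_def)

lemma germ_smult:
  assumes "c \<in> carrier F" "n \<le> k" "x \<in> carrier (D k)"
  shows "c \<odot>\<^bsub>L\<^esub> g k x = g k (c \<odot>\<^bsub>D k\<^esub> x)"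
proof -
  \<comment> \<open>Scalar multiplication becomes an instance of \<open>germ_binary\<close> as an
    operation that ignores its second argument; for the dummy \<open>z\<close> one may take
    \<open>y\<close>.\<close>
  have "{g l (c \<odot>\<^bsub>D l\<^esub> y) |l y. (l, y) \<in> g k x} = {g l (c \<odot>\<^bsub>D l\<^esub> y) |l y z. (l, y) \<in> g k x \<and> (l, z) \<in> g k x}"
    by blast
  then show ?thesis
    using germ_binary[of "\<lambda>k x y. c \<odot>\<^bsub>D k\<^esub> x", OF stage_smult_closed poisson_hom_smult[OF trans_hom], OF _ _ assms(1) _ _ assms(1) _ assms(2,3,3)]
      assms(1) by (simp add: direct_limit_def)
qed

lemma germ_zero: "n \<le> k \<Longrightarrow> g k \<zero>\<^bsub>D k\<^esub> = \<zero>\<^bsub>L\<^esub>"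
  using germ_trans[OF order_refl _ stage_zero_closed[OF order_refl], of k]
    poisson_hom_zero[OF stage_algebra[OF order_refl] stage_algebra trans_hom[OF order_refl], of k]
  by (simp add: direct_limit_def)

lemma germ_one: "n \<le> k \<Longrightarrow> g k \<one>\<^bsub>D k\<^esub> = \<one>\<^bsub>L\<^esub>"
  using germ_trans[OF order_refl _ stage_one_closed[OF order_refl], of k]
    poisson_hom_one[OF trans_hom[OF order_refl], of k]
  by (simp add: direct_limit_def)

lemmas germ_ops = germ_mult germ_add germ_bracket germ_smult germ_closed
  stage_minus_closed stage_smult_closed stage_add_closed stage_mult_closed stage_bracket_closed
  stage_zero_closed stage_one_closed

theorem direct_limit_poisson_algebra: "poisson_algebra F L"
proof (rule poisson_algebraI)
  note simps = germ_ops germ_zero[symmetric] germ_one[symmetric]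
  have alg: "cring (D k)" "algebra F (D k)" "poisson_algebra F (D k)" if "n \<le> k" for k
    using poisson_algebra.poisson_algebra_facts[OF stage_algebra[OF that]] by simp_all
  show F: "cring F" by (rule poisson_algebra_base[OF stage_algebra[OF order_refl]])
  show "\<zero>\<^bsub>L\<^esub> \<in> carrier L" "\<one>\<^bsub>L\<^esub> \<in> carrier L"
    using germ_closed stage_zero_closed stage_one_closed by (simp_all flip: germ_zero[OF order_refl] germ_one[OF order_refl])
  { fix a assume "a \<in> carrier L"
    then obtain k x where k: "n \<le> k" and [simp]: "x \<in> carrier (D k)" "a = g k x" by (rule germ_cases)
    interpret A: poisson_algebra F "D k" using alg(3)[OF k] .
    show "\<zero>\<^bsub>L\<^esub> \<oplus>\<^bsub>L\<^esub> a = a" "\<one>\<^bsub>L\<^esub> \<otimes>\<^bsub>L\<^esub> a = a" "\<one>\<^bsub>F\<^esub> \<odot>\<^bsub>L\<^esub> a = a"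
      using k F by (simp_all add: simps flip: germ_zero[OF k] germ_one[OF k])
    have "g k (\<ominus>\<^bsub>D k\<^esub> x) \<oplus>\<^bsub>L\<^esub> a = \<zero>\<^bsub>L\<^esub>" using k by (simp add: simps A.l_neg flip: germ_zero[OF k])
    then show "\<exists>b\<in>carrier L. b \<oplus>\<^bsub>L\<^esub> a = \<zero>\<^bsub>L\<^esub>" using k by (intro bexI[of _ "g k (\<ominus>\<^bsub>D k\<^esub> x)"]) (simp_all add: germ_ops)
    have br: "\<lbrace>a, a\<rbrace>\<^bsub>L\<^esub> = \<zero>\<^bsub>L\<^esub>" using k by (simp add: germ_ops A.pb_alternating flip: germ_zero[OF k])
    { fix c d assume c: "c \<in> carrier F"
      show "c \<odot>\<^bsub>L\<^esub> a \<in> carrier L" using c k by (simp add: germ_ops)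
      assume d: "d \<in> carrier F"
      show "(c \<oplus>\<^bsub>F\<^esub> d) \<odot>\<^bsub>L\<^esub> a = (c \<odot>\<^bsub>L\<^esub> a) \<oplus>\<^bsub>L\<^esub> (d \<odot>\<^bsub>L\<^esub> a)"
        "(c \<otimes>\<^bsub>F\<^esub> d) \<odot>\<^bsub>L\<^esub> a = c \<odot>\<^bsub>L\<^esub> (d \<odot>\<^bsub>L\<^esub> a)"
        using c d k by (simp_all add: germ_ops A.smult_l_distr A.smult_assoc1) }
    note br }
  note alternating = this
  { fix a b assume "a \<in> carrier L" "b \<in> carrier L"
    then obtain k x y where k: "n \<le> k" and [simp]: "x \<in> carrier (D k)" "y \<in> carrier (D k)" "a = g k x" "b = g k y"
      by (rule germ_cases2)
    interpret A: poisson_algebra F "D k" using alg(3)[OF k] .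
    show "a \<oplus>\<^bsub>L\<^esub> b \<in> carrier L" "a \<otimes>\<^bsub>L\<^esub> b \<in> carrier L" using k by (simp_all add: germ_ops)
    have bracket_closed: "\<lbrace>a, b\<rbrace>\<^bsub>L\<^esub> \<in> carrier L" using k by (simp add: germ_ops)
    show "a \<oplus>\<^bsub>L\<^esub> b = b \<oplus>\<^bsub>L\<^esub> a" "a \<otimes>\<^bsub>L\<^esub> b = b \<otimes>\<^bsub>L\<^esub> a"
      using k by (simp_all add: germ_ops A.a_comm A.m_comm)
    { fix c assume c: "c \<in> carrier F"
      show "c \<odot>\<^bsub>L\<^esub> (a \<oplus>\<^bsub>L\<^esub> b) = (c \<odot>\<^bsub>L\<^esub> a) \<oplus>\<^bsub>L\<^esub> (c \<odot>\<^bsub>L\<^esub> b)"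
        "(c \<odot>\<^bsub>L\<^esub> a) \<otimes>\<^bsub>L\<^esub> b = c \<odot>\<^bsub>L\<^esub> (a \<otimes>\<^bsub>L\<^esub> b)"
        using c k by (simp_all add: germ_ops A.smult_r_distr A.smult_assoc2)
      have "\<lbrace>c \<odot>\<^bsub>L\<^esub> a, b\<rbrace>\<^bsub>L\<^esub> = c \<odot>\<^bsub>L\<^esub> \<lbrace>a, b\<rbrace>\<^bsub>L\<^esub>" "\<lbrace>a, c \<odot>\<^bsub>L\<^esub> b\<rbrace>\<^bsub>L\<^esub> = c \<odot>\<^bsub>L\<^esub> \<lbrace>a, b\<rbrace>\<^bsub>L\<^esub>"
        using c k by (simp_all add: germ_ops A.pb_smult_left A.pb_smult_right) }
    note bracket_closed this }
  note two = this
  { fix a b d assume "a \<in> carrier L" "b \<in> carrier L" "d \<in> carrier L"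
    then obtain k x y z where k: "n \<le> k" and [simp]: "x \<in> carrier (D k)" "y \<in> carrier (D k)" "z \<in> carrier (D k)"
       "a = g k x" "b = g k y" "d = g k z"
      by (rule germ_cases3)
    interpret A: poisson_algebra F "D k" using alg(3)[OF k] .
    show "(a \<oplus>\<^bsub>L\<^esub> b) \<oplus>\<^bsub>L\<^esub> d = a \<oplus>\<^bsub>L\<^esub> (b \<oplus>\<^bsub>L\<^esub> d)" "(a \<otimes>\<^bsub>L\<^esub> b) \<otimes>\<^bsub>L\<^esub> d = a \<otimes>\<^bsub>L\<^esub> (b \<otimes>\<^bsub>L\<^esub> d)"
      "(a \<oplus>\<^bsub>L\<^esub> b) \<otimes>\<^bsub>L\<^esub> d = (a \<otimes>\<^bsub>L\<^esub> d) \<oplus>\<^bsub>L\<^esub> (b \<otimes>\<^bsub>L\<^esub> d)"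
      using k by (simp_all add: germ_ops A.a_assoc A.m_assoc A.l_distr)
    have "\<lbrace>a \<oplus>\<^bsub>L\<^esub> b, d\<rbrace>\<^bsub>L\<^esub> = \<lbrace>a, d\<rbrace>\<^bsub>L\<^esub> \<oplus>\<^bsub>L\<^esub> \<lbrace>b, d\<rbrace>\<^bsub>L\<^esub>" "\<lbrace>a, b \<oplus>\<^bsub>L\<^esub> d\<rbrace>\<^bsub>L\<^esub> = \<lbrace>a, b\<rbrace>\<^bsub>L\<^esub> \<oplus>\<^bsub>L\<^esub> \<lbrace>a, d\<rbrace>\<^bsub>L\<^esub>"
      "\<lbrace>a, \<lbrace>b, d\<rbrace>\<^bsub>L\<^esub>\<rbrace>\<^bsub>L\<^esub> \<oplus>\<^bsub>L\<^esub> \<lbrace>b, \<lbrace>d, a\<rbrace>\<^bsub>L\<^esub>\<rbrace>\<^bsub>L\<^esub> \<oplus>\<^bsub>L\<^esub> \<lbrace>d, \<lbrace>a, b\<rbrace>\<^bsub>L\<^esub>\<rbrace>\<^bsub>L\<^esub> = \<zero>\<^bsub>L\<^esub>"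
      "\<lbrace>a \<otimes>\<^bsub>L\<^esub> b, d\<rbrace>\<^bsub>L\<^esub> = a \<otimes>\<^bsub>L\<^esub> \<lbrace>b, d\<rbrace>\<^bsub>L\<^esub> \<oplus>\<^bsub>L\<^esub> \<lbrace>a, d\<rbrace>\<^bsub>L\<^esub> \<otimes>\<^bsub>L\<^esub> b"
      using k by (simp_all add: germ_ops A.pb_add_left A.pb_add_right A.pb_jacobi A.pb_leibniz flip: germ_zero[OF k]) }
  note three = this
  show "poisson_algebra_axioms F L"
    by (intro poisson_algebra_axioms.intro alternating two three)
qed

end

section \<open>Inverse limits\<close>

lemma inverse_limit_poisson_algebra:
  fixes D :: "'x set \<Rightarrow> ('f, 's) poisson"
  assumes F: "cring F" and alg: "\<And>V. V \<in> I \<Longrightarrow> poisson_algebra F (D V)"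
    and hom: "\<And>V W. V \<in> I \<Longrightarrow> W \<in> I \<Longrightarrow> W \<subseteq> V \<Longrightarrow> r V W \<in> poisson_hom F (D V) (D W)"
  shows "poisson_algebra F (inverse_limit I D r)" (is "poisson_algebra F ?L")
proof -
  have algs: "cring (D V)" "ring (D V)" "algebra F (D V)" "poisson_algebra F (D V)" if "V \<in> I" for V
    using poisson_algebra.poisson_algebra_facts[OF alg[OF that]] poisson_algebra_ring[OF alg[OF that]] by simp_all
  have mem: "s \<in> carrier ?L \<longleftrightarrow> s \<in> extensional I \<and> (\<forall>V\<in>I. s V \<in> carrier (D V)) \<and>
      (\<forall>V\<in>I. \<forall>W\<in>I. W \<subseteq> V \<longrightarrow> r V W (s V) = s W)" for s
    by (auto simp: inverse_limit_def PiE_iff)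
  have val: "s V \<in> carrier (D V)" if "s \<in> carrier ?L" "V \<in> I" for s V using that by (simp add: mem)
  have eqI: "s = u" if "s \<in> extensional I" "u \<in> extensional I" "\<And>V. V \<in> I \<Longrightarrow> s V = u V" for s u :: "'x set \<Rightarrow> 's"
    using that by (rule extensionalityI)
  have ext: "s \<in> extensional I" if "s \<in> carrier ?L" for s using that by (simp add: mem)
  have ops: "x \<otimes>\<^bsub>?L\<^esub> y = (\<lambda>V\<in>I. x V \<otimes>\<^bsub>D V\<^esub> y V)" "x \<oplus>\<^bsub>?L\<^esub> y = (\<lambda>V\<in>I. x V \<oplus>\<^bsub>D V\<^esub> y V)"
    "\<lbrace>x, y\<rbrace>\<^bsub>?L\<^esub> = (\<lambda>V\<in>I. \<lbrace>x V, y V\<rbrace>\<^bsub>D V\<^esub>)" "c \<odot>\<^bsub>?L\<^esub> x = (\<lambda>V\<in>I. c \<odot>\<^bsub>D V\<^esub> x V)"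
    "\<zero>\<^bsub>?L\<^esub> = (\<lambda>V\<in>I. \<zero>\<^bsub>D V\<^esub>)" "\<one>\<^bsub>?L\<^esub> = (\<lambda>V\<in>I. \<one>\<^bsub>D V\<^esub>)" for x y c
    by (simp_all add: inverse_limit_def)
  note ring = cring.cring_simprules[OF algs(1)] monoid.l_one[OF ring.is_monoid[OF algs(2)]]
    monoid.r_one[OF ring.is_monoid[OF algs(2)]]
  note alg_laws = algebra.smult_assoc2[OF algs(3)] module.smult_closed[OF algebra.axioms(1)[OF algs(3)]]
    module.smult_l_distr[OF algebra.axioms(1)[OF algs(3)]] module.smult_r_distr[OF algebra.axioms(1)[OF algs(3)]]
    module.smult_assoc1[OF algebra.axioms(1)[OF algs(3)]] module.smult_one[OF algebra.axioms(1)[OF algs(3)]]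
  note pb = poisson_algebra.pb_closed[OF alg] poisson_algebra.pb_add_left[OF alg] poisson_algebra.pb_add_right[OF alg]
    poisson_algebra.pb_smult_left[OF alg] poisson_algebra.pb_smult_right[OF alg] poisson_algebra.pb_alternating[OF alg]
    poisson_algebra.pb_jacobi[OF alg] poisson_algebra.pb_leibniz[OF alg]
  note homs = poisson_hom_mult[OF hom] poisson_hom_add[OF hom] poisson_hom_bracket[OF hom] poisson_hom_smult[OF hom]
    poisson_hom_one[OF hom] poisson_hom_zero[OF alg alg hom] poisson_hom_minus[OF alg alg hom]
  \<comment> \<open>Negation is not a field of the record, so the inverse has to be exhibited; it is
    a compatible family because homomorphisms preserve negatives.\<close>
  have minus: "(\<lambda>V\<in>I. \<ominus>\<^bsub>D V\<^esub> x V) \<in> carrier ?L" if "x \<in> carrier ?L" for x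
    using that by (simp add: mem homs ring(3))
  show ?thesis
  proof (rule poisson_algebraI)
    show "\<exists>y\<in>carrier ?L. y \<oplus>\<^bsub>?L\<^esub> x = \<zero>\<^bsub>?L\<^esub>" if "x \<in> carrier ?L" for x
      using minus[OF that] val[OF that]
      by (intro bexI[of _ "\<lambda>V\<in>I. \<ominus>\<^bsub>D V\<^esub> x V"] eqI) (simp_all add: ops ring)
    show "poisson_algebra_axioms F ?L"
    proof
      show "\<lbrace>x, y\<rbrace>\<^bsub>?L\<^esub> \<in> carrier ?L" if "x \<in> carrier ?L" "y \<in> carrier ?L" for x y
        using that by (simp add: mem ops homs pb)
    qed (rule eqI; simp add: ops val pb)+
    show "(c \<odot>\<^bsub>?L\<^esub> x) \<otimes>\<^bsub>?L\<^esub> y = c \<odot>\<^bsub>?L\<^esub> (x \<otimes>\<^bsub>?L\<^esub> y)"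
      if "c \<in> carrier F" "x \<in> carrier ?L" "y \<in> carrier ?L" for c x y
      using that by (intro eqI) (simp_all add: ops val alg_laws)
    show "cring F" by (rule F)
  \<comment> \<open>Each remaining goal is either a closure statement, which holds because the maps
    \<open>r V W\<close> preserve the operations, or an equation between extensional functions,
    checked in every component.\<close>
  qed ((simp add: mem ops homs ring alg_laws; fail) | (rule eqI; simp add: ops val ring alg_laws ext; fail))+
qed

section \<open>The inverse system\<close>

lemma
  assumes "sheaf_of_poisson_algebras F Y"
  shows sheaf_sec: "is_open Y U \<Longrightarrow> poisson_algebra F (sec Y U)"
    and sheaf_res: "is_open Y U \<Longrightarrow> is_open Y V \<Longrightarrow> V \<subseteq> U \<Longrightarrow> res Y U V \<in> poisson_hom F (sec Y U) (sec Y V)"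
    and sheaf_res_id: "is_open Y U \<Longrightarrow> s \<in> carrier (sec Y U) \<Longrightarrow> res Y U U s = s"
    and sheaf_res_res: "is_open Y U \<Longrightarrow> is_open Y V \<Longrightarrow> is_open Y W \<Longrightarrow> W \<subseteq> V \<Longrightarrow> V \<subseteq> U
      \<Longrightarrow> s \<in> carrier (sec Y U) \<Longrightarrow> res Y V W (res Y U V s) = res Y U W s"
    and sheaf_glue: "\<And>\<U> s. \<forall>V\<in>\<U>. is_open Y V \<and> s V \<in> carrier (sec Y V) \<Longrightarrow>
      \<forall>V\<in>\<U>. \<forall>W\<in>\<U>. res Y V (V \<inter> W) (s V) = res Y W (V \<inter> W) (s W) \<Longrightarrow>
      \<exists>!a. a \<in> carrier (sec Y (\<Union>\<U>)) \<and> (\<forall>V\<in>\<U>. res Y (\<Union>\<U>) V a = s V)"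
proof -
  note * = assms[unfolded sheaf_of_poisson_algebras_def sheaf_of_def]
  note c1 = *[THEN conjunct2] and c2 = *[THEN conjunct2, THEN conjunct2]
    and c3 = *[THEN conjunct2, THEN conjunct2, THEN conjunct2]
  show "is_open Y U \<Longrightarrow> poisson_algebra F (sec Y U)" using *[THEN conjunct1] by simp
  show "is_open Y U \<Longrightarrow> is_open Y V \<Longrightarrow> V \<subseteq> U \<Longrightarrow> res Y U V \<in> poisson_hom F (sec Y U) (sec Y V)"
    using c1[THEN conjunct1] by simp
  show "is_open Y U \<Longrightarrow> s \<in> carrier (sec Y U) \<Longrightarrow> res Y U U s = s" using c2[THEN conjunct1] by simp
  show "is_open Y U \<Longrightarrow> is_open Y V \<Longrightarrow> is_open Y W \<Longrightarrow> W \<subseteq> V \<Longrightarrow> V \<subseteq> U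
      \<Longrightarrow> s \<in> carrier (sec Y U) \<Longrightarrow> res Y V W (res Y U V s) = res Y U W s"
    using c3[THEN conjunct1] by simp
  show "\<exists>!a. a \<in> carrier (sec Y (\<Union>\<U>)) \<and> (\<forall>V\<in>\<U>. res Y (\<Union>\<U>) V a = s V)"
    if "\<forall>V\<in>\<U>. is_open Y V \<and> s V \<in> carrier (sec Y V)"
      "\<forall>V\<in>\<U>. \<forall>W\<in>\<U>. res Y V (V \<inter> W) (s V) = res Y W (V \<inter> W) (s W)" for \<U> s
    by (rule c3[THEN conjunct2, rule_format]) (use that in blast)
qed

lemma sheaf_sections_eqI:
  assumes Y: "sheaf_of_poisson_algebras F Y" and op: "\<And>V. V \<in> \<U> \<Longrightarrow> is_open Y V"
    and x: "x \<in> carrier (sec Y (\<Union>\<U>))" and y: "y \<in> carrier (sec Y (\<Union>\<U>))"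
    and eq: "\<And>V. V \<in> \<U> \<Longrightarrow> res Y (\<Union>\<U>) V x = res Y (\<Union>\<U>) V y"
  shows "x = y"
proof -
  have o: "is_open Y (\<Union>\<U>)" using op by blast
  have "\<exists>!a. a \<in> carrier (sec Y (\<Union>\<U>)) \<and> (\<forall>V\<in>\<U>. res Y (\<Union>\<U>) V a = res Y (\<Union>\<U>) V x)"
  proof (rule sheaf_glue[OF Y, of \<U> "\<lambda>V. res Y (\<Union>\<U>) V x"]; intro ballI)
    fix V assume V: "V \<in> \<U>"
    then have VU: "V \<subseteq> \<Union>\<U>" by blast
    show "is_open Y V \<and> res Y (\<Union>\<U>) V x \<in> carrier (sec Y V)"
      using poisson_hom_closed[OF sheaf_res[OF Y o op[OF V] VU] x] op[OF V] by simp
    fix W assume W: "W \<in> \<U>"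
    then have WU: "W \<subseteq> \<Union>\<U>" by blast
    have "is_open Y (V \<inter> W)" using op V W by blast
    then show "res Y V (V \<inter> W) (res Y (\<Union>\<U>) V x) = res Y W (V \<inter> W) (res Y (\<Union>\<U>) W x)"
      using sheaf_res_res[OF Y o op[OF V] _ _ VU x, of "V \<inter> W"] sheaf_res_res[OF Y o op[OF W] _ _ WU x, of "V \<inter> W"]
      by simp
  qed
  then show ?thesis using x y eq by (metis (no_types, lifting))
qed

text \<open>The sheaf axiom takes families indexed by the open sets themselves, whereas here
  \<open>V i = V j\<close> may happen for different indices. The overlap is then the whole set, so
  \<open>comp\<close> forces \<open>s i = s j\<close> and choosing one index per set is
  harmless.\<close>

lemma sheaf_indexed_glue:
  assumes Y: "sheaf_of_poisson_algebras F Y"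
    and op: "\<And>i. i \<in> I \<Longrightarrow> is_open Y (V i)" and s: "\<And>i. i \<in> I \<Longrightarrow> s i \<in> carrier (sec Y (V i))"
    and comp: "\<And>i j. i \<in> I \<Longrightarrow> j \<in> I \<Longrightarrow> res Y (V i) (V i \<inter> V j) (s i) = res Y (V j) (V i \<inter> V j) (s j)"
  obtains a where "a \<in> carrier (sec Y (\<Union>(V ` I)))" "\<And>i. i \<in> I \<Longrightarrow> res Y (\<Union>(V ` I)) (V i) a = s i"
proof -
  define s' where "s' W = s (SOME i. i \<in> I \<and> V i = W)" for W
  have s': "s' (V i) = s i" if i: "i \<in> I" for i
  proof -
    define j where "j = (SOME j. j \<in> I \<and> V j = V i)"
    have j: "j \<in> I" "V j = V i" using someI[of "\<lambda>j. j \<in> I \<and> V j = V i" i] i by (simp_all add: j_def)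
    have "s j = s i"
      using comp[OF j(1) i] sheaf_res_id[OF Y op[OF i] s[OF i]] sheaf_res_id[OF Y op[OF j(1)] s[OF j(1)]] j(2) by simp
    then show ?thesis by (simp add: s'_def j_def)
  qed
  have "\<exists>!a. a \<in> carrier (sec Y (\<Union>(V ` I))) \<and> (\<forall>W\<in>V ` I. res Y (\<Union>(V ` I)) W a = s' W)"
  proof (rule sheaf_glue[OF Y])
    show "\<forall>W\<in>V ` I. is_open Y W \<and> s' W \<in> carrier (sec Y W)" by (simp add: s' op s)
    show "\<forall>W\<in>V ` I. \<forall>W'\<in>V ` I. res Y W (W \<inter> W') (s' W) = res Y W' (W \<inter> W') (s' W')"
      by (intro ballI, elim imageE, hypsubst, simp only: s', rule comp)
  qed
  then obtain a where "a \<in> carrier (sec Y (\<Union>(V ` I)))" "\<forall>W\<in>V ` I. res Y (\<Union>(V ` I)) W a = s' W" by blast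
  then show thesis using that[of a] s' by simp
qed

text \<open>What the affine charts contribute is packaged in the two topological assumptions, which
  \<open>variety_noetherian_sober\<close> supplies.\<close>

locale provariety_system =
  fixes F :: "('f, 'e) ring_scheme" and \<X> :: "('f, 'a, 's) psystem" and p :: "nat \<Rightarrow> nat \<Rightarrow> 'a \<Rightarrow> 'a"
    and ps :: "nat \<Rightarrow> nat \<Rightarrow> 'a set \<Rightarrow> 's \<Rightarrow> 's"
  assumes system: "poisson_system F \<X> p ps"
    and noetherian: "\<And>n. noetherian_space (topol (\<X> n))" and sober: "\<And>n. sober_space (topol (\<X> n))"
begin

abbreviation pb :: "nat \<Rightarrow> nat \<Rightarrow> 'a set \<Rightarrow> 'a set" where
  "pb n m V \<equiv> preimage_on (points (\<X> n)) (p n m) V"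

lemma points_nonempty: "points (\<X> n) \<noteq> {}"
  using system by (simp add: poisson_system_def irreducible_variety_def irreducible_topology_def)

lemma sheaf: "sheaf_of_poisson_algebras F (\<X> n)"
  using system by (simp add: poisson_system_def poisson_variety_def)

lemma
  assumes "m \<le> n"
  shows p_morphism: "sheafed_morphism (poisson_hom F) (\<X> n) (\<X> m) (p n m) (ps n m)"
    and p_surj: "p n m ` points (\<X> n) = points (\<X> m)"
  using system assms by (simp_all add: poisson_system_def poisson_morphism_def)

lemma system_inverse: "inverse_system \<X> p ps"
  using system by (simp add: poisson_system_def)

lemma p_continuous: "m \<le> n \<Longrightarrow> continuous_map (topol (\<X> n)) (topol (\<X> m)) (p n m)"
  using p_morphism[of m n] by (simp add: sheafed_morphism_def)

lemma p_point: "m \<le> n \<Longrightarrow> x \<in> points (\<X> n) \<Longrightarrow> p n m x \<in> points (\<X> m)"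
  using p_surj[of m n] by blast

lemma p_id: "x \<in> points (\<X> n) \<Longrightarrow> p n n x = x"
  using system_inverse by (simp add: inverse_system_def)

lemma p_comp: "k \<le> m \<Longrightarrow> m \<le> n \<Longrightarrow> x \<in> points (\<X> n) \<Longrightarrow> p m k (p n m x) = p n k x"
  using system_inverse[unfolded inverse_system_def, THEN conjunct2] by simp

lemma ps_id: "is_open (\<X> n) V \<Longrightarrow> s \<in> carrier (sec (\<X> n) V) \<Longrightarrow> ps n n V s = s"
  using system_inverse by (simp add: inverse_system_def)

lemma ps_comp: "k \<le> m \<Longrightarrow> m \<le> n \<Longrightarrow> is_open (\<X> k) V \<Longrightarrow> s \<in> carrier (sec (\<X> k) V)
    \<Longrightarrow> ps n m (pb m k V) (ps m k V s) = ps n k V s"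
  using system_inverse[unfolded inverse_system_def, THEN conjunct2] by simp

lemma ps_hom: "m \<le> n \<Longrightarrow> is_open (\<X> m) V \<Longrightarrow> ps n m V \<in> poisson_hom F (sec (\<X> m) V) (sec (\<X> n) (pb n m V))"
  using p_morphism[of m n] by (simp add: sheafed_morphism_def)

lemma ps_res: "m \<le> n \<Longrightarrow> is_open (\<X> m) V \<Longrightarrow> is_open (\<X> m) W \<Longrightarrow> W \<subseteq> V \<Longrightarrow> s \<in> carrier (sec (\<X> m) V)
    \<Longrightarrow> res (\<X> n) (pb n m V) (pb n m W) (ps n m V s) = ps n m W (res (\<X> m) V W s)"
  using p_morphism[of m n] by (simp add: sheafed_morphism_def)

lemma pb_open: "m \<le> n \<Longrightarrow> is_open (\<X> m) V \<Longrightarrow> is_open (\<X> n) (pb n m V)"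
  using openin_continuous_map_preimage[OF p_continuous] by (simp add: preimage_on_def)

lemma pb_id: "V \<subseteq> points (\<X> n) \<Longrightarrow> pb n n V = V"
  using p_id by (auto simp: preimage_on_def)

lemma pb_mono: "V \<subseteq> W \<Longrightarrow> pb n m V \<subseteq> pb n m W"
  by (auto simp: preimage_on_def)

lemma pb_Union: "pb n m (\<Union>\<F>) = \<Union>(pb n m ` \<F>)"
  by (auto simp: preimage_on_def)

lemma lim_pointsD:
  assumes "x \<in> lim_points \<X> p"
  shows "x n \<in> points (\<X> n)" and "m \<le> n \<Longrightarrow> p n m (x n) = x m"
  using assms by (simp_all add: lim_points_def)

text \<open>Surjectivity allows a point to be lifted one level at a time, starting from
  \<open>y\<close> at level \<open>k\<close>; the coordinates below \<open>k\<close> are then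
  determined.\<close>

lemma lim_points_surj:
  assumes "y \<in> points (\<X> k)"
  shows "\<exists>x\<in>lim_points \<X> p. x k = y"
proof -
  have "\<exists>f. \<forall>i. (f i \<in> points (\<X> (k + i)) \<and> (i = 0 \<longrightarrow> f i = y)) \<and> p (k + Suc i) (k + i) (f (Suc i)) = f i"
  proof (rule dependent_nat_choice)
    show "\<exists>x. x \<in> points (\<X> (k + 0)) \<and> (0 = 0 \<longrightarrow> x = y)" using assms by simp
    fix x i assume "x \<in> points (\<X> (k + i)) \<and> (i = 0 \<longrightarrow> x = y)"
    then have "x \<in> p (k + Suc i) (k + i) ` points (\<X> (k + Suc i))" using p_surj[of "k + i" "k + Suc i"] by simp
    then show "\<exists>z. (z \<in> points (\<X> (k + Suc i)) \<and> (Suc i = 0 \<longrightarrow> z = y)) \<and> p (k + Suc i) (k + i) z = x" by auto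
  qed
  then obtain f where f: "\<And>i. f i \<in> points (\<X> (k + i))" "f 0 = y"
    and step: "\<And>i. p (k + Suc i) (k + i) (f (Suc i)) = f i" by blast
  have fp: "p (k + n) (k + m) (f n) = f m" if "m \<le> n" for m n
    using that
  proof (induction n rule: dec_induct)
    case base
    show ?case using p_id f(1) by simp
  next
    case (step n)
    have "p (k + Suc n) (k + m) (f (Suc n)) = p (k + n) (k + m) (p (k + Suc n) (k + n) (f (Suc n)))"
      using p_comp[of "k + m" "k + n" "k + Suc n" "f (Suc n)"] f(1)[of "Suc n"] step(1) by simp
    then show ?case using step \<open>\<And>i. p (k + Suc i) (k + i) (f (Suc i)) = f i\<close> by simp
  qed
  \<comment> \<open>Projecting from level \<open>k + n\<close>, which is at least \<open>n\<close>,
    treats coordinates below and above \<open>k\<close> uniformly.\<close>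
  define x where "x n = p (k + n) n (f n)" for n
  have "p n m (x n) = x m" if "m \<le> n" for m n
  proof -
    have "p n m (x n) = p (k + n) m (f n)" unfolding x_def using that f(1) by (intro p_comp) simp_all
    also have "\<dots> = p (k + m) m (p (k + n) (k + m) (f n))"
      using p_comp[of m "k + m" "k + n" "f n"] that f(1)[of n] by simp
    finally show ?thesis using fp[OF that] by (simp add: x_def)
  qed
  moreover have "x n \<in> points (\<X> n)" for n unfolding x_def using p_point f(1) by simp
  moreover have "x k = y" using fp[of 0 k] f(2) by (simp add: x_def)
  ultimately show ?thesis by (intro bexI[of _ x]) (simp_all add: lim_points_def)
qed

lemma mem_cylinder: "x \<in> cylinder \<X> p n W \<longleftrightarrow> x \<in> lim_points \<X> p \<and> x n \<in> W"
  by (simp add: cylinder_def preimage_on_def)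

lemma cylinder_pb: "m \<le> n \<Longrightarrow> cylinder \<X> p n (pb n m W) = cylinder \<X> p m W"
  using lim_pointsD by (auto simp: mem_cylinder preimage_on_def)

text \<open>The image of \<open>U\<close> under the projection to level \<open>k\<close>. For basic
  sets from their level on it equals \<open>trace_open\<close>, by \<open>trace_open_eq\<close>, but
  it refers to no choice and is monotone in \<open>U\<close>.\<close>

definition trace :: "(nat \<Rightarrow> 'a) set \<Rightarrow> nat \<Rightarrow> 'a set" where
  "trace U k = (\<lambda>x. x k) ` U"

text \<open>These are the cylinders over open sets of level \<open>k\<close>, by
  \<open>basic_at_cylinder\<close>, \<open>trace_is_open\<close> and \<open>cylinder_trace\<close>.
  Phrasing this through the least level makes passage to larger \<open>k\<close> immediate.\<close>

definition basic_at :: "(nat \<Rightarrow> 'a) set \<Rightarrow> nat \<Rightarrow> bool" where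
  "basic_at U k \<longleftrightarrow> U \<in> lim_basis \<X> p \<and> level \<X> p U \<le> k"

lemma basic_at_mono: "basic_at U k \<Longrightarrow> k \<le> m \<Longrightarrow> basic_at U m"
  by (simp add: basic_at_def)

lemma trace_mono: "U \<subseteq> V \<Longrightarrow> trace U k \<subseteq> trace V k"
  by (auto simp: trace_def)

text \<open>Every point of level \<open>k\<close> extends to a point of the limit, so projecting a
  cylinder loses nothing. This is how a basic set determines its open set at each level.\<close>

lemma trace_cylinder: "m \<le> k \<Longrightarrow> trace (cylinder \<X> p m W) k = pb k m W"
proof (intro equalityI subsetI)
  fix y assume m: "m \<le> k" and y: "y \<in> pb k m W"
  then obtain x where x: "x \<in> lim_points \<X> p" "x k = y" using lim_points_surj[of y k] by (auto simp: preimage_on_def)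
  then have "x m \<in> W" using lim_pointsD(2)[OF x(1) m] y by (simp add: preimage_on_def)
  then show "y \<in> trace (cylinder \<X> p m W) k" using x by (auto simp: trace_def mem_cylinder)
next
  fix y assume "m \<le> k" "y \<in> trace (cylinder \<X> p m W) k"
  then show "y \<in> pb k m W" using lim_pointsD by (auto simp: trace_def mem_cylinder preimage_on_def)
qed

lemma basic_at_cylinder: "is_open (\<X> k) W \<Longrightarrow> basic_at (cylinder \<X> p k W) k"
  by (auto simp: basic_at_def lim_basis_def level_def intro!: Least_le)

lemma level_open:
  assumes "U \<in> lim_basis \<X> p"
  shows "is_open (\<X> (level \<X> p U)) (level_open \<X> p U)" "U = cylinder \<X> p (level \<X> p U) (level_open \<X> p U)"
proof -
  have "\<exists>n W. is_open (\<X> n) W \<and> U = cylinder \<X> p n W" using assms by (auto simp: lim_basis_def)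
  then have "\<exists>W. is_open (\<X> (level \<X> p U)) W \<and> U = cylinder \<X> p (level \<X> p U) W"
    unfolding level_def by (rule LeastI_ex)
  then have "is_open (\<X> (level \<X> p U)) (level_open \<X> p U) \<and> U = cylinder \<X> p (level \<X> p U) (level_open \<X> p U)"
    unfolding level_open_def by (rule someI_ex)
  then show "is_open (\<X> (level \<X> p U)) (level_open \<X> p U)" "U = cylinder \<X> p (level \<X> p U) (level_open \<X> p U)"
    by simp_all
qed

lemma trace_open_eq: "basic_at U k \<Longrightarrow> trace_open \<X> p U k = trace U k"
  using trace_cylinder[of "level \<X> p U" k "level_open \<X> p U"] level_open(2)[of U]
  by (simp add: basic_at_def trace_open_def)

lemma trace_is_open: "basic_at U k \<Longrightarrow> is_open (\<X> k) (trace U k)"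
  using pb_open[OF _ level_open(1), of U k] trace_open_eq[of U k] by (simp add: basic_at_def trace_open_def)

lemma cylinder_trace: "basic_at U k \<Longrightarrow> cylinder \<X> p k (trace U k) = U"
  using cylinder_pb[of "level \<X> p U" k "level_open \<X> p U"] level_open(2)[of U] trace_open_eq[of U k]
  by (simp add: basic_at_def trace_open_def)

lemma trace_pb: "basic_at U k \<Longrightarrow> k \<le> m \<Longrightarrow> pb m k (trace U k) = trace U m"
  using trace_cylinder[of k m "trace U k"] cylinder_trace[of U k] by simp

text \<open>Images do not commute with intersections in general; here they do, because both sets are
  full preimages of their traces at level \<open>k\<close>.\<close>

lemma basic_at_Int:
  assumes "basic_at U k" "basic_at V k"
  shows "basic_at (U \<inter> V) k" "trace (U \<inter> V) k = trace U k \<inter> trace V k"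
proof -
  have o: "is_open (\<X> k) (trace U k \<inter> trace V k)" using assms trace_is_open by blast
  have "cylinder \<X> p k (trace U k \<inter> trace V k) = cylinder \<X> p k (trace U k) \<inter> cylinder \<X> p k (trace V k)"
    by (auto simp: mem_cylinder)
  then have eq: "cylinder \<X> p k (trace U k \<inter> trace V k) = U \<inter> V" using assms cylinder_trace by simp
  show "basic_at (U \<inter> V) k" using basic_at_cylinder[OF o] eq by simp
  show "trace (U \<inter> V) k = trace U k \<inter> trace V k"
    using trace_cylinder[of k k "trace U k \<inter> trace V k"] eq pb_id[OF openin_subset[OF o]] by simp
qed

lemma basis_Int:
  assumes "U \<in> lim_basis \<X> p" "V \<in> lim_basis \<X> p"
  shows "U \<inter> V \<in> lim_basis \<X> p"
proof -
  have "basic_at U (max (level \<X> p U) (level \<X> p V))" "basic_at V (max (level \<X> p U) (level \<X> p V))"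
    using assms by (simp_all add: basic_at_def)
  then show ?thesis using basic_at_Int(1) basic_at_def by blast
qed

text \<open>A basic neighbourhood in the product restricts finitely many coordinates, and on the
  limit all these conditions can be read off from the largest of them.\<close>

lemma basis_refine:
  assumes U: "openin (lim_topology \<X> p) U" and x: "x \<in> U"
  obtains C where "C \<in> lim_basis \<X> p" "x \<in> C" "C \<subseteq> U"
proof -
  obtain S where S: "openin (product_topology (\<lambda>n. topol (\<X> n)) UNIV) S" "U = S \<inter> lim_points \<X> p"
    using U by (auto simp: lim_topology_def openin_subtopology)
  then have "x \<in> S" using x by simp
  then obtain B where B: "x \<in> (\<Pi>\<^sub>E i\<in>UNIV. B i)" "\<And>i. is_open (\<X> i) (B i)"
      "finite {i. B i \<noteq> points (\<X> i)}" "(\<Pi>\<^sub>E i\<in>UNIV. B i) \<subseteq> S"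
    using product_topology_open_contains_basis[OF S(1)] by blast
  \<comment> \<open>Inserting \<open>0\<close> covers the case in which no coordinate is
    restricted.\<close>
  define N where "N = Max (insert 0 {i. B i \<noteq> points (\<X> i)})"
  have N: "B i = points (\<X> i)" if "\<not> i \<le> N" for i
    using that Max_ge[of "insert 0 {i. B i \<noteq> points (\<X> i)}" i] B(3) by (auto simp: N_def)
  define W where "W = (\<Inter>i\<in>{..N}. pb N i (B i))"
  have "openin (topol (\<X> N)) W"
    unfolding W_def using B(2) pb_open by (intro openin_INT2) simp_all
  moreover have "x \<in> cylinder \<X> p N W"
    using x S(2) B(1) lim_pointsD[of x] by (auto simp: mem_cylinder W_def preimage_on_def)
  moreover have "cylinder \<X> p N W \<subseteq> U"
  proof
    fix z assume "z \<in> cylinder \<X> p N W"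
    then have z: "z \<in> lim_points \<X> p" "\<And>i. i \<le> N \<Longrightarrow> p N i (z N) \<in> B i"
      by (auto simp: mem_cylinder W_def preimage_on_def)
    have "z i \<in> B i" for i
      using z(2)[of i] lim_pointsD[OF z(1)] N[of i] by (cases "i \<le> N") auto
    then have "z \<in> S" using B(4) by (auto simp: PiE_iff)
    then show "z \<in> U" using S(2) z(1) by simp
  qed
  ultimately show thesis using that[of "cylinder \<X> p N W"] by (auto simp: lim_basis_def)
qed

text \<open>A family \<open>G\<close> of pairs (level, open set) that is stable under pulling back to higher levels and
  whose cylinders cover \<open>U\<close> covers \<open>U\<close> already at one level: otherwise the uncovered parts of the
  traces of \<open>U\<close> form an inverse system of nonempty locally closed sets, and a point in its limit is
  not covered.\<close>

lemma basic_cover: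
  assumes U: "basic_at U n"
    and G: "\<And>k W. G k W \<Longrightarrow> n \<le> k \<and> is_open (\<X> k) W \<and> W \<subseteq> trace U k"
    and pull: "\<And>k m W. G k W \<Longrightarrow> k \<le> m \<Longrightarrow> G m (pb m k W)"
    and cov: "\<And>x. x \<in> U \<Longrightarrow> \<exists>k W. G k W \<and> x k \<in> W"
  shows "\<exists>k \<F>. n \<le> k \<and> finite \<F> \<and> (\<forall>W\<in>\<F>. G k W) \<and> \<Union>\<F> = trace U k"
proof (rule ccontr)
  assume no: "\<not> ?thesis"
  \<comment> \<open>Below \<open>n\<close>, where \<open>U\<close> need not come from an open set,
    the pair consists of the whole space and the empty set, so the difference imposes no condition
    and is nonempty.\<close>
  define W where "W k = (if n \<le> k then trace U k else points (\<X> k))" for k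
  define V where "V k = (if n \<le> k then \<Union>{W. G k W} else {})" for k
  have at: "basic_at U k" if "n \<le> k" for k using basic_at_mono[OF U that] .
  have "\<exists>x. (\<forall>k. x k \<in> W k - V k) \<and> (\<forall>m k. m \<le> k \<longrightarrow> p k m (x k) = x m)"
  proof (rule inverse_limit_locally_closed_nonempty[where T = "\<lambda>n. topol (\<X> n)"])
    show "openin (topol (\<X> k)) (W k)" for k using trace_is_open[OF at] by (simp add: W_def)
    show "openin (topol (\<X> k)) (V k)" for k using G by (auto simp: V_def)
    show "W k - V k \<noteq> {}" for k
    proof (cases "n \<le> k")
      case False
      then show ?thesis using points_nonempty by (simp add: W_def V_def)
    next
      case True
      \<comment> \<open>If the whole trace were covered at level \<open>k\<close>, finitely many
        sets would already do so, against the assumption \<open>no\<close>.\<close>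
      obtain \<F> where \<F>: "finite \<F>" "\<F> \<subseteq> {W. G k W}" "\<Union>\<F> = \<Union>{W. G k W}"
        using noetherian_space_finite_subcover[OF noetherian[of k], of "{W. G k W}"] G by blast
      then have "\<Union>\<F> \<subseteq> trace U k" using G by blast
      moreover have "\<Union>\<F> \<noteq> trace U k" using no True \<F>(1,2) by blast
      ultimately show ?thesis using True \<F>(3) by (auto simp: W_def V_def)
    qed
    fix m k x assume mk: "m \<le> k" and x: "x \<in> W k - V k"
    show "p k m x \<in> W m - V m"
    proof (cases "n \<le> m")
      case False
      have "x \<in> points (\<X> k)" using x openin_subset[OF trace_is_open[OF at]] by (auto simp: W_def split: if_splits)
      then show ?thesis using False p_point[OF mk] by (simp add: W_def V_def)
    next
      case True
      then have xU: "x \<in> pb k m (trace U m)" and xV: "\<not> (\<exists>W. G k W \<and> x \<in> W)"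
        using x mk trace_pb[OF at[OF True] mk] by (auto simp: W_def V_def)
      \<comment> \<open>Were the image covered at level \<open>m\<close>, the pullback of the
        covering set, which \<open>pull\<close> provides at level \<open>k\<close>, would cover
        \<open>x\<close>.\<close>
      have "p k m x \<notin> A" if "G m A" for A
        using pull[OF that mk] xV xU by (auto simp: preimage_on_def)
      then show ?thesis using xU True by (auto simp: W_def V_def preimage_on_def)
    qed
  qed (use noetherian sober p_continuous p_id p_comp in simp_all)
  then obtain x where x: "\<And>k. x k \<in> W k - V k" "\<And>m k. m \<le> k \<Longrightarrow> p k m (x k) = x m" by blast
  have "W k \<subseteq> points (\<X> k)" for k using openin_subset[OF trace_is_open[OF at]] by (simp add: W_def)
  then have "x \<in> lim_points \<X> p" using x by (auto simp: lim_points_def)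
  moreover have "x n \<in> trace U n" using x(1)[of n] by (simp add: W_def)
  ultimately have "x \<in> U" using cylinder_trace[OF U] mem_cylinder by blast
  then obtain k A where "G k A" "x k \<in> A" using cov by blast
  then show False using G[of k A] x(1)[of k] by (auto simp: V_def)
qed

end

section \<open>Sections on cylinders\<close>

context provariety_system
begin

abbreviation sec_at :: "(nat \<Rightarrow> 'a) set \<Rightarrow> nat \<Rightarrow> ('f, 's) poisson" where
  "sec_at U k \<equiv> sec (\<X> k) (trace U k)"

abbreviation lift :: "(nat \<Rightarrow> 'a) set \<Rightarrow> nat \<Rightarrow> nat \<Rightarrow> 's \<Rightarrow> 's" where
  "lift U k m \<equiv> ps m k (trace U k)"

abbreviation res_at :: "nat \<Rightarrow> (nat \<Rightarrow> 'a) set \<Rightarrow> (nat \<Rightarrow> 'a) set \<Rightarrow> 's \<Rightarrow> 's" where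
  "res_at k U V \<equiv> res (\<X> k) (trace U k) (trace V k)"

text \<open>The germ for the direct system of \<open>U\<close>. Sections are handled through this
  function and \<open>trace\<close> from here on, in place of the chosen open sets behind
  \<open>stage\<close>.\<close>

definition cls :: "(nat \<Rightarrow> 'a) set \<Rightarrow> nat \<Rightarrow> 's \<Rightarrow> (nat \<times> 's) set" where
  "cls U = germ (level \<X> p U) (stage \<X> p U) (stage_map \<X> p ps U)"

lemma lift_hom: "basic_at U k \<Longrightarrow> k \<le> m \<Longrightarrow> lift U k m \<in> poisson_hom F (sec_at U k) (sec_at U m)"
  using ps_hom[of k m "trace U k"] trace_is_open[of U k] trace_pb[of U k m] by simp

lemma lift_closed: "basic_at U k \<Longrightarrow> k \<le> m \<Longrightarrow> s \<in> carrier (sec_at U k) \<Longrightarrow> lift U k m s \<in> carrier (sec_at U m)"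
  using poisson_hom_closed[OF lift_hom] .

lemma lift_id: "basic_at U k \<Longrightarrow> s \<in> carrier (sec_at U k) \<Longrightarrow> lift U k k s = s"
  using ps_id trace_is_open by simp

lemma lift_lift: "basic_at U k \<Longrightarrow> k \<le> l \<Longrightarrow> l \<le> m \<Longrightarrow> s \<in> carrier (sec_at U k) \<Longrightarrow> lift U l m (lift U k l s) = lift U k m s"
  using ps_comp[of k l m "trace U k" s] trace_is_open[of U k] trace_pb[of U k l] by simp

lemma res_at_hom: "basic_at U k \<Longrightarrow> basic_at V k \<Longrightarrow> V \<subseteq> U \<Longrightarrow> res_at k U V \<in> poisson_hom F (sec_at U k) (sec_at V k)"
  using sheaf_res[OF sheaf trace_is_open trace_is_open trace_mono] .

lemma res_at_closed: "basic_at U k \<Longrightarrow> basic_at V k \<Longrightarrow> V \<subseteq> U \<Longrightarrow> s \<in> carrier (sec_at U k) \<Longrightarrow> res_at k U V s \<in> carrier (sec_at V k)"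
  using poisson_hom_closed[OF res_at_hom] .

lemma res_at_lift:
  assumes "basic_at U k" "basic_at V k" "V \<subseteq> U" "k \<le> m" "s \<in> carrier (sec_at U k)"
  shows "res_at m U V (lift U k m s) = lift V k m (res_at k U V s)"
  using ps_res[OF assms(4) trace_is_open[OF assms(1)] trace_is_open[OF assms(2)] trace_mono[OF assms(3)] assms(5)]
    trace_pb[OF assms(1,4)] trace_pb[OF assms(2,4)] by simp

lemma res_at_res_at:
  assumes "basic_at U k" "basic_at V k" "basic_at W k" "W \<subseteq> V" "V \<subseteq> U" "s \<in> carrier (sec_at U k)"
  shows "res_at k V W (res_at k U V s) = res_at k U W s"
  using sheaf_res_res[OF sheaf] assms trace_is_open trace_mono by simp

lemma stage_eq: "basic_at U k \<Longrightarrow> stage \<X> p U k = sec_at U k"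
  by (simp add: stage_def trace_open_eq)

lemma stage_map_eq: "basic_at U k \<Longrightarrow> stage_map \<X> p ps U k m = lift U k m"
  by (simp add: stage_map_def trace_open_eq)

lemma direct_system:
  assumes "U \<in> lim_basis \<X> p"
  shows "poisson_direct_system F (level \<X> p U) (stage \<X> p U) (stage_map \<X> p ps U)"
proof (rule poisson_direct_system.intro)
  have at: "basic_at U k" if "level \<X> p U \<le> k" for k using assms that by (simp add: basic_at_def)
  fix k assume k: "level \<X> p U \<le> k"
  show "poisson_algebra F (stage \<X> p U k)"
    using sheaf_sec[OF sheaf trace_is_open[OF at[OF k]]] by (simp add: stage_eq[OF at[OF k]])
  { fix l assume l: "k \<le> l"
    then have kl: "level \<X> p U \<le> l" using k by simp
    show "stage_map \<X> p ps U k l \<in> poisson_hom F (stage \<X> p U k) (stage \<X> p U l)"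
      using lift_hom[OF at[OF k] l] by (simp add: stage_eq[OF at[OF k]] stage_eq[OF at[OF kl]] stage_map_eq[OF at[OF k]])
    fix m s assume "l \<le> m" "s \<in> carrier (stage \<X> p U k)"
    then show "stage_map \<X> p ps U l m (stage_map \<X> p ps U k l s) = stage_map \<X> p ps U k m s"
      using lift_lift[OF at[OF k] l] by (simp add: stage_eq[OF at[OF k]] stage_map_eq[OF at[OF k]] stage_map_eq[OF at[OF kl]]) }
  fix s assume "s \<in> carrier (stage \<X> p U k)"
  then show "stage_map \<X> p ps U k k s = s"
    using lift_id[OF at[OF k]] by (simp add: stage_eq[OF at[OF k]] stage_map_eq[OF at[OF k]])
qed

lemma basic_atD: "basic_at U k \<Longrightarrow> U \<in> lim_basis \<X> p" "basic_at U k \<Longrightarrow> level \<X> p U \<le> k"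
  by (simp_all add: basic_at_def)

lemma pre_sec_algebra: "U \<in> lim_basis \<X> p \<Longrightarrow> poisson_algebra F (pre_sec \<X> p ps U)"
  unfolding pre_sec_def by (rule poisson_direct_system.direct_limit_poisson_algebra[OF direct_system])

lemma cls_closed: "basic_at U k \<Longrightarrow> s \<in> carrier (sec_at U k) \<Longrightarrow> cls U k s \<in> carrier (pre_sec \<X> p ps U)"
  using poisson_direct_system.germ_closed[OF direct_system, of U k s]
  by (simp add: basic_atD stage_eq pre_sec_def cls_def)

lemma cls_lift: "basic_at U k \<Longrightarrow> k \<le> m \<Longrightarrow> s \<in> carrier (sec_at U k) \<Longrightarrow> cls U m (lift U k m s) = cls U k s"
  using poisson_direct_system.germ_trans[OF direct_system, of U k m s]
  by (simp add: basic_atD stage_eq stage_map_eq cls_def)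

lemma cls_eq_iff:
  assumes "basic_at U k" "basic_at U l" "s \<in> carrier (sec_at U k)" "u \<in> carrier (sec_at U l)"
  shows "cls U k s = cls U l u \<longleftrightarrow> (\<exists>m. k \<le> m \<and> l \<le> m \<and> lift U k m s = lift U l m u)"
  using poisson_direct_system.germ_eq_iff[OF direct_system, of U k l s u] assms
  by (simp add: basic_atD stage_eq stage_map_eq cls_def)

lemma mem_cls:
  assumes "basic_at U k" "s \<in> carrier (sec_at U k)"
  shows "(l, u) \<in> cls U k s \<longleftrightarrow> basic_at U l \<and> u \<in> carrier (sec_at U l) \<and> cls U l u = cls U k s"
proof -
  have "(l, u) \<in> cls U k s \<longleftrightarrow> basic_at U l \<and> u \<in> carrier (sec_at U l) \<and> (\<exists>m. k \<le> m \<and> l \<le> m \<and> lift U k m s = lift U l m u)"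
    using assms(1) basic_atD[OF assms(1)] stage_eq[of U l] stage_map_eq[of U l] stage_map_eq[of U k]
    by (auto simp: cls_def germ_def basic_at_def)
  then show ?thesis using cls_eq_iff[OF assms(1) _ assms(2), of l u] by auto
qed

lemma cls_cases:
  assumes "U \<in> lim_basis \<X> p" "a \<in> carrier (pre_sec \<X> p ps U)"
  obtains k s where "n \<le> k" "basic_at U k" "s \<in> carrier (sec_at U k)" "a = cls U k s"
proof (rule poisson_direct_system.germ_cases_above[OF direct_system[OF assms(1)]])
  show "a \<in> carrier (direct_limit (level \<X> p U) (stage \<X> p U) (stage_map \<X> p ps U))"
    using assms(2) by (simp add: pre_sec_def)
  fix k s assume *: "n \<le> k" "level \<X> p U \<le> k" "s \<in> carrier (stage \<X> p U k)"
    "a = germ (level \<X> p U) (stage \<X> p U) (stage_map \<X> p ps U) k s"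
  then have "basic_at U k" using assms(1) by (simp add: basic_at_def)
  then show thesis using that * by (simp add: stage_eq cls_def)
qed

lemma cls_cases2:
  assumes "U \<in> lim_basis \<X> p" "a \<in> carrier (pre_sec \<X> p ps U)" "b \<in> carrier (pre_sec \<X> p ps U)"
  obtains k x y where "n \<le> k" "basic_at U k" "x \<in> carrier (sec_at U k)" "y \<in> carrier (sec_at U k)"
    "a = cls U k x" "b = cls U k y"
proof -
  obtain k x where k: "n \<le> k" "basic_at U k" "x \<in> carrier (sec_at U k)" "a = cls U k x"
    using assms(1,2) by (rule cls_cases)
  obtain l y where l: "k \<le> l" "basic_at U l" "y \<in> carrier (sec_at U l)" "b = cls U l y"
    using assms(1,3) by (rule cls_cases)
  show thesis
    using that[of l "lift U k l x" y] k l lift_closed[OF k(2) l(1)] cls_lift[OF k(2) l(1)] by simp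
qed

text \<open>Two representatives agree at some later level, and restriction commutes with lifting, so
  their restrictions agree there too. The union in \<open>pre_res\<close> is thus over a single
  class, with \<open>k\<close> itself as one admissible level.\<close>

lemma pre_res_cls:
  assumes U: "basic_at U k" and V: "basic_at V k" and VU: "V \<subseteq> U" and s: "s \<in> carrier (sec_at U k)"
  shows "pre_res \<X> p ps U V (cls U k s) = cls V k (res_at k U V s)"
proof -
  have "cls V j (res (\<X> j) (trace_open \<X> p U j) (trace_open \<X> p V j) x) = cls V k (res_at k U V s)"
    if x: "(j, x) \<in> cls U k s" and j: "level \<X> p V \<le> j" for j x
  proof -
    have Uj: "basic_at U j" and xj: "x \<in> carrier (sec_at U j)" and "cls U j x = cls U k s"
      using x by (simp_all add: mem_cls[OF U s])
    then obtain m where m: "j \<le> m" "k \<le> m" "lift U j m x = lift U k m s"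
      using cls_eq_iff[OF Uj U xj s] by blast
    have Vj: "basic_at V j" using j basic_atD(1)[OF V] by (simp add: basic_at_def)
    have "lift V j m (res_at j U V x) = lift V k m (res_at k U V s)"
      using res_at_lift[OF Uj Vj VU m(1) xj] res_at_lift[OF U V VU m(2) s] m(3) by simp
    then have "cls V j (res_at j U V x) = cls V k (res_at k U V s)"
      using cls_eq_iff[OF Vj V res_at_closed[OF Uj Vj VU xj] res_at_closed[OF U V VU s]] m by blast
    then show ?thesis using trace_open_eq[OF Uj] trace_open_eq[OF Vj] by simp
  qed
  moreover have "(k, s) \<in> cls U k s" using U s by (simp add: mem_cls)
  ultimately have "{cls V j (res (\<X> j) (trace_open \<X> p U j) (trace_open \<X> p V j) x) |j x.
      (j, x) \<in> cls U k s \<and> level \<X> p V \<le> j} = {cls V k (res_at k U V s)}"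
    using basic_atD(2)[OF V] by blast
  then show ?thesis by (simp add: pre_res_def flip: cls_def)
qed

lemma
  assumes "basic_at U k" "x \<in> carrier (sec_at U k)"
  shows cls_mult: "y \<in> carrier (sec_at U k) \<Longrightarrow> cls U k x \<otimes>\<^bsub>pre_sec \<X> p ps U\<^esub> cls U k y = cls U k (x \<otimes>\<^bsub>sec_at U k\<^esub> y)"
    and cls_add: "y \<in> carrier (sec_at U k) \<Longrightarrow> cls U k x \<oplus>\<^bsub>pre_sec \<X> p ps U\<^esub> cls U k y = cls U k (x \<oplus>\<^bsub>sec_at U k\<^esub> y)"
    and cls_bracket: "y \<in> carrier (sec_at U k) \<Longrightarrow> \<lbrace>cls U k x, cls U k y\<rbrace>\<^bsub>pre_sec \<X> p ps U\<^esub> = cls U k \<lbrace>x, y\<rbrace>\<^bsub>sec_at U k\<^esub>"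
    and cls_smult: "c \<in> carrier F \<Longrightarrow> c \<odot>\<^bsub>pre_sec \<X> p ps U\<^esub> cls U k x = cls U k (c \<odot>\<^bsub>sec_at U k\<^esub> x)"
  using poisson_direct_system.germ_mult[OF direct_system, of U k x y]
    poisson_direct_system.germ_add[OF direct_system, of U k x y]
    poisson_direct_system.germ_bracket[OF direct_system, of U k x y]
    poisson_direct_system.germ_smult[OF direct_system, of U c k x] assms
  by (simp_all add: basic_atD stage_eq pre_sec_def cls_def)

lemma cls_one: "basic_at U k \<Longrightarrow> \<one>\<^bsub>pre_sec \<X> p ps U\<^esub> = cls U k \<one>\<^bsub>sec_at U k\<^esub>"
  using poisson_direct_system.germ_one[OF direct_system, of U k]
  by (simp add: basic_atD stage_eq pre_sec_def cls_def)

lemma pre_res_hom: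
  assumes U: "U \<in> lim_basis \<X> p" and V: "V \<in> lim_basis \<X> p" and VU: "V \<subseteq> U"
  shows "pre_res \<X> p ps U V \<in> poisson_hom F (pre_sec \<X> p ps U) (pre_sec \<X> p ps V)"
proof (rule poisson_homI)
  have Vat: "basic_at V k" if "level \<X> p V \<le> k" for k using V that by (simp add: basic_at_def)
  { fix a b assume a: "a \<in> carrier (pre_sec \<X> p ps U)" and b: "b \<in> carrier (pre_sec \<X> p ps U)"
    obtain k x y where k: "level \<X> p V \<le> k" "basic_at U k" and x: "x \<in> carrier (sec_at U k)"
      and y: "y \<in> carrier (sec_at U k)" and ab: "a = cls U k x" "b = cls U k y"
      using U a b by (rule cls_cases2)
    interpret A: poisson_algebra F "sec_at U k" by (rule sheaf_sec[OF sheaf trace_is_open[OF k(2)]])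
    note V = Vat[OF k(1)]
    note h = res_at_hom[OF k(2) V VU]
    note r = pre_res_cls[OF k(2) V VU]
    note cl = res_at_closed[OF k(2) V VU x] res_at_closed[OF k(2) V VU y]
    show "pre_res \<X> p ps U V a \<in> carrier (pre_sec \<X> p ps V)"
      using r[OF x] cls_closed[OF V cl(1)] ab by simp
    show "pre_res \<X> p ps U V (a \<otimes>\<^bsub>pre_sec \<X> p ps U\<^esub> b)
        = pre_res \<X> p ps U V a \<otimes>\<^bsub>pre_sec \<X> p ps V\<^esub> pre_res \<X> p ps U V b"
      using x y by (simp add: ab cls_mult[OF k(2)] cls_mult[OF V] cl r poisson_hom_mult[OF h])
    show "pre_res \<X> p ps U V (a \<oplus>\<^bsub>pre_sec \<X> p ps U\<^esub> b)
        = pre_res \<X> p ps U V a \<oplus>\<^bsub>pre_sec \<X> p ps V\<^esub> pre_res \<X> p ps U V b"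
      using x y by (simp add: ab cls_add[OF k(2)] cls_add[OF V] cl r poisson_hom_add[OF h])
    show "pre_res \<X> p ps U V \<lbrace>a, b\<rbrace>\<^bsub>pre_sec \<X> p ps U\<^esub>
        = \<lbrace>pre_res \<X> p ps U V a, pre_res \<X> p ps U V b\<rbrace>\<^bsub>pre_sec \<X> p ps V\<^esub>"
      using x y by (simp add: ab cls_bracket[OF k(2)] cls_bracket[OF V] cl r poisson_hom_bracket[OF h] A.pb_closed)
    show "pre_res \<X> p ps U V (c \<odot>\<^bsub>pre_sec \<X> p ps U\<^esub> a) = c \<odot>\<^bsub>pre_sec \<X> p ps V\<^esub> pre_res \<X> p ps U V a"
      if "c \<in> carrier F" for c
      using x that by (simp add: ab cls_smult[OF k(2)] cls_smult[OF V] cl r poisson_hom_smult[OF h]) }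
  let ?k = "max (level \<X> p U) (level \<X> p V)"
  have k: "basic_at U ?k" "basic_at V ?k" using U V by (simp_all add: basic_at_def)
  interpret A: poisson_algebra F "sec_at U ?k" by (rule sheaf_sec[OF sheaf trace_is_open[OF k(1)]])
  show "pre_res \<X> p ps U V \<one>\<^bsub>pre_sec \<X> p ps U\<^esub> = \<one>\<^bsub>pre_sec \<X> p ps V\<^esub>"
    using pre_res_cls[OF k VU A.one_closed] cls_one[OF k(1)] cls_one[OF k(2)] poisson_hom_one[OF res_at_hom[OF k VU]]
    by simp
qed

lemma pre_res_closed: "U \<in> lim_basis \<X> p \<Longrightarrow> V \<in> lim_basis \<X> p \<Longrightarrow> V \<subseteq> U \<Longrightarrow> a \<in> carrier (pre_sec \<X> p ps U)
    \<Longrightarrow> pre_res \<X> p ps U V a \<in> carrier (pre_sec \<X> p ps V)"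
  using poisson_hom_closed[OF pre_res_hom] .

lemma pre_res_id:
  assumes "U \<in> lim_basis \<X> p" "a \<in> carrier (pre_sec \<X> p ps U)"
  shows "pre_res \<X> p ps U U a = a"
proof -
  obtain k s where k: "basic_at U k" "s \<in> carrier (sec_at U k)" "a = cls U k s"
    using assms by (rule cls_cases)
  then show ?thesis using pre_res_cls[OF k(1,1) order_refl k(2)] sheaf_res_id[OF sheaf trace_is_open[OF k(1)] k(2)] by simp
qed

lemma pre_res_pre_res:
  assumes U: "U \<in> lim_basis \<X> p" and V: "V \<in> lim_basis \<X> p" and W: "W \<in> lim_basis \<X> p"
    and sub: "W \<subseteq> V" "V \<subseteq> U" and a: "a \<in> carrier (pre_sec \<X> p ps U)"
  shows "pre_res \<X> p ps V W (pre_res \<X> p ps U V a) = pre_res \<X> p ps U W a"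
proof -
  obtain k s where k: "max (level \<X> p V) (level \<X> p W) \<le> k" "basic_at U k" and s: "s \<in> carrier (sec_at U k)" "a = cls U k s"
    using U a by (rule cls_cases)
  have at: "basic_at V k" "basic_at W k" using k(1) V W by (simp_all add: basic_at_def)
  have WU: "W \<subseteq> U" using sub by blast
  show ?thesis
    using pre_res_cls[OF k(2) at(1) sub(2) s(1)] pre_res_cls[OF k(2) at(2) WU s(1)]
      pre_res_cls[OF at sub(1) res_at_closed[OF k(2) at(1) sub(2) s(1)]] res_at_res_at[OF k(2) at sub s(1)] s(2) by simp
qed

end

section \<open>Gluing\<close>

lemma restrict_inverse_limit_hom:
  assumes "J \<subseteq> I"
  shows "(\<lambda>s. restrict s J) \<in> poisson_hom F (inverse_limit I D r) (inverse_limit J D r)"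
proof (rule poisson_homI)
  show "restrict s J \<in> carrier (inverse_limit J D r)" if "s \<in> carrier (inverse_limit I D r)" for s
    using that subsetD[OF assms] by (simp add: inverse_limit_def PiE_iff)
qed (use subsetD[OF assms] in \<open>auto simp: inverse_limit_def fun_eq_iff restrict_def\<close>)

section \<open>Uniqueness and existence of glued sections on basic sets\<close>

context provariety_system
begin

text \<open>The level at which agreement on \<open>C\<close> becomes visible depends on
  \<open>C\<close>. Once \<open>basic_cover\<close> finds one level where the open sets of visible
  agreement cover, separation of the structure sheaf at that level concludes. An empty
  \<open>\<C>\<close> is allowed and shows that only one section lives on the empty set.\<close>

lemma pre_sec_eqI:
  assumes U: "U \<in> lim_basis \<X> p" and a: "a \<in> carrier (pre_sec \<X> p ps U)" and b: "b \<in> carrier (pre_sec \<X> p ps U)"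
    and \<C>: "\<And>C. C \<in> \<C> \<Longrightarrow> C \<in> lim_basis \<X> p \<and> C \<subseteq> U" and cov: "U \<subseteq> \<Union>\<C>"
    and eq: "\<And>C. C \<in> \<C> \<Longrightarrow> pre_res \<X> p ps U C a = pre_res \<X> p ps U C b"
  shows "a = b"
proof -
  obtain n x y where n: "basic_at U n" and x: "x \<in> carrier (sec_at U n)" and y: "y \<in> carrier (sec_at U n)"
    and ab: "a = cls U n x" "b = cls U n y" using U a b by (rule cls_cases2)
  have at: "basic_at U k" if "n \<le> k" for k using basic_at_mono[OF n that] .
  define G where "G k W \<longleftrightarrow> n \<le> k \<and> is_open (\<X> k) W \<and> W \<subseteq> trace U k \<and>
    res (\<X> k) (trace U k) W (lift U n k x) = res (\<X> k) (trace U k) W (lift U n k y)" for k W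
  have "\<exists>k \<F>. n \<le> k \<and> finite \<F> \<and> (\<forall>W\<in>\<F>. G k W) \<and> \<Union>\<F> = trace U k"
  proof (rule basic_cover[OF n])
    show "n \<le> k \<and> is_open (\<X> k) W \<and> W \<subseteq> trace U k" if "G k W" for k W using that by (simp add: G_def)
    show "G m (pb m k W)" if G: "G k W" and km: "k \<le> m" for k m W
    proof -
      have k: "n \<le> k" and W: "is_open (\<X> k) W" "W \<subseteq> trace U k"
        and e: "res (\<X> k) (trace U k) W (lift U n k x) = res (\<X> k) (trace U k) W (lift U n k y)"
        using G by (simp_all add: G_def)
      have r: "res (\<X> m) (trace U m) (pb m k W) (lift U n m s) = ps m k W (res (\<X> k) (trace U k) W (lift U n k s))"
        if s: "s \<in> carrier (sec_at U n)" for s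
        using ps_res[OF km trace_is_open[OF at[OF k]] W lift_closed[OF n k s]] trace_pb[OF at[OF k] km] lift_lift[OF n k km s]
        by simp
      have "pb m k W \<subseteq> trace U m" using pb_mono[OF W(2), of m k] trace_pb[OF at[OF k] km] by simp
      then show ?thesis using r[OF x] r[OF y] e k km pb_open[OF km W(1)] by (simp add: G_def)
    qed
    fix \<xi> assume "\<xi> \<in> U"
    then obtain C where C: "C \<in> \<C>" "\<xi> \<in> C" using cov by blast
    have CU: "C \<subseteq> U" and CB: "C \<in> lim_basis \<X> p" using \<C>[OF C(1)] by simp_all
    let ?k = "max n (level \<X> p C)"
    have nk: "n \<le> ?k" and Ck: "basic_at C ?k" using CB by (simp_all add: basic_at_def)
    note x' = lift_closed[OF n nk x] and y' = lift_closed[OF n nk y]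
    have "cls C ?k (res_at ?k U C (lift U n ?k x)) = cls C ?k (res_at ?k U C (lift U n ?k y))"
      using eq[OF C(1)] pre_res_cls[OF at[OF nk] Ck CU x'] pre_res_cls[OF at[OF nk] Ck CU y']
        cls_lift[OF n nk x] cls_lift[OF n nk y] ab by simp
    then obtain m where m: "?k \<le> m"
      "lift C ?k m (res_at ?k U C (lift U n ?k x)) = lift C ?k m (res_at ?k U C (lift U n ?k y))"
      using cls_eq_iff[OF Ck Ck res_at_closed[OF at[OF nk] Ck CU x'] res_at_closed[OF at[OF nk] Ck CU y']] by blast
    \<comment> \<open>Equality of classes is equality after lifting to some \<open>m\<close>; moving
      the lift inside the restriction makes \<open>trace C m\<close> a set of agreement.\<close>
    then have "res_at m U C (lift U n m x) = res_at m U C (lift U n m y)"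
      using res_at_lift[OF at[OF nk] Ck CU m(1) x'] res_at_lift[OF at[OF nk] Ck CU m(1) y']
        lift_lift[OF n nk m(1) x] lift_lift[OF n nk m(1) y] by simp
    then have "G m (trace C m)"
      using trace_is_open[OF basic_at_mono[OF Ck m(1)]] trace_mono[OF CU] m(1) by (simp add: G_def)
    moreover have "\<xi> m \<in> trace C m" using C(2) by (simp add: trace_def)
    ultimately show "\<exists>k W. G k W \<and> \<xi> k \<in> W" by blast
  qed
  then obtain k \<F> where k: "n \<le> k" and \<F>: "\<forall>W\<in>\<F>. G k W" and un: "\<Union>\<F> = trace U k"
    by (elim exE conjE)
  have "lift U n k x = lift U n k y"
  proof (rule sheaf_sections_eqI[OF sheaf[of k], where \<U> = \<F>])
    show "is_open (\<X> k) V" "res (\<X> k) (\<Union>\<F>) V (lift U n k x) = res (\<X> k) (\<Union>\<F>) V (lift U n k y)" if "V \<in> \<F>" for V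
      using \<F> that by (simp_all add: G_def un)
  qed (use lift_closed[OF n k x] lift_closed[OF n k y] un in simp_all)
  then show ?thesis using cls_lift[OF n k x] cls_lift[OF n k y] ab by simp
qed

text \<open>Because of \<open>down\<close>, the overlap of two members belongs to
  \<open>\<C>\<close>, so \<open>compat\<close>, stated only along inclusions, also yields agreement
  on overlaps. Level \<open>k\<close> provides a finite cover by represented sections, level
  \<open>m\<close> their actual agreement, and the gluing takes place in the structure sheaf of
  \<open>\<X> m\<close>.\<close>

lemma pre_sec_glue:
  assumes U: "U \<in> lim_basis \<X> p"
    and \<C>: "\<And>C. C \<in> \<C> \<Longrightarrow> C \<in> lim_basis \<X> p \<and> C \<subseteq> U" and cov: "U \<subseteq> \<Union>\<C>"
    and down: "\<And>C D. C \<in> \<C> \<Longrightarrow> D \<in> lim_basis \<X> p \<Longrightarrow> D \<subseteq> C \<Longrightarrow> D \<in> \<C>"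
    and c: "\<And>C. C \<in> \<C> \<Longrightarrow> c C \<in> carrier (pre_sec \<X> p ps C)"
    and compat: "\<And>C D. C \<in> \<C> \<Longrightarrow> D \<in> \<C> \<Longrightarrow> D \<subseteq> C \<Longrightarrow> pre_res \<X> p ps C D (c C) = c D"
  shows "\<exists>a\<in>carrier (pre_sec \<X> p ps U). \<forall>C\<in>\<C>. pre_res \<X> p ps U C a = c C"
proof -
  let ?n = "level \<X> p U"
  have n: "basic_at U ?n" using U by (simp add: basic_at_def)
  have at: "basic_at U k" if "?n \<le> k" for k using basic_at_mono[OF n that] .
  \<comment> \<open>These are the traces of those members whose prescribed section is already
    represented at level \<open>k\<close>; lifting a representative makes them stable under
    pullback.\<close>
  define G where "G k W \<longleftrightarrow> ?n \<le> k \<and> (\<exists>C\<in>\<C>. basic_at C k \<and> W = trace C k \<and>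
    (\<exists>x\<in>carrier (sec_at C k). c C = cls C k x))" for k W
  have "\<exists>k \<F>. ?n \<le> k \<and> finite \<F> \<and> (\<forall>W\<in>\<F>. G k W) \<and> \<Union>\<F> = trace U k"
  proof (rule basic_cover[OF n])
    show "?n \<le> k \<and> is_open (\<X> k) W \<and> W \<subseteq> trace U k" if "G k W" for k W
    proof -
      obtain C where "C \<in> \<C>" "basic_at C k" "W = trace C k" "?n \<le> k" using \<open>G k W\<close> unfolding G_def by blast
      then show ?thesis using trace_is_open[of C k] trace_mono[of C U k] \<C>[of C] by simp
    qed
    show "G m (pb m k W)" if G: "G k W" and km: "k \<le> m" for k m W
    proof -
      obtain C x where C: "C \<in> \<C>" "basic_at C k" "W = trace C k" "?n \<le> k" and x: "x \<in> carrier (sec_at C k)" "c C = cls C k x"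
        using G unfolding G_def by blast
      have "lift C k m x \<in> carrier (sec_at C m)" "c C = cls C m (lift C k m x)"
        using lift_closed[OF C(2) km x(1)] cls_lift[OF C(2) km x(1)] x(2) by simp_all
      moreover have "basic_at C m" "pb m k W = trace C m" using basic_at_mono[OF C(2) km] trace_pb[OF C(2) km] C(3) by simp_all
      moreover have "?n \<le> m" using C(4) km by simp
      ultimately show ?thesis using C(1) unfolding G_def by blast
    qed
    fix \<xi> assume "\<xi> \<in> U"
    then obtain C where C: "C \<in> \<C>" "\<xi> \<in> C" using cov by blast
    then have CB: "C \<in> lim_basis \<X> p" using \<C> by simp
    obtain k x where k: "?n \<le> k" "basic_at C k" "x \<in> carrier (sec_at C k)" "c C = cls C k x"
      using CB c[OF C(1)] by (rule cls_cases)
    then have "G k (trace C k)" using C(1) unfolding G_def by blast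
    moreover have "\<xi> k \<in> trace C k" using C(2) by (simp add: trace_def)
    ultimately show "\<exists>k W. G k W \<and> \<xi> k \<in> W" by blast
  qed
  then obtain k \<F> where k: "?n \<le> k" and fin: "finite \<F>" and \<F>: "\<forall>W\<in>\<F>. G k W" and un: "\<Union>\<F> = trace U k"
    by (elim exE conjE)
  \<comment> \<open>Each \<open>W\<close> in \<open>\<F>\<close> is the trace of some member of
    \<open>\<C>\<close>. At this level a basic set is the cylinder over its trace, so that member is
    recovered without a choice.\<close>
  define E where "E W = cylinder \<X> p k W" for W
  have EW: "E W \<in> \<C> \<and> basic_at (E W) k \<and> trace (E W) k = W \<and> (\<exists>x\<in>carrier (sec_at (E W) k). c (E W) = cls (E W) k x)"
    if W: "W \<in> \<F>" for W
  proof -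
    obtain C where C: "C \<in> \<C>" "basic_at C k" "W = trace C k" "\<exists>x\<in>carrier (sec_at C k). c C = cls C k x"
      using \<F> W unfolding G_def by blast
    then have "E W = C" using cylinder_trace by (simp add: E_def)
    then show ?thesis using C by simp
  qed
  then obtain x where x: "\<And>W. W \<in> \<F> \<Longrightarrow> x W \<in> carrier (sec_at (E W) k)" "\<And>W. W \<in> \<F> \<Longrightarrow> c (E W) = cls (E W) k (x W)"
    by metis
  have EC: "E W \<in> \<C>" and Ek: "basic_at (E W) k" and Et: "trace (E W) k = W" if "W \<in> \<F>" for W using EW[OF that] by simp_all
  have EB: "E W \<in> lim_basis \<X> p" if "W \<in> \<F>" for W using basic_atD(1)[OF Ek[OF that]] .
  have "\<exists>m\<ge>k. lift (E W \<inter> E W') k m (res_at k (E W) (E W \<inter> E W') (x W))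
      = lift (E W \<inter> E W') k m (res_at k (E W') (E W \<inter> E W') (x W'))" if W: "W \<in> \<F>" and W': "W' \<in> \<F>" for W W'
  proof -
    note D = basic_at_Int(1)[OF Ek[OF W] Ek[OF W']]
    have "E W \<inter> E W' \<in> \<C>" using down[OF EC[OF W] basic_atD(1)[OF D]] by blast
    then have "pre_res \<X> p ps (E W) (E W \<inter> E W') (c (E W)) = pre_res \<X> p ps (E W') (E W \<inter> E W') (c (E W'))"
      using compat EC[OF W] EC[OF W'] by simp
    then have "cls (E W \<inter> E W') k (res_at k (E W) (E W \<inter> E W') (x W))
        = cls (E W \<inter> E W') k (res_at k (E W') (E W \<inter> E W') (x W'))"
      using pre_res_cls[OF Ek[OF W] D Int_lower1 x(1)[OF W]] pre_res_cls[OF Ek[OF W'] D Int_lower2 x(1)[OF W']]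
        x(2)[OF W] x(2)[OF W'] by simp
    then show ?thesis
      using cls_eq_iff[OF D D res_at_closed[OF Ek[OF W] D Int_lower1 x(1)[OF W]] res_at_closed[OF Ek[OF W'] D Int_lower2 x(1)[OF W']]]
      by blast
  qed
  then obtain \<mu> where \<mu>: "\<And>W W'. W \<in> \<F> \<Longrightarrow> W' \<in> \<F> \<Longrightarrow> k \<le> \<mu> W W' \<and>
      lift (E W \<inter> E W') k (\<mu> W W') (res_at k (E W) (E W \<inter> E W') (x W))
      = lift (E W \<inter> E W') k (\<mu> W W') (res_at k (E W') (E W \<inter> E W') (x W'))" by metis
  \<comment> \<open>Finitely many pairs, each agreeing from some level on. The inserted
    \<open>k\<close> ensures \<open>k \<le> m\<close> and keeps the set nonempty when
    \<open>\<F>\<close> is empty.\<close>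
  define m where "m = Max (insert k ((\<lambda>(W, W'). \<mu> W W') ` (\<F> \<times> \<F>)))"
  have fin': "finite (insert k ((\<lambda>(W, W'). \<mu> W W') ` (\<F> \<times> \<F>)))" using fin by simp
  have km: "k \<le> m" unfolding m_def by (rule Max_ge[OF fin']) simp
  have \<mu>m: "\<mu> W W' \<le> m" if "W \<in> \<F>" "W' \<in> \<F>" for W W'
    unfolding m_def by (rule Max_ge[OF fin']) (use that in force)
  note Em = basic_at_mono[OF Ek km]
  let ?x = "\<lambda>W. lift (E W) k m (x W)"
  have xm: "?x W \<in> carrier (sec_at (E W) m)" if "W \<in> \<F>" for W using lift_closed[OF Ek[OF that] km x(1)[OF that]] .
  have agree: "res_at m (E W) (E W \<inter> E W') (?x W) = res_at m (E W') (E W \<inter> E W') (?x W')" if W: "W \<in> \<F>" and W': "W' \<in> \<F>" for W W'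
  proof -
    note D = basic_at_Int(1)[OF Ek[OF W] Ek[OF W']]
    note \<mu>1 = conjunct1[OF \<mu>[OF W W']] and \<mu>2 = conjunct2[OF \<mu>[OF W W']]
    have "lift (E W \<inter> E W') k m (res_at k (E W) (E W \<inter> E W') (x W))
        = lift (E W \<inter> E W') k m (res_at k (E W') (E W \<inter> E W') (x W'))"
      using lift_lift[OF D \<mu>1 \<mu>m[OF W W'] res_at_closed[OF Ek[OF W] D Int_lower1 x(1)[OF W]]]
        lift_lift[OF D \<mu>1 \<mu>m[OF W W'] res_at_closed[OF Ek[OF W'] D Int_lower2 x(1)[OF W']]] \<mu>2 by simp
    then show ?thesis
      using res_at_lift[OF Ek[OF W] D Int_lower1 km x(1)[OF W]] res_at_lift[OF Ek[OF W'] D Int_lower2 km x(1)[OF W']] by simp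
  qed
  have um: "\<Union>((\<lambda>W. trace (E W) m) ` \<F>) = trace U m"
  proof -
    have "(\<lambda>W. trace (E W) m) ` \<F> = pb m k ` \<F>"
      using trace_pb[OF Ek km] Et by (intro image_cong) auto
    then show ?thesis using pb_Union[of m k \<F>] un trace_pb[OF at[OF k] km] by simp
  qed
  obtain y where y: "y \<in> carrier (sec_at U m)" and yr: "\<And>W. W \<in> \<F> \<Longrightarrow> res_at m U (E W) y = ?x W"
  proof (rule sheaf_indexed_glue[OF sheaf[of m], where I = \<F> and V = "\<lambda>W. trace (E W) m" and s = ?x])
    show "is_open (\<X> m) (trace (E W) m)" if "W \<in> \<F>" for W using trace_is_open[OF Em[OF that]] .
    show "?x W \<in> carrier (sec_at (E W) m)" if "W \<in> \<F>" for W using xm[OF that] .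
    show "res (\<X> m) (trace (E W) m) (trace (E W) m \<inter> trace (E W') m) (?x W)
        = res (\<X> m) (trace (E W') m) (trace (E W) m \<inter> trace (E W') m) (?x W')" if "W \<in> \<F>" "W' \<in> \<F>" for W W'
      using agree[OF that] basic_at_Int(2)[OF Em[OF that(1)] Em[OF that(2)]] by simp
  qed (use that um in simp)
  have Um: "basic_at U m" using at[OF order_trans[OF k km]] .
  have EU: "E W \<subseteq> U" if "W \<in> \<F>" for W using \<C>[OF EC[OF that]] by simp
  let ?a = "cls U m y"
  have a: "?a \<in> carrier (pre_sec \<X> p ps U)" using cls_closed[OF Um y] .
  have aE: "pre_res \<X> p ps U (E W) ?a = c (E W)" if W: "W \<in> \<F>" for W
    using pre_res_cls[OF Um Em[OF W] EU[OF W] y] yr[OF W] cls_lift[OF Ek[OF W] km x(1)[OF W]] x(2)[OF W] by simp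
  have UE: "U \<subseteq> \<Union>(E ` \<F>)"
  proof
    fix \<xi> assume \<xi>: "\<xi> \<in> U"
    then have "\<xi> k \<in> \<Union>\<F>" unfolding un by (simp add: trace_def)
    moreover have "\<xi> \<in> lim_points \<X> p" using \<xi> cylinder_trace[OF at[OF k]] mem_cylinder by blast
    ultimately show "\<xi> \<in> \<Union>(E ` \<F>)" by (auto simp: E_def mem_cylinder)
  qed
  \<comment> \<open>So far the restriction is known only on the finite subcover. An arbitrary
    \<open>C\<close> is covered by its intersections with the sets \<open>E W\<close>, where both
    sides equal the prescribed section, so uniqueness applies.\<close>
  have "pre_res \<X> p ps U C ?a = c C" if C: "C \<in> \<C>" for C
  proof (rule pre_sec_eqI[where \<C> = "(\<lambda>W. C \<inter> E W) ` \<F>"])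
    have CB: "C \<in> lim_basis \<X> p" and CU: "C \<subseteq> U" using \<C>[OF C] by simp_all
    show "C \<in> lim_basis \<X> p" by (rule CB)
    show "pre_res \<X> p ps U C ?a \<in> carrier (pre_sec \<X> p ps C)" by (rule pre_res_closed[OF U CB CU a])
    show "c C \<in> carrier (pre_sec \<X> p ps C)" by (rule c[OF C])
    show "C \<subseteq> \<Union>((\<lambda>W. C \<inter> E W) ` \<F>)" using UE CU by blast
    fix D assume "D \<in> (\<lambda>W. C \<inter> E W) ` \<F>"
    then obtain W where W: "W \<in> \<F>" and D: "D = C \<inter> E W" by blast
    have DB: "D \<in> lim_basis \<X> p" unfolding D by (rule basis_Int[OF CB EB[OF W]])
    have sub: "D \<subseteq> C" "D \<subseteq> E W" using D by simp_all
    show "D \<in> lim_basis \<X> p \<and> D \<subseteq> C" using DB sub by simp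
    have "D \<in> \<C>" by (rule down[OF C DB sub(1)])
    have "pre_res \<X> p ps C D (pre_res \<X> p ps U C ?a) = pre_res \<X> p ps (E W) D (pre_res \<X> p ps U (E W) ?a)"
      using pre_res_pre_res[OF U CB DB sub(1) CU a] pre_res_pre_res[OF U EB[OF W] DB sub(2) EU[OF W] a] by simp
    also have "\<dots> = c D" using aE[OF W] compat[OF EC[OF W] \<open>D \<in> \<C>\<close> sub(2)] by simp
    also have "\<dots> = pre_res \<X> p ps C D (c C)" using compat[OF C \<open>D \<in> \<C>\<close> sub(1)] by simp
    finally show "pre_res \<X> p ps C D (pre_res \<X> p ps U C ?a) = pre_res \<X> p ps C D (c C)" .
  qed
  then show ?thesis using a by blast
qed

section \<open>Extension from basic sets to all open sets\<close>

abbreviation basis_in :: "(nat \<Rightarrow> 'a) set \<Rightarrow> (nat \<Rightarrow> 'a) set set" where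
  "basis_in U \<equiv> {V \<in> lim_basis \<X> p. V \<subseteq> U}"

abbreviation lim_sec :: "(nat \<Rightarrow> 'a) set \<Rightarrow> ('f, (nat \<Rightarrow> 'a) set \<Rightarrow> (nat \<times> 's) set) poisson" where
  "lim_sec U \<equiv> inverse_limit (basis_in U) (pre_sec \<X> p ps) (pre_res \<X> p ps)"

lemma mem_lim_sec: "s \<in> carrier (lim_sec U) \<longleftrightarrow> s \<in> extensional (basis_in U) \<and>
    (\<forall>V\<in>basis_in U. s V \<in> carrier (pre_sec \<X> p ps V)) \<and>
    (\<forall>V\<in>basis_in U. \<forall>W\<in>basis_in U. W \<subseteq> V \<longrightarrow> pre_res \<X> p ps V W (s V) = s W)"
  by (auto simp: inverse_limit_def PiE_iff)

text \<open>A section over an open set is by definition a compatible family on its basic subsets, so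
  restriction is restriction of functions. The work lies in basic subsets of the union that fit into
  no single member of the cover: their values are glued from smaller basic sets that do.\<close>

theorem provariety_sheaf: "sheaf_of_poisson_algebras F (provariety \<X> p ps)"
  unfolding sheaf_of_poisson_algebras_def sheaf_of_def
proof (intro conjI allI impI ballI)
  have F: "cring F" using poisson_algebra_base[OF sheaf_sec[OF sheaf[of 0] openin_topspace]] .
  let ?Y = "provariety \<X> p ps"
  have sec: "sec ?Y U = lim_sec U" and res: "res ?Y U V s = restrict s (basis_in V)"
    and top: "topol ?Y = lim_topology \<X> p" for U V s
    by (simp_all add: provariety_def)
  show "poisson_algebra F (sec ?Y U)" for U
    unfolding sec using F pre_sec_algebra pre_res_hom by (intro inverse_limit_poisson_algebra) simp_all
  show "res ?Y U V \<in> poisson_hom F (sec ?Y U) (sec ?Y V)" if "is_open ?Y U \<and> is_open ?Y V \<and> V \<subseteq> U" for U V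
  proof -
    have "basis_in V \<subseteq> basis_in U" using that by blast
    then have "(\<lambda>s. restrict s (basis_in V)) \<in> poisson_hom F (lim_sec U) (lim_sec V)"
      by (rule restrict_inverse_limit_hom)
    then show ?thesis unfolding sec by (simp add: provariety_def)
  qed
  show "res ?Y U U s = s" if "s \<in> carrier (sec ?Y U)" for U s
    using that unfolding sec res by (simp add: mem_lim_sec extensional_restrict)
  show "res ?Y V W (res ?Y U V s) = res ?Y U W s" if "is_open ?Y U \<and> is_open ?Y V \<and> is_open ?Y W \<and> W \<subseteq> V \<and> V \<subseteq> U" for U V W s
  proof -
    have "basis_in V \<inter> basis_in W = basis_in W" using that by auto
    then show ?thesis unfolding res by simp
  qed
  fix \<U> s
  assume H: "(\<forall>V\<in>\<U>. is_open ?Y V \<and> s V \<in> carrier (sec ?Y V)) \<and>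
    (\<forall>V\<in>\<U>. \<forall>W\<in>\<U>. res ?Y V (V \<inter> W) (s V) = res ?Y W (V \<inter> W) (s W))"
  then have op: "\<And>V. V \<in> \<U> \<Longrightarrow> openin (lim_topology \<X> p) V" and s: "\<And>V. V \<in> \<U> \<Longrightarrow> s V \<in> carrier (lim_sec V)"
    unfolding sec top by simp_all
  have agree: "restrict (s V) (basis_in (V \<inter> W)) = restrict (s W) (basis_in (V \<inter> W))" if "V \<in> \<U>" "W \<in> \<U>" for V W
    using bspec[OF bspec[OF conjunct2[OF H] that(1)] that(2)] unfolding res .
  define fine where "fine C \<longleftrightarrow> C \<in> lim_basis \<X> p \<and> (\<exists>V\<in>\<U>. C \<subseteq> V)" for C
  define c where "c C = s (SOME V. V \<in> \<U> \<and> C \<subseteq> V) C" for C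
  \<comment> \<open>The choice in \<open>c\<close> is immaterial: if \<open>C\<close> lies in both
    \<open>V\<close> and \<open>W\<close>, it is a basic subset of \<open>V \<inter> W\<close>,
    where \<open>s V\<close> and \<open>s W\<close> agree.\<close>
  have c: "c C = s V C" if "V \<in> \<U>" "C \<in> lim_basis \<X> p" "C \<subseteq> V" for V C
  proof -
    define W where "W = (SOME V. V \<in> \<U> \<and> C \<subseteq> V)"
    have W: "W \<in> \<U> \<and> C \<subseteq> W" unfolding W_def by (rule someI[of _ V]) (use that in simp)
    then have "C \<in> basis_in (V \<inter> W)" using that by simp
    then show ?thesis using fun_cong[OF agree[of V W], of C] W that(1) by (simp add: c_def flip: W_def)
  qed
  have c_closed: "c C \<in> carrier (pre_sec \<X> p ps C)" if C: "fine C" for C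
  proof -
    obtain V where "V \<in> \<U>" "C \<in> lim_basis \<X> p" "C \<subseteq> V" using C by (auto simp: fine_def)
    then show ?thesis using c s[of V] by (simp add: mem_lim_sec)
  qed
  have c_res: "pre_res \<X> p ps C D (c C) = c D" if "fine C" "fine D" "D \<subseteq> C" for C D
  proof -
    obtain V where V: "V \<in> \<U>" "C \<in> lim_basis \<X> p" "C \<subseteq> V" using \<open>fine C\<close> by (auto simp: fine_def)
    have D: "D \<in> lim_basis \<X> p" "D \<subseteq> V" using that V by (auto simp: fine_def)
    show ?thesis using c[OF V] c[OF V(1) D] s[OF V(1)] V D that(3) by (simp add: mem_lim_sec)
  qed
  have fine_cover: "D \<subseteq> \<Union>{C. fine C \<and> C \<subseteq> D}" if D: "D \<in> basis_in (\<Union>\<U>)" for D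
  proof
    fix \<xi> assume \<xi>: "\<xi> \<in> D"
    then obtain V where V: "V \<in> \<U>" "\<xi> \<in> V" using D by blast
    obtain C where C: "C \<in> lim_basis \<X> p" "\<xi> \<in> C" "C \<subseteq> V" using basis_refine[OF op[OF V(1)] V(2)] by blast
    have "C \<inter> D \<in> lim_basis \<X> p" using C(1) D by (intro basis_Int) simp_all
    then have "fine (C \<inter> D)" using V(1) C(3) by (auto simp: fine_def)
    then show "\<xi> \<in> \<Union>{C. fine C \<and> C \<subseteq> D}" using C(2) \<xi> by blast
  qed
  have eqI: "a = b" if D: "D \<in> basis_in (\<Union>\<U>)" and "a \<in> carrier (pre_sec \<X> p ps D)" "b \<in> carrier (pre_sec \<X> p ps D)"
    "\<And>C. fine C \<Longrightarrow> C \<subseteq> D \<Longrightarrow> pre_res \<X> p ps D C a = pre_res \<X> p ps D C b" for D a b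
    by (rule pre_sec_eqI[where \<C> = "{C. fine C \<and> C \<subseteq> D}"]) (use that fine_cover[OF D] in \<open>auto simp: fine_def\<close>)
  have "\<exists>a\<in>carrier (pre_sec \<X> p ps D). \<forall>C\<in>{C. fine C \<and> C \<subseteq> D}. pre_res \<X> p ps D C a = c C"
    if D: "D \<in> basis_in (\<Union>\<U>)" for D
  proof (rule pre_sec_glue)
    show "D \<in> lim_basis \<X> p" using D by simp
    show "D \<subseteq> \<Union>{C. fine C \<and> C \<subseteq> D}" by (rule fine_cover[OF D])
    show "C' \<in> {C. fine C \<and> C \<subseteq> D}" if "C \<in> {C. fine C \<and> C \<subseteq> D}" "C' \<in> lim_basis \<X> p" "C' \<subseteq> C" for C C'
      using that by (auto simp: fine_def)
  qed (use c_closed c_res in \<open>auto simp: fine_def\<close>)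
  then obtain a where a: "\<And>D. D \<in> basis_in (\<Union>\<U>) \<Longrightarrow> a D \<in> carrier (pre_sec \<X> p ps D)"
    and ac: "\<And>D C. D \<in> basis_in (\<Union>\<U>) \<Longrightarrow> fine C \<Longrightarrow> C \<subseteq> D \<Longrightarrow> pre_res \<X> p ps D C (a D) = c C"
    by (metis (no_types, lifting) mem_Collect_eq)
  have sub: "basis_in V \<subseteq> basis_in (\<Union>\<U>)" if "V \<in> \<U>" for V using that by blast
  show "\<exists>!b. b \<in> carrier (sec ?Y (\<Union>\<U>)) \<and> (\<forall>V\<in>\<U>. res ?Y (\<Union>\<U>) V b = s V)"
    unfolding sec res
  proof (rule ex1I[of _ "restrict a (basis_in (\<Union>\<U>))"])
    \<comment> \<open>The values \<open>a D\<close> were chosen separately for each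
      \<open>D\<close>. They are compatible since a section over a basic set is determined by its
      restrictions to fine sets, and those are prescribed by \<open>c\<close>.\<close>
    have "pre_res \<X> p ps D D' (a D) = a D'"
      if D: "D \<in> basis_in (\<Union>\<U>)" and D': "D' \<in> basis_in (\<Union>\<U>)" and DD: "D' \<subseteq> D" for D D'
    proof (rule eqI[OF D'])
      have B: "D \<in> lim_basis \<X> p" "D' \<in> lim_basis \<X> p" using D D' by simp_all
      show "pre_res \<X> p ps D D' (a D) \<in> carrier (pre_sec \<X> p ps D')" by (rule pre_res_closed[OF B DD a[OF D]])
      show "a D' \<in> carrier (pre_sec \<X> p ps D')" by (rule a[OF D'])
      fix C assume C: "fine C" "C \<subseteq> D'"
      then have CB: "C \<in> lim_basis \<X> p" and CD: "C \<subseteq> D" using DD by (auto simp: fine_def)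
      show "pre_res \<X> p ps D' C (pre_res \<X> p ps D D' (a D)) = pre_res \<X> p ps D' C (a D')"
        using pre_res_pre_res[OF B CB C(2) DD a[OF D]] ac[OF D C(1) CD] ac[OF D' C] by simp
    qed
    then have "restrict a (basis_in (\<Union>\<U>)) \<in> carrier (lim_sec (\<Union>\<U>))" using a by (simp add: mem_lim_sec)
    moreover have "restrict (restrict a (basis_in (\<Union>\<U>))) (basis_in V) = s V" if V: "V \<in> \<U>" for V
    proof (rule extensionalityI[where A = "basis_in V"])
      show "s V \<in> extensional (basis_in V)" using s[OF V] by (simp add: mem_lim_sec)
      fix D assume D: "D \<in> basis_in V"
      then have D': "D \<in> basis_in (\<Union>\<U>)" using sub[OF V] by blast
      have "fine D" using D V by (auto simp: fine_def)
      \<comment> \<open>A basic subset of a member of the cover is itself fine, so it may be taken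
        as its own fine subset.\<close>
      then have "a D = c D" using ac[OF D' _ order_refl] pre_res_id[of D "a D"] a[OF D'] D by simp
      then show "restrict (restrict a (basis_in (\<Union>\<U>))) (basis_in V) D = s V D" using D D' c[OF V, of D] by simp
    qed (rule restrict_extensional)
    ultimately show "restrict a (basis_in (\<Union>\<U>)) \<in> carrier (lim_sec (\<Union>\<U>)) \<and>
      (\<forall>V\<in>\<U>. restrict (restrict a (basis_in (\<Union>\<U>))) (basis_in V) = s V)" by simp
  next
    fix b assume b: "b \<in> carrier (lim_sec (\<Union>\<U>)) \<and> (\<forall>V\<in>\<U>. restrict b (basis_in V) = s V)"
    show "b = restrict a (basis_in (\<Union>\<U>))"
    proof (rule extensionalityI[where A = "basis_in (\<Union>\<U>)"])
      show "b \<in> extensional (basis_in (\<Union>\<U>))" using b by (simp add: mem_lim_sec)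
      fix D assume D: "D \<in> basis_in (\<Union>\<U>)"
      \<comment> \<open>On fine sets \<open>b\<close> must coincide with the given sections, and
        these values determine it on \<open>D\<close>.\<close>
      have "b D = a D"
      proof (rule eqI[OF D])
        show "b D \<in> carrier (pre_sec \<X> p ps D)" using b D by (simp add: mem_lim_sec)
        show "a D \<in> carrier (pre_sec \<X> p ps D)" by (rule a[OF D])
        fix C assume C: "fine C" "C \<subseteq> D"
        then obtain V where V: "V \<in> \<U>" "C \<in> lim_basis \<X> p" "C \<subseteq> V" by (auto simp: fine_def)
        have "pre_res \<X> p ps D C (b D) = b C" using b D C(2) V by (auto simp: mem_lim_sec)
        also have "b C = s V C" using fun_cong[OF bspec[OF conjunct2[OF b] V(1)], of C] V(2,3) by simp
        finally show "pre_res \<X> p ps D C (b D) = pre_res \<X> p ps D C (a D)"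
          using ac[OF D C] c[OF V] by simp
      qed
      then show "b D = restrict a (basis_in (\<Union>\<U>)) D" using D by simp
    qed simp
  qed
qed

end

theorem mainTheorem6:
  fixes F :: "('f, 'e) ring_scheme"
    and \<X> :: "nat \<Rightarrow> ('a, 's, ('f, 's) poisson) sheafed_space"
    and p :: "nat \<Rightarrow> nat \<Rightarrow> 'a \<Rightarrow> 'a"
    and ps :: "nat \<Rightarrow> nat \<Rightarrow> 'a set \<Rightarrow> 's \<Rightarrow> 's"
  assumes "algebraically_closed F"
    and "\<And>n::nat. n > 0 \<Longrightarrow> [n] \<cdot>\<^bsub>F\<^esub> \<one>\<^bsub>F\<^esub> \<noteq> \<zero>\<^bsub>F\<^esub>"
    and "poisson_system F \<X> p ps"
  shows "sheaf_of_poisson_algebras F (provariety \<X> p ps)"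
proof (rule provariety_system.provariety_sheaf, rule provariety_system.intro)
  have "field F" using assms(1) by (simp add: algebraically_closed_def)
  moreover have "variety F (\<X> n)" for n using assms(3) by (simp add: poisson_system_def irreducible_variety_def)
  ultimately show "noetherian_space (topol (\<X> n))" "sober_space (topol (\<X> n))" for n
    using variety_noetherian_sober by blast+
qed (rule assms(3))

end
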